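(* Let $c>0$ and $\Delta=(0,c]$. Let $\mu$ be an infinitely divisible distribution on $\mathbb R$ with Lévy measure $\nu$, and let $\nu_{(1)}(dx)=\mathbf 1_{(1,\infty)}(x)\,\nu(dx)/\nu((1,\infty))$. For a constant $c_1>1$ let $\mu_{c_1}$ be the compound Poisson distribution with Lévy measure $\nu_{c_1}(dx)=\mathbf 1_{\{c_1<x\}}\nu(dx)$. Suppose that there exists $c_1>1$ such that $\mu_{c_1}\in\mathcal A_\Delta$. Then the following are equivalent: (i) $\mu\in\mathcal S_\Delta\cap\mathcal D_\Delta$; (ii) $\nu_{(1)}\in\mathcal S_\Delta$; (iii) $\nu_{(1)}\in\mathcal L_\Delta\cap\mathcal D_\Delta$ and $\mu(x+\Delta)\sim\nu(x+\Delta)$.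
   Context: An infinitely divisible distribution $\mu$ on $\mathbb R$ has characteristic function $\widehat\mu(z)=\exp\{\int_{-\infty}^\infty(e^{izy}-1-izy\mathbf 1_{\{|y|\le1\}})\nu(dy)+iaz-\frac12b^2z^2\}$ with $a\in\mathbb R$, $b\ge0$ and Lévy measure $\nu$ satisfying $\nu(\{0\})=0$, $\int(1\wedge x^2)\nu(dx)<\infty$. The compound Poisson distribution with finite Lévy measure $\rho$ has characteristic function $\exp\{\int(e^{izy}-1)\rho(dy)\}$. An assertion that $\nu_{(1)}$ belongs to a class includes $\nu((1,\infty))>0$, so that $\nu_{(1)}$ is defined. For $\Delta=(0,c]$ and a measure $F$, $F(x+\Delta):=F((x,x+c])$. $F^{*n}$ is the $n$-fold convolution. $\alpha(x)\sim\beta(x)$ means $\alpha(x)/\beta(x)\to1$ as $x\to\infty$. A non-negative measurable function $\alpha$ belongs to $\mathcal L$ if there is $x_0>0$ with $\alpha(x)>0$ for $x\ge x_0$ and, for every fixed $y>0$, $\alpha(x+y)\sim\alpha(x)$. A distribution $F$ is in $\mathcal L_\Delta$ if the function $x\mapsto F(x+\Delta)$ is in $\mathcal L$. $F\in\mathcal S_\Delta$ if $F\in\mathcal L_\Delta$ and $F^{*2}(x+\Delta)\sim 2F(x+\Delta)$. A function $\alpha:\mathbb R\to\mathbb R_+$ is almost decreasing if there exist $x_0>0$ and $K>0$ such that $\alpha(x+y)\le K\alpha(x)$ for all $x>x_0$, $y>0$. $F\in\mathcal D_\Delta$ if $x\mapsto F(x+\Delta)$ is almost decreasing. A function $\alpha:\mathbb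 R\to\mathbb R_+$ is asymptotic to a non-increasing function if for some $x_0>0$ it is locally bounded and positive on $[x_0,\infty)$, and $\sup_{t\ge x}\alpha(t)\sim\alpha(x)$ and $\inf_{x_0\le t\le x}\alpha(t)\sim\alpha(x)$. $F\in\mathcal A_\Delta$ if $x\mapsto F(x+\Delta)$ is asymptotic to a non-increasing function in this sense. *)

theory Defs
  imports "HOL-Probability.Probability" "HOL-Library.Landau_Symbols"
begin

section \<open>Levy measures, infinitely divisible and compound Poisson distributions\<close>

definition levy_measure :: "real measure \<Rightarrow> bool" where
  "levy_measure \<nu> \<longleftrightarrow>
     sets \<nu> = sets borel \<and> emeasure \<nu> {0} = 0 \<and> (\<integral>\<^sup>+ x. ennreal (min 1 (x^2)) \<partial>\<nu>) < \<infinity>"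

text \<open>The integrand below is integrable for every Levy measure, so the convention that the
  Bochner integral of a non-integrable function is 0 plays no role.\<close>

definition levy_exponent :: "real measure \<Rightarrow> real \<Rightarrow> real \<Rightarrow> real \<Rightarrow> complex" where
  "levy_exponent \<nu> a b z =
     (CLINT y|\<nu>. iexp (z * y) - 1 - \<i> * of_real (z * y * indicator {y. \<bar>y\<bar> \<le> 1} y))
     + \<i> * of_real (a * z) - of_real (b^2 * z^2 / 2)"

text \<open>Infinite divisibility is expressed by the Levy-Khintchine representation, which also
  says what the Levy measure of the distribution is.\<close>

definition infinitely_divisible_with :: "real measure \<Rightarrow> real measure \<Rightarrow> bool" where
  "infinitely_divisible_with \<mu> \<nu> \<longleftrightarrow>
     real_distribution \<mu> \<and> levy_measure \<nu> \<and>
     (\<exists>a b. 0 \<le> b \<and> (\<forall>z. char \<mu> z = exp (levy_exponent \<nu> a b z)))"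

text \<open>A distribution is determined by its characteristic function, so this holds for at most
  one \<open>\<mu>\<close>, given \<open>\<rho>\<close>.\<close>

definition compound_poisson :: "real measure \<Rightarrow> real measure \<Rightarrow> bool" where
  "compound_poisson \<rho> \<mu> \<longleftrightarrow>
     levy_measure \<rho> \<and> finite_measure \<rho> \<and> real_distribution \<mu> \<and>
     (\<forall>z. char \<mu> z = exp (CLINT y|\<rho>. iexp (z * y) - 1))"

definition levy_above :: "real measure \<Rightarrow> real \<Rightarrow> real measure" where
  "levy_above \<nu> c\<^sub>1 = density \<nu> (indicator {c\<^sub>1<..})"

text \<open>If \<open>\<nu> (1,\<infinity>) = 0\<close> this is not a distribution; statements about it have to carry
  the condition \<open>\<nu> (1,\<infinity>) > 0\<close>.\<close>

definition normalized_levy :: "real measure \<Rightarrow> real measure" where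
  "normalized_levy \<nu> = uniform_measure \<nu> {1<..}"


section \<open>Classes of functions\<close>

text \<open>The library relation \<open>\<alpha> \<sim>[at_top] \<beta>\<close> differs from "\<open>\<alpha> x / \<beta> x\<close> tends to 1" only in that it
  reads \<open>0 / 0\<close> as 1. It is used here and below only together with a condition that makes one of the two
  sides positive for all large arguments, where both readings coincide.\<close>

definition long_tailed :: "(real \<Rightarrow> real) \<Rightarrow> bool" where
  "long_tailed \<alpha> \<longleftrightarrow>
     \<alpha> \<in> borel_measurable borel \<and> (\<forall>x. 0 \<le> \<alpha> x) \<and>
     (\<exists>x\<^sub>0>0. \<forall>x\<ge>x\<^sub>0. 0 < \<alpha> x) \<and>
     (\<forall>y>0. (\<lambda>x. \<alpha> (x + y)) \<sim>[at_top] \<alpha>)"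

definition almost_decreasing :: "(real \<Rightarrow> real) \<Rightarrow> bool" where
  "almost_decreasing \<alpha> \<longleftrightarrow>
     (\<forall>x. 0 \<le> \<alpha> x) \<and>
     (\<exists>x\<^sub>0>0. \<exists>K>0. \<forall>x>x\<^sub>0. \<forall>y>0. \<alpha> (x + y) \<le> K * \<alpha> x)"

text \<open>The condition \<open>bdd_above\<close> says that the suprema are finite, as real-valued \<open>SUP\<close> is
  unspecified on unbounded sets. It is implicit in the supremum being asymptotic to \<open>\<alpha>\<close>:
  since \<open>\<alpha>\<close> is locally bounded, all suprema are infinite if one of them is.\<close>

definition asymp_nonincreasing :: "(real \<Rightarrow> real) \<Rightarrow> bool" where
  "asymp_nonincreasing \<alpha> \<longleftrightarrow>
     (\<forall>x. 0 \<le> \<alpha> x) \<and>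
     (\<exists>x\<^sub>0>0.
        (\<forall>x\<ge>x\<^sub>0. bounded (\<alpha> ` {x\<^sub>0..x})) \<and> (\<forall>x\<ge>x\<^sub>0. 0 < \<alpha> x) \<and>
        bdd_above (\<alpha> ` {x\<^sub>0..}) \<and>
        (\<lambda>x. SUP t\<in>{x..}. \<alpha> t) \<sim>[at_top] \<alpha> \<and>
        (\<lambda>x. INF t\<in>{x\<^sub>0..x}. \<alpha> t) \<sim>[at_top] \<alpha>)"


section \<open>Classes of distributions, for \<open>\<Delta> = (0, c]\<close>\<close>

text \<open>\<open>F (x + \<Delta>)\<close>. For a Levy measure, which may be infinite near 0, this is the true
  value at least for all \<open>x > 0\<close>.\<close>

definition local_mass :: "real \<Rightarrow> real measure \<Rightarrow> real \<Rightarrow> real" where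
  "local_mass c F x = measure F {x<..x + c}"

definition L_Delta :: "real \<Rightarrow> real measure set" where
  "L_Delta c = {F. real_distribution F \<and> long_tailed (local_mass c F)}"

definition S_Delta :: "real \<Rightarrow> real measure set" where
  "S_Delta c = {F. F \<in> L_Delta c \<and>
     local_mass c (convolution F F) \<sim>[at_top] (\<lambda>x. 2 * local_mass c F x)}"

definition D_Delta :: "real \<Rightarrow> real measure set" where
  "D_Delta c = {F. real_distribution F \<and> almost_decreasing (local_mass c F)}"

definition A_Delta :: "real \<Rightarrow> real measure set" where
  "A_Delta c = {F. real_distribution F \<and> asymp_nonincreasing (local_mass c F)}"

end

theory Submission
  imports Defs
begin

text \<open>Write \<open>m\<close> for the compound Poisson distribution \<open>\<mu>\<^sub>c\<close>, \<open>R\<close> for its Levy measure, and \<open>F (x)\<close> for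
  \<open>F (x + \<Delta>)\<close>. Each of the three assertions is shown to be equivalent to one condition on \<open>R\<close>: that it is
  long-tailed and that \<open>(R \<otimes> R) {(y, z). B < y, B < z, y + z \<in> x + \<Delta>} \<le> e R (x)\<close> for large \<open>x\<close>, with \<open>e\<close>
  small if \<open>B\<close> is large (\<open>negligible_pairs\<close>). For distributions on the half-line this is membership in
  \<open>\<S>\<^sub>\<Delta>\<close>. Its second part passes to all measures whose local masses are at most a multiple of those of
  \<open>R\<close>, and is therefore much easier to transfer than the definition of \<open>\<S>\<^sub>\<Delta>\<close>.

  The bridge between \<open>m\<close> and \<open>R\<close> is the size-bias identity \<open>u m(du) = \<integral> y R(dy) m(du - y)\<close>. Evaluated on
  \<open>x + \<Delta>\<close> and split according to which of the two summands is bounded by \<open>B\<close>, it says that \<open>m (x)\<close> is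
  \<open>\<integral>\<^sub>z\<^sub>\<le>\<^sub>B m(dz) R (x - z)\<close> up to the mass of pairs of large summands and errors of relative order \<open>1 / x\<close>
  (\<open>lm_upper\<close>, \<open>lm_lower\<close>). Three consequences carry the proof. If \<open>R\<close> satisfies the condition, then
  first \<open>m (x) = O(R (x))\<close> and hence \<open>m \<sim> R\<close> (\<open>lm_asymp_r\<close>). If \<open>m\<close> satisfies it, then the convolution of
  \<open>m\<close> with the ratio \<open>R (x) / m (x)\<close> tends to 1; as \<open>m\<close> is a convolution power of a distribution with more
  than half of its mass at 0, the convolution can be undone and the ratio itself tends to 1
  (\<open>r_asymp_lm\<close>). If \<open>R\<close> is long-tailed and \<open>m (x) \<le> (1 + o(1)) R (x)\<close>, then the bounded summands exhaust
  \<open>m (x)\<close> and nothing is left for pairs of large ones (\<open>negligible_pairs_if_asymp_le\<close>).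

  To pass from \<open>m\<close> to \<open>\<mu>\<close>, write \<open>\<mu> = \<eta> * m\<close> where \<open>\<eta>\<close> collects the normal part and the jumps up to
  \<open>c\<^sub>1\<close> and satisfies \<open>\<integral> e\<^sup>y \<eta>(dy) < \<infinity>\<close> (\<open>infinitely_divisible_decompose\<close>). If \<open>m\<close> is long-tailed and almost
  decreasing, then \<open>\<mu> \<sim> m\<close> (\<open>convolution_light_asymp\<close>); applied to \<open>\<eta> * \<eta>\<close> and \<open>m * m\<close> this also gives
  \<open>\<mu> \<in> \<S>\<^sub>\<Delta>\<close>. When the regularity is known of \<open>\<mu>\<close> or \<open>\<nu>\<close> instead, \<open>m \<in> \<A>\<^sub>\<Delta>\<close> takes its place: since \<open>\<eta>\<close>
  has nearly all its mass in some \<open>[-A, A]\<close> and \<open>m\<close> is asymptotically monotone,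
  \<open>m (x + A) \<le> (1 + e) \<mu> (x)\<close> (\<open>convolution_lower_shift\<close>). If \<open>\<mu>\<close> is long-tailed, this shows that \<open>\<mu>\<close>
  dominates \<open>m\<close>, and then the reverse comparison holds as well (\<open>convolution_upper_shift\<close>).\<close>

section \<open>Asymptotic comparison of positive functions\<close>

text \<open>One half of \<open>\<sim>\<close>; the two halves come from different arguments.\<close>

definition asymp_le :: "(real \<Rightarrow> real) \<Rightarrow> (real \<Rightarrow> real) \<Rightarrow> bool" where
  "asymp_le f g \<longleftrightarrow> (\<forall>e>0. \<forall>\<^sub>F x in at_top. f x \<le> (1 + e) * g x)"

lemma asymp_leD: "asymp_le f g \<Longrightarrow> 0 < e \<Longrightarrow> \<forall>\<^sub>F x in at_top. f x \<le> (1 + e) * g x"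
  by (simp add: asymp_le_def)

lemma asymp_equiv_iff_quotient:
  fixes f g :: "real \<Rightarrow> real"
  assumes "\<forall>\<^sub>F x in at_top. 0 < g x"
  shows "f \<sim>[at_top] g \<longleftrightarrow> ((\<lambda>x. f x / g x) \<longlongrightarrow> 1) at_top"
proof -
  have "\<forall>\<^sub>F x in at_top. (if f x = 0 \<and> g x = 0 then 1 else f x / g x) = f x / g x"
    using assms by eventually_elim auto
  then show ?thesis
    unfolding asymp_equiv_def by (rule tendsto_cong)
qed

lemma asymp_equiv_iff_asymp_le:
  fixes f g :: "real \<Rightarrow> real"
  assumes pos: "\<forall>\<^sub>F x in at_top. 0 < g x"
  shows "f \<sim>[at_top] g \<longleftrightarrow> asymp_le f g \<and> asymp_le g f"
proof
  assume "f \<sim>[at_top] g"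
  then have lim: "((\<lambda>x. f x / g x) \<longlongrightarrow> 1) at_top"
    using asymp_equiv_iff_quotient[OF pos] by simp
  have "\<forall>\<^sub>F x in at_top. f x \<le> (1 + e) * g x" if "e > 0" for e
  proof -
    have "\<forall>\<^sub>F x in at_top. f x / g x < 1 + e"
      using order_tendstoD(2)[OF lim, of "1 + e"] that by simp
    with pos show ?thesis by eventually_elim (simp add: field_simps)
  qed
  moreover have "\<forall>\<^sub>F x in at_top. g x \<le> (1 + e) * f x" if "e > 0" for e
  proof -
    have "1 / (1 + e) < 1" using that by simp
    then have "\<forall>\<^sub>F x in at_top. 1 / (1 + e) < f x / g x"
      by (rule order_tendstoD(1)[OF lim])
    with pos show ?thesis by eventually_elim (use that in \<open>simp add: field_simps\<close>)
  qed
  ultimately show "asymp_le f g \<and> asymp_le g f" by (auto simp: asymp_le_def)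
next
  assume le: "asymp_le f g \<and> asymp_le g f"
  show "f \<sim>[at_top] g"
    unfolding asymp_equiv_iff_quotient[OF pos]
  proof (rule order_tendstoI)
    fix a :: real assume "a < 1"
    define e where "e = (if a \<le> 0 then 1 else (1 / a - 1) / 2)"
    have e: "e > 0" using \<open>a < 1\<close> by (auto simp: e_def field_simps)
    have ae: "a * (1 + e) < 1"
      using \<open>a < 1\<close> by (auto simp: e_def field_simps mult_le_0_iff intro: le_less_trans[of _ 0])
    show "\<forall>\<^sub>F x in at_top. a < f x / g x"
      using asymp_leD[OF conjunct2[OF le] e] pos
    proof eventually_elim
      case (elim x)
      have "a * (1 + e) * g x < 1 * g x"
        using ae elim by (intro mult_strict_right_mono) auto
      also have "\<dots> \<le> (1 + e) * f x" using elim by simp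
      finally have "(1 + e) * (a * g x) < (1 + e) * f x" by (simp only: mult_ac)
      then have "a * g x < f x" using e by simp
      then show ?case using elim by (simp add: field_simps)
    qed
  next
    fix a :: real assume "1 < a"
    then have "(a - 1) / 2 > 0" by simp
    from asymp_leD[OF conjunct1[OF le] this] pos
    show "\<forall>\<^sub>F x in at_top. f x / g x < a"
    proof eventually_elim
      case (elim x)
      have "(1 + (a - 1) / 2) * g x < a * g x"
        using elim \<open>1 < a\<close> by (intro mult_strict_right_mono) (auto simp: field_simps)
      with elim have "f x < a * g x" by linarith
      then show ?case using elim by (simp add: field_simps)
    qed
  qed
qed

lemma asymp_equiv_eventually_pos:
  fixes f g :: "real \<Rightarrow> real"
  assumes "f \<sim>[at_top] g" "\<forall>\<^sub>F x in at_top. 0 < g x"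
  shows "\<forall>\<^sub>F x in at_top. 0 < f x"
  using asymp_equiv_imp_eventually_same_sign[OF assms(1)] assms(2)
  by eventually_elim (auto simp: sgn_if split: if_splits)

section \<open>Local masses\<close>

lemma local_mass_nonneg [simp]: "0 \<le> local_mass c F x"
  by (simp add: local_mass_def)

context finite_borel_measure
begin

lemma local_mass_eq_cdf: "0 < c \<Longrightarrow> local_mass c M x = cdf M (x + c) - cdf M x"
  using cdf_diff_eq[of x "x + c"] by (simp add: local_mass_def)

lemma local_mass_le_mass: "local_mass c M x \<le> measure M UNIV"
  unfolding local_mass_def using bounded_measure[of "{x<..x+c}"] by (simp add: borel_UNIV)

lemma borel_measurable_cdf [measurable]: "cdf M \<in> borel_measurable borel"
  by (rule borel_measurable_mono) (auto simp: mono_def cdf_nondecreasing)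

lemma borel_measurable_local_mass: "0 < c \<Longrightarrow> local_mass c M \<in> borel_measurable borel"
  by (subst measurable_cong[OF local_mass_eq_cdf]) auto

lemma local_mass_le_two:
  assumes "0 < c" "0 \<le> y" "y \<le> c"
  shows "local_mass c M (x + y) \<le> local_mass c M x + local_mass c M (x + c)"
  using assms cdf_nondecreasing[of x "x + y"] cdf_nondecreasing[of "x + y + c" "x + c + c"]
  by (simp add: local_mass_eq_cdf)

lemma local_mass_le_two':
  assumes "0 < c" "0 \<le> y" "y \<le> c"
  shows "local_mass c M x \<le> local_mass c M (x + y) + local_mass c M (x + y - c)"
  using assms cdf_nondecreasing[of "x + y - c" x] cdf_nondecreasing[of "x + c" "x + y + c"]
  by (simp add: local_mass_eq_cdf)

end

lemma long_tailed_pos: "long_tailed f \<Longrightarrow> \<forall>\<^sub>F x in at_top. 0 < f x"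
  unfolding long_tailed_def by (auto simp: eventually_at_top_linorder)

lemma long_tailed_shift:
  assumes "long_tailed f"
  shows "((\<lambda>x. f (x + y) / f x) \<longlongrightarrow> 1) at_top"
proof -
  note pos = long_tailed_pos[OF assms]
  have shift: "filterlim (\<lambda>x::real. x + a) at_top at_top" for a
    by (rule filterlim_tendsto_add_at_top[OF tendsto_const[of a] filterlim_ident, simplified add.commute])
  have up: "((\<lambda>x. f (x + y) / f x) \<longlongrightarrow> 1) at_top" if "y > 0" for y
    using assms that asymp_equiv_iff_quotient[OF pos] by (auto simp: long_tailed_def)
  consider "y > 0" | "y = 0" | "y < 0" by linarith
  then show ?thesis
  proof cases
    case 2
    have "\<forall>\<^sub>F x in at_top. f (x + y) / f x = 1"
      using pos by eventually_elim (auto simp: 2)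
    then show ?thesis by (rule tendsto_eventually)
  next
    case 3
    have "((\<lambda>x. f (x + y + - y) / f (x + y)) \<longlongrightarrow> 1) at_top"
      by (rule filterlim_compose[OF up shift]) (use 3 in auto)
    then have "((\<lambda>x. inverse (f (x + y + - y) / f (x + y))) \<longlongrightarrow> inverse 1) at_top"
      by (intro tendsto_intros) auto
    then show ?thesis by simp
  qed (rule up)
qed

lemma long_tailed_asymp_le:
  assumes "long_tailed f"
  shows "asymp_le (\<lambda>x. f (x + y)) f" "asymp_le f (\<lambda>x. f (x + y))"
  using long_tailed_shift[OF assms, of y] asymp_equiv_iff_quotient[OF long_tailed_pos[OF assms]]
    asymp_equiv_iff_asymp_le[OF long_tailed_pos[OF assms]] by auto

lemma long_tailed_cong_asymp:
  assumes f: "long_tailed f" and g: "g \<in> borel_measurable borel" "\<And>x. 0 \<le> g x"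
    and gf: "g \<sim>[at_top] f"
  shows "long_tailed g"
proof -
  have pos: "\<forall>\<^sub>F x in at_top. 0 < g x"
    by (rule asymp_equiv_eventually_pos[OF gf long_tailed_pos[OF f]])
  then obtain x0 where x0: "\<forall>x\<ge>x0. 0 < g x" by (auto simp: eventually_at_top_linorder)
  have "(\<lambda>x. g (x + y)) \<sim>[at_top] g" if "y > 0" for y
  proof -
    have "filterlim (\<lambda>x::real. x + y) at_top at_top"
      by (rule filterlim_tendsto_add_at_top[OF tendsto_const[of y] filterlim_ident, simplified add.commute])
    then have "(\<lambda>x. g (x + y)) \<sim>[at_top] (\<lambda>x. f (x + y))"
      by (rule asymp_equiv_compose'[OF gf])
    also have "(\<lambda>x. f (x + y)) \<sim>[at_top] f" using f that by (auto simp: long_tailed_def)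
    also have "f \<sim>[at_top] g" using gf by (rule asymp_equiv_symI)
    finally show ?thesis .
  qed
  moreover have "\<exists>x0>0. \<forall>x\<ge>x0. 0 < g x"
    using x0 by (intro exI[of _ "max 1 x0"]) auto
  ultimately show ?thesis using g by (auto simp: long_tailed_def)
qed

text \<open>Iterating the comparison of \<open>F (x + \<Delta>)\<close> with \<open>F (x + c + \<Delta>)\<close> loses a factor arbitrarily close
  to 1 per step. A remainder shorter than \<open>c\<close> costs only a bounded factor, because every interval of
  length \<open>c\<close> is covered by two neighbouring intervals of a grid of mesh \<open>c\<close>; this makes the bound uniform
  on compact sets of shifts.\<close>

lemma (in finite_borel_measure) long_tailed_growth:
  assumes c: "0 < c" and lt: "long_tailed (local_mass c M)" and eps: "0 < eps"
  obtains x0 C where "0 < x0" "1 \<le> C"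
    "\<And>x. x0 \<le> x \<Longrightarrow> 0 < local_mass c M x"
    "\<And>x y. x0 \<le> x \<Longrightarrow> 0 \<le> y \<Longrightarrow> local_mass c M (x + y) \<le> C * exp (eps * y) * local_mass c M x"
    "\<And>x y. x0 \<le> x \<Longrightarrow> 0 \<le> y \<Longrightarrow> local_mass c M x \<le> C * exp (eps * y) * local_mass c M (x + y)"
proof -
  let ?f = "local_mass c M"
  define q where "q = exp (eps * c)"
  have q: "1 < q" using c eps by (simp add: q_def)
  have "\<forall>\<^sub>F x in at_top. ?f (x + c) \<le> (1 + (q - 1)) * ?f x \<and> ?f x \<le> (1 + (q - 1)) * ?f (x + c)"
    using long_tailed_asymp_le[OF lt, of c] q by (intro eventually_conj asymp_leD) auto
  with long_tailed_pos[OF lt] have "\<forall>\<^sub>F x in at_top. 0 < ?f x \<and> ?f (x + c) \<le> q * ?f x \<and> ?f x \<le> q * ?f (x + c)"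
    by eventually_elim simp
  then obtain x1 where x1: "\<And>x. x1 \<le> x \<Longrightarrow> 0 < ?f x \<and> ?f (x + c) \<le> q * ?f x \<and> ?f x \<le> q * ?f (x + c)"
    by (auto simp: eventually_at_top_linorder)
  define x0 where "x0 = max 1 (x1 + c)"
  have x0: "x0 > 0" "x1 + c \<le> x0" by (auto simp: x0_def)
  have it: "?f (x + real k * c) \<le> q ^ k * ?f x \<and> ?f x \<le> q ^ k * ?f (x + real k * c)" if "x0 \<le> x" for x k
  proof (induction k)
    case (Suc k)
    have "x1 \<le> x + real k * c" by (rule order_trans[of x1 x]) (use that x0 c in auto)
    note s = x1[OF this]
    have "q * ?f (x + real k * c) \<le> q * (q ^ k * ?f x)"
      using Suc q by (intro mult_left_mono) auto
    then have "?f (x + real k * c + c) \<le> q * (q ^ k * ?f x)"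
      using s by linarith
    moreover have "q ^ k * ?f (x + real k * c) \<le> q ^ k * (q * ?f (x + real k * c + c))"
      using s q by (intro mult_left_mono) auto
    then have "?f x \<le> q ^ k * (q * ?f (x + real k * c + c))"
      using Suc by linarith
    moreover have e: "x + real (Suc k) * c = x + real k * c + c" by (simp add: algebra_simps)
    ultimately show ?case unfolding e by (simp only: power_Suc mult_ac)
  qed simp
  define C where "C = 1 + q"
  have step1: "?f (x + t) \<le> C * ?f x" if "x0 \<le> x" "0 \<le> t" "t \<le> c" for x t
    using local_mass_le_two[OF c that(2,3), of x] x1[of x] that x0 c by (simp add: C_def algebra_simps)
  have step2: "?f x \<le> C * ?f (x + t)" if "x0 \<le> x" "0 \<le> t" "t \<le> c" for x t
    using local_mass_le_two'[OF c that(2,3), of x] x1[of "x + t - c"] that x0 c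
    by (simp add: C_def algebra_simps)
  have dec: "\<exists>k t. y = real k * c + t \<and> 0 \<le> t \<and> t \<le> c \<and> q ^ k \<le> exp (eps * y)" if "0 \<le> y" for y
  proof -
    define k where "k = nat \<lfloor>y / c\<rfloor>"
    have k: "real k \<le> y / c" "y / c \<le> real k + 1"
      using that c by (auto simp: k_def)
    then have kc: "real k * c \<le> y" "y \<le> real k * c + c" using c by (auto simp: field_simps)
    have "q ^ k = exp (eps * (real k * c))" by (simp add: q_def exp_of_nat_mult[symmetric] mult_ac)
    also have "\<dots> \<le> exp (eps * y)" using kc eps by simp
    finally show ?thesis using kc by (intro exI[of _ k] exI[of _ "y - real k * c"]) auto
  qed
  show ?thesis
  proof (rule that[of x0 C])
    show "1 \<le> C" using q by (simp add: C_def)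
    show "0 < ?f x" if "x0 \<le> x" for x using x1[of x] that x0 c by auto
    fix x y :: real assume x: "x0 \<le> x" and y: "0 \<le> y"
    obtain k t where kt: "y = real k * c + t" "0 \<le> t" "t \<le> c" "q ^ k \<le> exp (eps * y)"
      using dec[OF y] by blast
    have x': "x0 \<le> x + real k * c" by (rule order_trans[of x0 x]) (use x c in auto)
    have "?f (x + y) \<le> C * ?f (x + real k * c)" using step1[OF x' kt(2,3)] kt(1) by (simp add: add.assoc)
    also have "\<dots> \<le> C * (q ^ k * ?f x)" using it[OF x, of k] q by (intro mult_left_mono) (auto simp: C_def)
    also have "\<dots> \<le> C * (exp (eps * y) * ?f x)" using kt q by (intro mult_left_mono mult_right_mono) (auto simp: C_def)
    finally show "?f (x + y) \<le> C * exp (eps * y) * ?f x" by (simp add: mult.assoc)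
    have "?f x \<le> q ^ k * ?f (x + real k * c)" using it[OF x, of k] by simp
    also have "\<dots> \<le> q ^ k * (C * ?f (x + real k * c + t))"
      using step2[OF x' kt(2,3)] q by (intro mult_left_mono) auto
    also have "\<dots> \<le> exp (eps * y) * (C * ?f (x + real k * c + t))"
      using kt q by (intro mult_right_mono) (auto simp: C_def)
    finally show "?f x \<le> C * exp (eps * y) * ?f (x + y)" using kt(1) by (simp add: mult_ac add.assoc)
  qed (use x0 in auto)
qed

section \<open>Splitting the local mass of a convolution\<close>

text \<open>The part of the local mass of a convolution that comes from pairs of summands with the
  property \<open>P\<close>. It is finitely additive in \<open>P\<close>, and an integral of local masses if \<open>P\<close> concerns one
  summand only.\<close>

definition sum_mass ::
    "real \<Rightarrow> real measure \<Rightarrow> real measure \<Rightarrow> (real \<Rightarrow> real \<Rightarrow> bool) \<Rightarrow> real \<Rightarrow> real" where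
  "sum_mass c F G P x =
     measure (F \<Otimes>\<^sub>M G) {w. x < fst w + snd w \<and> fst w + snd w \<le> x + c \<and> P (fst w) (snd w)}"

abbreviation pred2 :: "(real \<Rightarrow> real \<Rightarrow> bool) \<Rightarrow> bool" where
  "pred2 P \<equiv> Measurable.pred (borel \<Otimes>\<^sub>M borel) (\<lambda>w. P (fst w) (snd w))"

lemma finite_borel_pair:
  assumes "finite_borel_measure F" "finite_borel_measure G"
  shows "finite_measure (F \<Otimes>\<^sub>M G)" "sets (F \<Otimes>\<^sub>M G) = sets (borel \<Otimes>\<^sub>M borel)"
    "space (F \<Otimes>\<^sub>M G) = UNIV" "pair_sigma_finite F G"
proof -
  interpret F: finite_borel_measure F by fact
  interpret G: finite_borel_measure G by fact
  show "finite_measure (F \<Otimes>\<^sub>M G)"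
    by (rule finite_measure_pair_measure) unfold_locales
  show "sets (F \<Otimes>\<^sub>M G) = sets (borel \<Otimes>\<^sub>M borel)"
    by (rule sets_pair_measure_cong[OF F.M_is_borel G.M_is_borel])
  show "space (F \<Otimes>\<^sub>M G) = UNIV"
    by (simp add: space_pair_measure F.borel_UNIV G.borel_UNIV)
  show "pair_sigma_finite F G" by unfold_locales
qed

lemma real_distribution_convolution:
  assumes "real_distribution F" "real_distribution G"
  shows "real_distribution (F \<star> G)"
proof -
  interpret F: real_distribution F by fact
  interpret G: real_distribution G by fact
  interpret P: pair_prob_space F G by unfold_locales
  show ?thesis
    unfolding convolution_def case_prod_beta by (rule P.real_distribution_distr) measurable
qed

lemma sum_set_measurable:
  assumes "finite_borel_measure F" "finite_borel_measure G" and [measurable]: "pred2 P"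
  shows "{w. x < fst w + snd w \<and> fst w + snd w \<le> x + c \<and> P (fst w) (snd w)} \<in> sets (F \<Otimes>\<^sub>M G)"
proof -
  have "{w \<in> space (borel \<Otimes>\<^sub>M borel). x < fst w + snd w \<and> fst w + snd w \<le> x + c \<and> P (fst w) (snd w)}
      \<in> sets (borel \<Otimes>\<^sub>M borel :: (real \<times> real) measure)"
    by measurable
  then show ?thesis by (simp add: finite_borel_pair[OF assms(1,2)] space_pair_measure)
qed

lemma sum_mass_nonneg [simp]: "0 \<le> sum_mass c F G P x"
  by (simp add: sum_mass_def)

lemma local_mass_convolution:
  assumes "finite_borel_measure F" "finite_borel_measure G"
  shows "local_mass c (F \<star> G) x = sum_mass c F G (\<lambda>_ _. True) x"
proof -
  note s = finite_borel_pair[OF assms]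
  have "(\<lambda>w. fst w + snd w) \<in> measurable (F \<Otimes>\<^sub>M G) borel"
    by (simp add: measurable_cong_sets[OF s(2) refl])
  then have "measure (F \<star> G) {x<..x + c} =
      measure (F \<Otimes>\<^sub>M G) ((\<lambda>w. fst w + snd w) -` {x<..x + c} \<inter> space (F \<Otimes>\<^sub>M G))"
    unfolding convolution_def case_prod_beta by (rule measure_distr) simp
  also have "(\<lambda>w. fst w + snd w) -` {x<..x + c} \<inter> space (F \<Otimes>\<^sub>M G) =
      {w. x < fst w + snd w \<and> fst w + snd w \<le> x + c \<and> True}"
    by (auto simp: s)
  finally show ?thesis by (simp add: local_mass_def sum_mass_def)
qed

lemma sum_mass_mono:
  assumes "finite_borel_measure F" "finite_borel_measure G" "pred2 Q"
    and "\<And>y z. x < y + z \<Longrightarrow> y + z \<le> x + c \<Longrightarrow> P y z \<Longrightarrow> Q y z"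
  shows "sum_mass c F G P x \<le> sum_mass c F G Q x"
proof -
  interpret finite_measure "F \<Otimes>\<^sub>M G" by (rule finite_borel_pair[OF assms(1,2)])
  show ?thesis unfolding sum_mass_def
    by (rule finite_measure_mono[OF _ sum_set_measurable[OF assms(1-3)]]) (use assms(4) in auto)
qed

lemma sum_mass_subadd:
  assumes "finite_borel_measure F" "finite_borel_measure G" "pred2 Q" "pred2 R"
    and "\<And>y z. x < y + z \<Longrightarrow> y + z \<le> x + c \<Longrightarrow> P y z \<Longrightarrow> Q y z \<or> R y z"
  shows "sum_mass c F G P x \<le> sum_mass c F G Q x + sum_mass c F G R x"
proof -
  interpret finite_measure "F \<Otimes>\<^sub>M G" by (rule finite_borel_pair[OF assms(1,2)])
  let ?S = "\<lambda>P. {w. x < fst w + snd w \<and> fst w + snd w \<le> x + c \<and> P (fst w) (snd w)}"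
  have "measure (F \<Otimes>\<^sub>M G) (?S P) \<le> measure (F \<Otimes>\<^sub>M G) (?S Q \<union> ?S R)"
    by (rule finite_measure_mono)
      (use assms(5) in \<open>auto intro!: sets.Un sum_set_measurable[OF assms(1,2)] assms(3,4)\<close>)
  also have "\<dots> \<le> measure (F \<Otimes>\<^sub>M G) (?S Q) + measure (F \<Otimes>\<^sub>M G) (?S R)"
    by (rule measure_Un_le) (auto intro!: sum_set_measurable[OF assms(1,2)] assms(3,4))
  finally show ?thesis by (simp add: sum_mass_def)
qed

lemma sum_mass_superadd:
  assumes "finite_borel_measure F" "finite_borel_measure G" "pred2 P" "pred2 Q" "pred2 R"
    and "\<And>y z. x < y + z \<Longrightarrow> y + z \<le> x + c \<Longrightarrow> Q y z \<Longrightarrow> P y z \<and> \<not> R y z"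
    and "\<And>y z. x < y + z \<Longrightarrow> y + z \<le> x + c \<Longrightarrow> R y z \<Longrightarrow> P y z"
  shows "sum_mass c F G Q x + sum_mass c F G R x \<le> sum_mass c F G P x"
proof -
  interpret finite_measure "F \<Otimes>\<^sub>M G" by (rule finite_borel_pair[OF assms(1,2)])
  let ?S = "\<lambda>P. {w. x < fst w + snd w \<and> fst w + snd w \<le> x + c \<and> P (fst w) (snd w)}"
  have "measure (F \<Otimes>\<^sub>M G) (?S Q) + measure (F \<Otimes>\<^sub>M G) (?S R) = measure (F \<Otimes>\<^sub>M G) (?S Q \<union> ?S R)"
    by (rule finite_measure_Union[symmetric])
      (use assms(6) in \<open>auto intro!: sum_set_measurable[OF assms(1,2)] assms(4,5)\<close>)
  also have "\<dots> \<le> measure (F \<Otimes>\<^sub>M G) (?S P)"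
    by (rule finite_measure_mono[OF _ sum_set_measurable[OF assms(1-3)]]) (use assms(6,7) in auto)
  finally show ?thesis by (simp add: sum_mass_def)
qed

lemma sum_mass_swap:
  assumes "finite_borel_measure F" "finite_borel_measure G" "pred2 P"
  shows "sum_mass c F G P x = sum_mass c G F (\<lambda>y z. P z y) x"
proof -
  interpret pair_sigma_finite F G by (rule finite_borel_pair[OF assms(1,2)])
  note s = finite_borel_pair[OF assms(2,1)]
  let ?S = "{w. x < fst w + snd w \<and> fst w + snd w \<le> x + c \<and> P (fst w) (snd w)}"
  have "measure (F \<Otimes>\<^sub>M G) ?S = measure (distr (G \<Otimes>\<^sub>M F) (F \<Otimes>\<^sub>M G) (\<lambda>(x, y). (y, x))) ?S"
    using distr_pair_swap by simp
  also have "\<dots> = measure (G \<Otimes>\<^sub>M F) ((\<lambda>(x, y). (y, x)) -` ?S \<inter> space (G \<Otimes>\<^sub>M F))"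
    by (rule measure_distr[OF _ sum_set_measurable[OF assms]]) (rule measurable_pair_swap')
  also have "(\<lambda>(x, y). (y, x)) -` ?S \<inter> space (G \<Otimes>\<^sub>M F) =
      {w. x < fst w + snd w \<and> fst w + snd w \<le> x + c \<and> P (snd w) (fst w)}"
    by (auto simp: s)
  finally show ?thesis by (simp add: sum_mass_def)
qed

lemma integrable_local_mass:
  assumes "finite_borel_measure F" "finite_borel_measure G" "0 < c" "A \<in> sets borel"
  shows "integrable F (\<lambda>y. indicator A y * local_mass c G (x - y))"
proof -
  interpret F: finite_borel_measure F by fact
  interpret G: finite_borel_measure G by fact
  note [measurable] = G.borel_measurable_local_mass[OF assms(3)] assms(4)
  show ?thesis
  proof (rule F.integrable_const_bound[where B = "measure G UNIV"])
    show "AE y in F. norm (indicator A y * local_mass c G (x - y)) \<le> measure G UNIV"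
      using G.local_mass_le_mass by (auto simp: indicator_def)
    show "(\<lambda>y. indicator A y * local_mass c G (x - y)) \<in> borel_measurable F"
      unfolding measurable_cong_sets[OF F.M_is_borel refl] by measurable
  qed
qed

lemma sum_mass_eq_integral:
  assumes "finite_borel_measure F" "finite_borel_measure G" "0 < c" and A: "A \<in> sets borel"
  shows "sum_mass c F G (\<lambda>y _. y \<in> A) x = (\<integral>y. indicator A y * local_mass c G (x - y) \<partial>F)"
proof -
  interpret F: finite_borel_measure F by fact
  interpret G: finite_borel_measure G by fact
  interpret P: pair_sigma_finite F G by (rule finite_borel_pair[OF assms(1,2)])
  interpret PF: finite_measure "F \<Otimes>\<^sub>M G" by (rule finite_borel_pair[OF assms(1,2)])
  let ?S = "{w. x < fst w + snd w \<and> fst w + snd w \<le> x + c \<and> fst w \<in> A}"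
  note [measurable] = A
  have S: "?S \<in> sets (F \<Otimes>\<^sub>M G)" by (rule sum_set_measurable[OF assms(1,2)]) measurable
  have "ennreal (measure (F \<Otimes>\<^sub>M G) ?S) = emeasure (F \<Otimes>\<^sub>M G) ?S"
    by (simp add: PF.emeasure_eq_measure)
  also have "\<dots> = (\<integral>\<^sup>+ y. emeasure G (Pair y -` ?S) \<partial>F)" by (rule G.emeasure_pair_measure_alt[OF S])
  also have "\<dots> = (\<integral>\<^sup>+ y. ennreal (indicator A y * local_mass c G (x - y)) \<partial>F)"
  proof (rule nn_integral_cong)
    fix y
    have "Pair y -` ?S = (if y \<in> A then {x - y<..x - y + c} else {})" by auto
    then show "emeasure G (Pair y -` ?S) = ennreal (indicator A y * local_mass c G (x - y))"
      by (auto simp: local_mass_def G.emeasure_eq_measure)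
  qed
  also have "\<dots> = ennreal (\<integral>y. indicator A y * local_mass c G (x - y) \<partial>F)"
    by (rule nn_integral_eq_integral[OF integrable_local_mass[OF assms]]) auto
  finally show ?thesis
    unfolding sum_mass_def
    by (subst (asm) ennreal_inj) (auto intro!: integral_nonneg)
qed

lemma sum_mass_le_mult:
  assumes "finite_borel_measure F" "finite_borel_measure G" "finite_borel_measure H" "0 < c"
    and A: "A \<in> sets borel" and le: "\<And>y. y \<in> A \<Longrightarrow> local_mass c G (x - y) \<le> K * local_mass c H (x - y)"
  shows "sum_mass c F G (\<lambda>y _. y \<in> A) x \<le> K * sum_mass c F H (\<lambda>y _. y \<in> A) x"
proof -
  have "(\<integral>y. indicator A y * local_mass c G (x - y) \<partial>F)
      \<le> (\<integral>y. K * (indicator A y * local_mass c H (x - y)) \<partial>F)"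
    using le by (intro integral_mono integrable_mult_right integrable_local_mass assms)
      (auto simp: indicator_def)
  then show ?thesis
    by (simp add: sum_mass_eq_integral[OF assms(1,2,4,5)] sum_mass_eq_integral[OF assms(1,3,4,5)])
qed

lemma sum_mass_le_const:
  assumes "finite_borel_measure F" "finite_borel_measure G" "0 < c"
    and A: "A \<in> sets borel" and le: "\<And>y. y \<in> A \<Longrightarrow> local_mass c G (x - y) \<le> K"
  shows "sum_mass c F G (\<lambda>y _. y \<in> A) x \<le> K * measure F A"
proof -
  interpret F: finite_borel_measure F by fact
  have int: "integrable F (\<lambda>y. K * indicator A y)"
    using A F.M_is_borel by (intro integrable_mult_right integrable_real_indicator)
      (auto simp: F.emeasure_eq_measure)
  have "(\<integral>y. indicator A y * local_mass c G (x - y) \<partial>F) \<le> (\<integral>y. K * indicator A y \<partial>F)"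
    using le by (intro integral_mono int integrable_local_mass assms) (auto simp: indicator_def)
  then show ?thesis
    using A F.M_is_borel F.borel_UNIV by (simp add: sum_mass_eq_integral[OF assms(1,2,3,4)])
qed

lemma sum_mass_ge_const:
  assumes "finite_borel_measure F" "finite_borel_measure G" "0 < c"
    and A: "A \<in> sets borel" and le: "\<And>y. y \<in> A \<Longrightarrow> K \<le> local_mass c G (x - y)"
  shows "K * measure F A \<le> sum_mass c F G (\<lambda>y _. y \<in> A) x"
proof -
  interpret F: finite_borel_measure F by fact
  have int: "integrable F (\<lambda>y. K * indicator A y)"
    using A F.M_is_borel by (intro integrable_mult_right integrable_real_indicator)
      (auto simp: F.emeasure_eq_measure)
  have "(\<integral>y. K * indicator A y \<partial>F) \<le> (\<integral>y. indicator A y * local_mass c G (x - y) \<partial>F)"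
    using le by (intro integral_mono int integrable_local_mass assms) (auto simp: indicator_def)
  then show ?thesis
    using A F.M_is_borel F.borel_UNIV by (simp add: sum_mass_eq_integral[OF assms(1,2,3,4)])
qed


section \<open>Two large summands\<close>

text \<open>The truncated form of subexponentiality: that two summands with sum in \<open>x + \<Delta>\<close> both
  exceed \<open>B\<close> is negligible against \<open>F (x + \<Delta>)\<close>. The two measures whose product is taken and the comparison function \<open>h\<close> are
  separate parameters, since each of them is exchanged at some point.\<close>

definition negligible_pairs :: "real \<Rightarrow> real measure \<Rightarrow> real measure \<Rightarrow> (real \<Rightarrow> real) \<Rightarrow> bool" where
  "negligible_pairs c F G h \<longleftrightarrow>
     (\<forall>e>0. \<exists>B0. \<forall>B\<ge>B0. \<forall>\<^sub>F x in at_top. sum_mass c F G (\<lambda>y z. B < y \<and> B < z) x \<le> e * h x)"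

text \<open>If both summands exceed \<open>B\<close>, then for either one the other lies in an interval \<open>x - y + \<Delta>\<close> far out,
  so that its distribution can be exchanged at the cost of a constant factor, first for one summand and
  then for the other. As \<open>x + \<Delta>\<close> has length \<open>c\<close>, the lower bound \<open>B\<close> decreases by \<open>c\<close>.\<close>

lemma negligible_pairs_transfer:
  assumes c: "0 < c" and fin: "finite_borel_measure F" "finite_borel_measure G1" "finite_borel_measure G2"
    and neg: "negligible_pairs c F F h"
    and K: "0 < K" "\<And>x. T \<le> x \<Longrightarrow> local_mass c G1 x \<le> K * local_mass c F x"
      "\<And>x. T \<le> x \<Longrightarrow> local_mass c G2 x \<le> K * local_mass c F x"
  shows "negligible_pairs c G1 G2 h"
  unfolding negligible_pairs_def
proof (intro allI impI)
  fix e :: real assume e: "e > 0"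
  then have "e / (K * K) > 0" using K by simp
  then obtain B0 where B0: "\<And>B. B0 \<le> B \<Longrightarrow>
      \<forall>\<^sub>F x in at_top. sum_mass c F F (\<lambda>y z. B < y \<and> B < z) x \<le> e / (K * K) * h x"
    using neg unfolding negligible_pairs_def by blast
  show "\<exists>B0. \<forall>B\<ge>B0. \<forall>\<^sub>F x in at_top. sum_mass c G1 G2 (\<lambda>y z. B < y \<and> B < z) x \<le> e * h x"
  proof (intro exI allI impI)
    fix B assume B: "max B0 T + c \<le> B"
    show "\<forall>\<^sub>F x in at_top. sum_mass c G1 G2 (\<lambda>y z. B < y \<and> B < z) x \<le> e * h x"
    proof (rule eventually_mono[OF B0[of "B - c"]])
      fix x assume hx: "sum_mass c F F (\<lambda>y z. B - c < y \<and> B - c < z) x \<le> e / (K * K) * h x"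
      have "sum_mass c G1 G2 (\<lambda>y z. B < y \<and> B < z) x \<le> sum_mass c G1 G2 (\<lambda>y _. y \<in> {B<..<x + c - B}) x"
        by (rule sum_mass_mono[OF fin(2,3)]) auto
      also have "\<dots> \<le> K * sum_mass c G1 F (\<lambda>y _. y \<in> {B<..<x + c - B}) x"
        using B by (intro sum_mass_le_mult[OF fin(2,3,1) c] K(3)) auto
      also have "sum_mass c G1 F (\<lambda>y _. y \<in> {B<..<x + c - B}) x
          \<le> sum_mass c G1 F (\<lambda>_ z. z \<in> {B - c<..<x + c - B}) x"
        by (rule sum_mass_mono[OF fin(2,1)]) auto
      also have "\<dots> = sum_mass c F G1 (\<lambda>y _. y \<in> {B - c<..<x + c - B}) x"
        by (rule sum_mass_swap[OF fin(2,1)]) simp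
      also have "\<dots> \<le> K * sum_mass c F F (\<lambda>y _. y \<in> {B - c<..<x + c - B}) x"
        using B by (intro sum_mass_le_mult[OF fin(1,2,1) c] K(2)) auto
      also have "sum_mass c F F (\<lambda>y _. y \<in> {B - c<..<x + c - B}) x
          \<le> sum_mass c F F (\<lambda>y z. B - c < y \<and> B - c < z) x"
        by (rule sum_mass_mono[OF fin(1,1)]) auto
      also note hx
      finally show "sum_mass c G1 G2 (\<lambda>y z. B < y \<and> B < z) x \<le> e * h x"
        using K by (simp add: mult_left_mono)
    qed (use B in simp)
  qed
qed

lemma (in finite_borel_measure) ex_symmetric_interval:
  assumes "0 < e"
  obtains B0 where "0 < B0" "\<And>B. B0 \<le> B \<Longrightarrow> measure M UNIV - e < measure M {-B..B}"
proof -
  have "((\<lambda>B. cdf M B - cdf M (- B)) \<longlongrightarrow> measure M UNIV - 0) at_top"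
    using cdf_lim_at_top filterlim_compose[OF cdf_lim_at_bot filterlim_uminus_at_bot_at_top]
    unfolding borel_UNIV by (rule tendsto_diff)
  then have "\<forall>\<^sub>F B in at_top. measure M UNIV - e < cdf M B - cdf M (- B)"
    using assms by (intro order_tendstoD(1)) auto
  then obtain B1 where B1: "\<And>B. B1 \<le> B \<Longrightarrow> measure M UNIV - e < cdf M B - cdf M (- B)"
    by (auto simp: eventually_at_top_linorder)
  show ?thesis
  proof (rule that[of "max 1 B1"])
    fix B assume B: "max 1 B1 \<le> B"
    have "cdf M B - cdf M (- B) = measure M {-B<..B}" using B by (intro cdf_diff_eq) auto
    also have "\<dots> \<le> measure M {-B..B}" by (intro finite_measure_mono) auto
    finally show "measure M UNIV - e < measure M {-B..B}" using B1[of B] B by simp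
  qed simp
qed

text \<open>Dominated convergence: for fixed \<open>y\<close> the ratio of \<open>G (x - y)\<close> and \<open>G (x)\<close> tends to 1 as \<open>G\<close> is
  long-tailed. The range of \<open>y\<close> may grow with \<open>x\<close>, as it has to when \<open>F\<close> has unbounded support and \<open>x - y\<close>
  has to stay in the region where \<open>G\<close> is controlled.\<close>

lemma sum_mass_ratio_tendsto:
  assumes fin: "finite_borel_measure F" "finite_borel_measure G" and c: "0 < c"
    and lt: "long_tailed (local_mass c G)"
    and A [measurable]: "\<And>x. A x \<in> sets borel" "A' \<in> sets borel"
    and A_lim: "\<And>y. \<forall>\<^sub>F x in at_top. y \<in> A x \<longleftrightarrow> y \<in> A'"
    and dom: "\<forall>\<^sub>F x in at_top. \<forall>y\<in>A x. local_mass c G (x - y) \<le> w y * local_mass c G x"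
    and w: "integrable F w" "\<And>y. 0 \<le> w y"
  shows "((\<lambda>x. sum_mass c F G (\<lambda>y _. y \<in> A x) x / local_mass c G x) \<longlongrightarrow> measure F A') at_top"
proof -
  interpret F: finite_borel_measure F by fact
  interpret G: finite_borel_measure G by fact
  note [measurable] = G.borel_measurable_local_mass[OF c]
  let ?g = "local_mass c G"
  have "((\<lambda>x. \<integral>y. indicator (A x) y * ?g (x - y) / ?g x \<partial>F) \<longlongrightarrow> (\<integral>y. indicator A' y \<partial>F)) at_top"
  proof (rule integral_dominated_convergence_at_top[where w = w])
    show "AE y in F. ((\<lambda>x. indicator (A x) y * ?g (x - y) / ?g x) \<longlongrightarrow> indicator A' y) at_top"
    proof (rule AE_I2)
      fix y
      have "\<forall>\<^sub>F x in at_top. indicator A' y * (?g (x + - y) / ?g x) = indicator (A x) y * ?g (x - y) / ?g x"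
        using A_lim[of y] by eventually_elim (auto simp: indicator_def)
      moreover have "((\<lambda>x. indicator A' y * (?g (x + - y) / ?g x)) \<longlongrightarrow> indicator A' y * 1) at_top"
        by (intro tendsto_mult_left long_tailed_shift[OF lt])
      ultimately show "((\<lambda>x. indicator (A x) y * ?g (x - y) / ?g x) \<longlongrightarrow> indicator A' y) at_top"
        using Lim_transform_eventually by fastforce
    qed
    show "\<forall>\<^sub>F x in at_top. AE y in F. norm (indicator (A x) y * ?g (x - y) / ?g x) \<le> w y"
      using dom long_tailed_pos[OF lt]
    proof eventually_elim
      case (elim x)
      then show ?case using w by (intro AE_I2) (auto simp: indicator_def field_simps)
    qed
    show "(\<lambda>y. indicator (A x) y * ?g (x - y) / ?g x) \<in> borel_measurable F" for x
      unfolding measurable_cong_sets[OF F.M_is_borel refl] by measurable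
    show "indicat_real A' \<in> borel_measurable F"
      unfolding measurable_cong_sets[OF F.M_is_borel refl] by measurable
  qed (rule w)
  moreover have "(\<integral>y. indicator (A x) y * ?g (x - y) / ?g x \<partial>F) = sum_mass c F G (\<lambda>y _. y \<in> A x) x / ?g x" for x
    by (subst sum_mass_eq_integral[OF fin c]) simp_all
  moreover have "(\<integral>y. indicator A' y \<partial>F) = measure F A'"
    using A by (simp add: F.borel_UNIV)
  ultimately show ?thesis by (simp only:)
qed

lemma (in finite_borel_measure) long_tailed_compact_bound:
  assumes c: "0 < c" and lt: "long_tailed (local_mass c M)"
  obtains K where "1 \<le> K"
    "\<forall>\<^sub>F x in at_top. \<forall>y\<in>{-B..B}. local_mass c M (x - y) \<le> K * local_mass c M x"
proof -
  obtain x0 C where x0: "0 < x0" and C: "1 \<le> C"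
    and up: "\<And>x y. x0 \<le> x \<Longrightarrow> 0 \<le> y \<Longrightarrow> local_mass c M (x + y) \<le> C * exp (1 * y) * local_mass c M x"
    and dn: "\<And>x y. x0 \<le> x \<Longrightarrow> 0 \<le> y \<Longrightarrow> local_mass c M x \<le> C * exp (1 * y) * local_mass c M (x + y)"
    by (rule long_tailed_growth[OF c lt, of 1], simp, blast)
  show ?thesis
  proof (rule that[of "C * exp \<bar>B\<bar>"])
    have "1 * 1 \<le> C * exp \<bar>B\<bar>" using C by (intro mult_mono) auto
    then show "1 \<le> C * exp \<bar>B\<bar>" by simp
    show "\<forall>\<^sub>F x in at_top. \<forall>y\<in>{-B..B}. local_mass c M (x - y) \<le> C * exp \<bar>B\<bar> * local_mass c M x"
      using eventually_ge_at_top[of "x0 + \<bar>B\<bar>"]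
    proof eventually_elim
      case (elim x)
      show ?case
      proof
        fix y assume y: "y \<in> {-B..B}"
        have "local_mass c M (x - y) \<le> C * exp \<bar>y\<bar> * local_mass c M x"
          using up[of x "- y"] dn[of "x - y" y] elim y x0 by (cases "y \<le> 0") auto
        also have "\<dots> \<le> C * exp \<bar>B\<bar> * local_mass c M x"
          using y C by (intro mult_right_mono mult_left_mono) auto
        finally show "local_mass c M (x - y) \<le> C * exp \<bar>B\<bar> * local_mass c M x" .
      qed
    qed
  qed
qed

lemma sum_mass_ratio_compact:
  assumes fin: "finite_borel_measure F" "finite_borel_measure G" and c: "0 < c"
    and lt: "long_tailed (local_mass c G)"
    and A: "A \<in> sets borel" "A \<subseteq> {-B..B}"
  shows "((\<lambda>x. sum_mass c F G (\<lambda>y _. y \<in> A) x / local_mass c G x) \<longlongrightarrow> measure F A) at_top"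
proof -
  interpret F: finite_borel_measure F by fact
  interpret G: finite_borel_measure G by fact
  obtain K where K: "1 \<le> K"
    "\<forall>\<^sub>F x in at_top. \<forall>y\<in>{-B..B}. local_mass c G (x - y) \<le> K * local_mass c G x"
    by (rule G.long_tailed_compact_bound[OF c lt])
  show ?thesis
  proof (rule sum_mass_ratio_tendsto[OF fin c lt, where w = "\<lambda>_. K"])
    show "\<forall>\<^sub>F x in at_top. \<forall>y\<in>A. local_mass c G (x - y) \<le> K * local_mass c G x"
      using K(2) by eventually_elim (use A in auto)
  qed (use A K in auto)
qed

text \<open>The two events that one summand lies in \<open>[-B, B]\<close> are disjoint for large \<open>x\<close> and already account
  for nearly twice the local mass of \<open>F\<close>.\<close>

lemma S_Delta_imp_negligible_pairs:
  assumes c: "0 < c" and F: "F \<in> S_Delta c"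
  shows "negligible_pairs c F F (local_mass c F)"
  unfolding negligible_pairs_def
proof (intro allI impI)
  fix e :: real assume e: "e > 0"
  interpret real_distribution F using F by (auto simp: S_Delta_def L_Delta_def)
  note fin = finite_borel_measure_M
  let ?f = "local_mass c F"
  have lt: "long_tailed ?f" using F by (auto simp: S_Delta_def L_Delta_def)
  obtain B0 where B0: "0 < B0" "\<And>B. B0 \<le> B \<Longrightarrow> measure F UNIV - e / 2 < measure F {-B..B}"
    using ex_symmetric_interval[of "e / 2"] e by auto
  show "\<exists>B0. \<forall>B\<ge>B0. \<forall>\<^sub>F x in at_top. sum_mass c F F (\<lambda>y z. B < y \<and> B < z) x \<le> e * ?f x"
  proof (intro exI allI impI)
    fix B assume B: "B0 \<le> B"
    have "1 - e / 2 < measure F {-B..B}" using B0(2)[OF B] prob_space by simp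
    have "(\<lambda>x. local_mass c (F \<star> F) x) \<sim>[at_top] (\<lambda>x. 2 * ?f x)" using F by (simp add: S_Delta_def)
    then have "((\<lambda>x. local_mass c (F \<star> F) x / (2 * ?f x)) \<longlongrightarrow> 1) at_top"
      using long_tailed_pos[OF lt] by (subst (asm) asymp_equiv_iff_quotient) auto
    from tendsto_mult_left[OF this, of 2]
    have "((\<lambda>x. local_mass c (F \<star> F) x / ?f x - 2 * (sum_mass c F F (\<lambda>y _. y \<in> {-B..B}) x / ?f x))
        \<longlongrightarrow> 2 - 2 * measure F {-B..B}) at_top"
      by (intro tendsto_intros sum_mass_ratio_compact[OF fin fin c lt, where B = B]) auto
    moreover have "2 - 2 * measure F {-B..B} < e" using \<open>1 - e / 2 < measure F {-B..B}\<close> by simp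
    ultimately have "\<forall>\<^sub>F x in at_top.
        local_mass c (F \<star> F) x / ?f x - 2 * (sum_mass c F F (\<lambda>y _. y \<in> {-B..B}) x / ?f x) < e"
      by (rule order_tendstoD(2))
    then show "\<forall>\<^sub>F x in at_top. sum_mass c F F (\<lambda>y z. B < y \<and> B < z) x \<le> e * ?f x"
      using long_tailed_pos[OF lt] eventually_ge_at_top[of "2 * B"]
    proof eventually_elim
      case (elim x)
      have "sum_mass c F F (\<lambda>y _. y \<in> {-B..B}) x + sum_mass c F F (\<lambda>_ z. z \<in> {-B..B}) x
          \<le> sum_mass c F F (\<lambda>y z. y \<in> {-B..B} \<or> z \<in> {-B..B}) x"
        by (rule sum_mass_superadd[OF fin fin]) (use elim in auto)
      moreover have "sum_mass c F F (\<lambda>y z. y \<in> {-B..B} \<or> z \<in> {-B..B}) x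
            + sum_mass c F F (\<lambda>y z. B < y \<and> B < z) x
          \<le> sum_mass c F F (\<lambda>_ _. True) x"
        by (rule sum_mass_superadd[OF fin fin]) auto
      moreover have "sum_mass c F F (\<lambda>_ z. z \<in> {-B..B}) x = sum_mass c F F (\<lambda>y _. y \<in> {-B..B}) x"
        by (rule sum_mass_swap[OF fin fin]) simp
      ultimately have "2 * sum_mass c F F (\<lambda>y _. y \<in> {-B..B}) x + sum_mass c F F (\<lambda>y z. B < y \<and> B < z) x
          \<le> local_mass c (F \<star> F) x"
        by (simp add: local_mass_convolution[OF fin fin])
      moreover have "local_mass c (F \<star> F) x - 2 * sum_mass c F F (\<lambda>y _. y \<in> {-B..B}) x < e * ?f x"
        using elim by (simp add: field_simps)
      ultimately show ?case by linarith
    qed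
  qed
qed

text \<open>For a distribution on the half-line one of two summands with sum in \<open>x + \<Delta>\<close> is bounded
  unless both are large, so the two cases with one bounded summand account for the factor 2.\<close>

lemma negligible_pairs_imp_S_Delta:
  assumes c: "0 < c" and F: "F \<in> L_Delta c" and supp: "measure F {..<0} = 0"
    and neg: "negligible_pairs c F F (local_mass c F)"
  shows "F \<in> S_Delta c"
proof -
  interpret real_distribution F using F by (auto simp: L_Delta_def)
  note fin = finite_borel_measure_M
  let ?f = "local_mass c F"
  have lt: "long_tailed ?f" using F by (auto simp: L_Delta_def)
  note pos = long_tailed_pos[OF lt]
  have neg0: "sum_mass c F F (\<lambda>y _. y \<in> {..<0}) x = 0" for x
    using sum_mass_le_const[OF fin fin c, of "{..<0}" x "measure F UNIV"] local_mass_le_mass supp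
      sum_mass_nonneg[of c F F "\<lambda>y _. y \<in> {..<0}" x] by (auto simp del: lessThan_iff)
  have swap: "sum_mass c F F (\<lambda>_ z. z \<in> A) x = sum_mass c F F (\<lambda>y _. y \<in> A) x"
    if [measurable]: "A \<in> sets borel" for A x
    by (rule sum_mass_swap[OF fin fin]) measurable
  have key: "\<forall>\<^sub>F x in at_top. \<bar>local_mass c (F \<star> F) x / ?f x - 2\<bar> < e" if e: "e > 0" for e
  proof -
    obtain B0 where B0: "0 < B0" "\<And>B. B0 \<le> B \<Longrightarrow> measure F UNIV - e / 8 < measure F {-B..B}"
      using ex_symmetric_interval[of "e / 8"] e by auto
    obtain B1 where B1: "\<And>B. B1 \<le> B \<Longrightarrow>
        \<forall>\<^sub>F x in at_top. sum_mass c F F (\<lambda>y z. B < y \<and> B < z) x \<le> e / 2 * ?f x"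
      using neg e unfolding negligible_pairs_def by (meson half_gt_zero)
    define B where "B = max B0 B1"
    have FB: "1 - e / 8 < measure F {-B..B}" "measure F {-B..B} \<le> 1"
      using B0(2)[of B] prob_space by (auto simp: B_def)
    have lim: "((\<lambda>x. sum_mass c F F (\<lambda>y _. y \<in> {-B..B}) x / ?f x) \<longlongrightarrow> measure F {-B..B}) at_top"
      by (rule sum_mass_ratio_compact[OF fin fin c lt, where B = B]) auto
    have "\<forall>\<^sub>F x in at_top. sum_mass c F F (\<lambda>y _. y \<in> {-B..B}) x / ?f x < 1 + e / 8"
      "\<forall>\<^sub>F x in at_top. 1 - e / 8 < sum_mass c F F (\<lambda>y _. y \<in> {-B..B}) x / ?f x"
      by (rule order_tendstoD[OF lim], use FB e in linarith)+
    moreover have "\<forall>\<^sub>F x in at_top. sum_mass c F F (\<lambda>y z. B < y \<and> B < z) x \<le> e / 2 * ?f x"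
      by (rule B1) (simp add: B_def)
    ultimately show ?thesis using pos eventually_ge_at_top[of "2 * B"]
    proof eventually_elim
      case (elim x)
      let ?s = "sum_mass c F F"
      have "?s (\<lambda>_ _. True) x \<le> ?s (\<lambda>y z. y < 0 \<or> z < 0) x + ?s (\<lambda>y z. 0 \<le> y \<and> 0 \<le> z) x"
        by (rule sum_mass_subadd[OF fin fin]) auto
      moreover have "?s (\<lambda>y z. y < 0 \<or> z < 0) x \<le> ?s (\<lambda>y z. y \<in> {..<0}) x + ?s (\<lambda>y z. z \<in> {..<0}) x"
        by (rule sum_mass_subadd[OF fin fin]) auto
      moreover have "?s (\<lambda>y z. 0 \<le> y \<and> 0 \<le> z) x
          \<le> ?s (\<lambda>y z. y \<in> {-B..B} \<or> z \<in> {-B..B}) x + ?s (\<lambda>y z. B < y \<and> B < z) x"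
        by (rule sum_mass_subadd[OF fin fin]) (use B0(1) in \<open>auto simp: B_def\<close>)
      moreover have "?s (\<lambda>y z. y \<in> {-B..B} \<or> z \<in> {-B..B}) x
          \<le> ?s (\<lambda>y z. y \<in> {-B..B}) x + ?s (\<lambda>y z. z \<in> {-B..B}) x"
        by (rule sum_mass_subadd[OF fin fin]) auto
      moreover have "?s (\<lambda>y _. y \<in> {-B..B}) x + ?s (\<lambda>_ z. z \<in> {-B..B}) x \<le> ?s (\<lambda>_ _. True) x"
        by (rule sum_mass_superadd[OF fin fin]) (use elim in auto)
      ultimately have "2 * ?s (\<lambda>y _. y \<in> {-B..B}) x \<le> local_mass c (F \<star> F) x"
        "local_mass c (F \<star> F) x \<le> 2 * ?s (\<lambda>y _. y \<in> {-B..B}) x + e / 2 * ?f x"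
        using elim(3) neg0[of x] swap[of "{..<0}" x, simplified] swap[of "{-B..B}" x, simplified]
        unfolding local_mass_convolution[OF fin fin] by auto
      moreover have "?s (\<lambda>y _. y \<in> {-B..B}) x < (1 + e / 8) * ?f x"
        "(1 - e / 8) * ?f x < ?s (\<lambda>y _. y \<in> {-B..B}) x"
        using elim by (simp_all add: field_simps)
      moreover have "0 < e * ?f x" using e elim by simp
      ultimately have "(2 - e) * ?f x < local_mass c (F \<star> F) x" "local_mass c (F \<star> F) x < (2 + e) * ?f x"
        by (simp_all add: algebra_simps)
      then have "2 - e < local_mass c (F \<star> F) x / ?f x" "local_mass c (F \<star> F) x / ?f x < 2 + e"
        using elim by (simp_all add: field_simps)
      then show ?case by linarith
    qed
  qed
  have "((\<lambda>x. local_mass c (F \<star> F) x / ?f x) \<longlongrightarrow> 2) at_top"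
    using key by (auto simp: tendsto_iff dist_real_def)
  from tendsto_mult_left[OF this, of "1 / 2"]
  have "local_mass c (F \<star> F) \<sim>[at_top] (\<lambda>x. 2 * ?f x)"
    using pos by (subst asymp_equiv_iff_quotient) (auto simp: mult.commute)
  with F show ?thesis by (simp add: S_Delta_def)
qed

text \<open>A light-tailed perturbation does not change the local mass \<open>f\<close> asymptotically. For \<open>0 \<le> y \<le> x - x\<^sub>0\<close> the
  long tail bounds \<open>f (x - y) / f x\<close> by a multiple of \<open>e\<^sup>y\<^sup>/\<^sup>2\<close>, and for \<open>y < 0\<close> almost decrease
  bounds it by a constant, so it is dominated by an \<open>\<eta>\<close>-integrable function. The \<open>\<eta>\<close>-mass of larger \<open>y\<close> is
  of order \<open>e\<^sup>-\<^sup>x\<close>, whereas \<open>f\<close> decays at most like \<open>e\<^sup>-\<^sup>x\<^sup>/\<^sup>2\<close>.\<close>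

lemma convolution_light_asymp:
  assumes c: "0 < c" and eta: "real_distribution \<eta>" "integrable \<eta> exp"
    and F: "finite_borel_measure F"
    and lt: "long_tailed (local_mass c F)" and ad: "almost_decreasing (local_mass c F)"
  shows "local_mass c (\<eta> \<star> F) \<sim>[at_top] local_mass c F"
proof -
  interpret E: real_distribution \<eta> by fact
  interpret F: finite_borel_measure F by fact
  note fin = E.finite_borel_measure_M F
  let ?f = "local_mass c F"
  obtain x0 C where x0: "0 < x0" and C: "1 \<le> C" and pos: "\<And>x. x0 \<le> x \<Longrightarrow> 0 < ?f x"
    and dn: "\<And>x y. x0 \<le> x \<Longrightarrow> 0 \<le> y \<Longrightarrow> ?f x \<le> C * exp (1 / 2 * y) * ?f (x + y)"
    by (rule F.long_tailed_growth[OF c lt, of "1 / 2"], simp, blast)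
  obtain x1 K where x1: "0 < x1" "0 < K" "\<And>x y. x1 < x \<Longrightarrow> 0 < y \<Longrightarrow> ?f (x + y) \<le> K * ?f x"
    using ad unfolding almost_decreasing_def by blast
  have dom: "?f (x - y) \<le> (C * (1 + exp y) + K) * ?f x" if "max x0 x1 < x" "y \<le> x - x0" for x y
  proof (cases "0 \<le> y")
    case True
    have "?f (x - y) \<le> C * exp (1 / 2 * y) * ?f x" using dn[of "x - y" y] that True by simp
    also have "\<dots> \<le> (C * (1 + exp y) + K) * ?f x"
    proof (rule mult_right_mono)
      have "exp (1 / 2 * y) \<le> exp y" using True by simp
      then have "exp (1 / 2 * y) \<le> 1 + exp y" by linarith
      then have "C * exp (1 / 2 * y) \<le> C * (1 + exp y)" using C by (intro mult_left_mono) auto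
      then show "C * exp (1 / 2 * y) \<le> C * (1 + exp y) + K" using x1 by simp
    qed simp
    finally show ?thesis .
  next
    case False
    have "?f (x - y) \<le> K * ?f x" using x1(3)[of x "- y"] False that by simp
    also have "\<dots> \<le> (C * (1 + exp y) + K) * ?f x"
      using C by (intro mult_right_mono) auto
    finally show ?thesis .
  qed
  have main: "((\<lambda>x. sum_mass c \<eta> F (\<lambda>y _. y \<in> {..x - x0}) x / ?f x) \<longlongrightarrow> measure \<eta> UNIV) at_top"
  proof (rule sum_mass_ratio_tendsto[OF fin c lt, where w = "\<lambda>y. C * (1 + exp y) + K"])
    show "\<forall>\<^sub>F x in at_top. y \<in> {..x - x0} \<longleftrightarrow> y \<in> UNIV" for y
      using eventually_ge_at_top[of "y + x0"] by eventually_elim auto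
    show "\<forall>\<^sub>F x in at_top. \<forall>y\<in>{..x - x0}. ?f (x - y) \<le> (C * (1 + exp y) + K) * ?f x"
      using eventually_gt_at_top[of "max x0 x1"] by eventually_elim (use dom in auto)
    show "integrable \<eta> (\<lambda>y. C * (1 + exp y) + K)"
      using eta by auto
    show "0 \<le> C * (1 + exp y) + K" for y using C x1 by (simp add: add_nonneg_nonneg)
  qed auto
  define D where "D = measure F UNIV * (\<integral>y. exp y \<partial>\<eta>)"
  have D: "0 \<le> D" by (auto simp: D_def intro!: mult_nonneg_nonneg integral_nonneg)
  have rest: "sum_mass c \<eta> F (\<lambda>y _. y \<in> {x - x0<..}) x \<le> D * exp (- (x - x0))" for x
  proof -
    have le: "sum_mass c \<eta> F (\<lambda>y _. y \<in> {x - x0<..}) x \<le> measure F UNIV * measure \<eta> {x - x0<..}"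
      by (rule sum_mass_le_const[OF fin c]) (auto intro: F.local_mass_le_mass)
    have "measure \<eta> {x - x0<..} = (\<integral>y. indicator {x - x0<..} y \<partial>\<eta>)" by simp
    also have "\<dots> \<le> (\<integral>y. exp (- (x - x0)) * exp y \<partial>\<eta>)"
    proof (rule integral_mono)
      show "integrable \<eta> (indicat_real {x - x0<..})"
        by (intro integrable_real_indicator) (auto simp: E.emeasure_eq_measure)
      show "integrable \<eta> (\<lambda>y. exp (- (x - x0)) * exp y)"
        using eta by (intro integrable_mult_right)
      show "indicator {x - x0<..} y \<le> exp (- (x - x0)) * exp y" for y
        by (auto simp: indicator_def simp flip: exp_add)
    qed
    also have "\<dots> = exp (- (x - x0)) * (\<integral>y. exp y \<partial>\<eta>)" by simp
    finally have "measure \<eta> {x - x0<..} \<le> exp (- (x - x0)) * (\<integral>y. exp y \<partial>\<eta>)" .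
    then have "measure F UNIV * measure \<eta> {x - x0<..} \<le> D * exp (- (x - x0))"
      unfolding D_def by (simp only: mult.assoc mult.commute[of "integral\<^sup>L \<eta> exp"])
        (rule mult_left_mono, auto)
    with le show ?thesis by linarith
  qed
  have small: "((\<lambda>x. sum_mass c \<eta> F (\<lambda>y _. y \<in> {x - x0<..}) x / ?f x) \<longlongrightarrow> 0) at_top"
  proof (rule tendsto_sandwich[OF _ _ tendsto_const])
    define L where "L = D * C / ?f x0"
    show "\<forall>\<^sub>F x in at_top. sum_mass c \<eta> F (\<lambda>y _. y \<in> {x - x0<..}) x / ?f x \<le> L * exp (- ((x - x0) / 2))"
      using eventually_ge_at_top[of x0]
    proof eventually_elim
      case (elim x)
      have fx: "?f x0 \<le> C * exp ((x - x0) / 2) * ?f x" using dn[of x0 "x - x0"] elim by simp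
      define u where "u = exp (- ((x - x0) / 2))"
      have u: "0 < u" "exp ((x - x0) / 2) * u = 1" and e: "exp (- (x - x0)) = u * u"
        by (simp_all add: u_def flip: exp_add)
      have "?f x0 * u \<le> C * (exp ((x - x0) / 2) * u) * ?f x"
        using mult_right_mono[OF fx, of u] less_imp_le[OF u(1)] by (simp only: mult_ac)
      then have "?f x0 * u \<le> C * ?f x" by (simp add: u(2))
      then have "D * u * (?f x0 * u) \<le> D * u * (C * ?f x)"
        using D u by (intro mult_left_mono) auto
      then have "D * exp (- (x - x0)) \<le> L * exp (- ((x - x0) / 2)) * ?f x"
        unfolding L_def e u_def[symmetric] using pos[of x0] by (simp add: field_simps)
      with rest[of x] show ?case using pos[OF elim] by (simp add: field_simps)
    qed
    have "filterlim (\<lambda>x::real. - ((x - x0) / 2)) at_bot at_top" by real_asymp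
    then have "((\<lambda>x. exp (- ((x - x0) / 2))) \<longlongrightarrow> 0) at_top"
      by (rule filterlim_compose[OF exp_at_bot])
    then show "((\<lambda>x. L * exp (- ((x - x0) / 2))) \<longlongrightarrow> 0) at_top"
      by (rule tendsto_mult_right_zero)
    show "\<forall>\<^sub>F x in at_top. 0 \<le> sum_mass c \<eta> F (\<lambda>y _. y \<in> {x - x0<..}) x / ?f x"
      by simp
  qed
  have split: "local_mass c (\<eta> \<star> F) x =
      sum_mass c \<eta> F (\<lambda>y _. y \<in> {..x - x0}) x + sum_mass c \<eta> F (\<lambda>y _. y \<in> {x - x0<..}) x" for x
  proof (rule antisym)
    show "local_mass c (\<eta> \<star> F) x \<le>
        sum_mass c \<eta> F (\<lambda>y _. y \<in> {..x - x0}) x + sum_mass c \<eta> F (\<lambda>y _. y \<in> {x - x0<..}) x"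
      unfolding local_mass_convolution[OF fin] by (rule sum_mass_subadd[OF fin]) auto
    show "sum_mass c \<eta> F (\<lambda>y _. y \<in> {..x - x0}) x + sum_mass c \<eta> F (\<lambda>y _. y \<in> {x - x0<..}) x
        \<le> local_mass c (\<eta> \<star> F) x"
      unfolding local_mass_convolution[OF fin] by (rule sum_mass_superadd[OF fin]) auto
  qed
  have "((\<lambda>x. local_mass c (\<eta> \<star> F) x / ?f x) \<longlongrightarrow> measure \<eta> UNIV + 0) at_top"
    unfolding split add_divide_distrib by (rule tendsto_add[OF main small])
  then show ?thesis
    using E.prob_space by (simp add: asymp_equiv_iff_quotient[OF long_tailed_pos[OF lt]])
qed

section \<open>Compound Poisson distributions\<close>

lemma char_convolution:
  assumes "real_distribution F" "real_distribution G"
  shows "char (F \<star> G) t = char F t * char G t"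
proof -
  interpret F: real_distribution F by fact
  interpret G: real_distribution G by fact
  interpret P: pair_prob_space F G by unfold_locales
  have "char (F \<star> G) t = (\<integral>w. iexp (t * (fst w + snd w)) \<partial>(F \<Otimes>\<^sub>M G))"
    unfolding char_def convolution_def case_prod_beta by (subst integral_distr) auto
  also have "\<dots> = (\<integral>w. iexp (t * fst w) * iexp (t * snd w) \<partial>(F \<Otimes>\<^sub>M G))"
    by (simp add: ring_distribs exp_add)
  also have "\<dots> = (\<integral>y. \<integral>z. iexp (t * y) * iexp (t * z) \<partial>G \<partial>F)"
    by (subst P.integral_fst'[symmetric])
      (auto intro!: P.P.integrable_const_bound[where B = 1] simp: norm_mult)
  finally show ?thesis by (simp add: char_def)
qed

fun conv_pow :: "real measure \<Rightarrow> nat \<Rightarrow> real measure" where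
  "conv_pow F 0 = return borel 0"
| "conv_pow F (Suc n) = (F \<star> conv_pow F n)"

lemma real_distribution_return: "real_distribution (return borel x)"
  by (simp add: real_distribution_def real_distribution_axioms_def prob_space_return)

lemma real_distribution_conv_pow: "real_distribution F \<Longrightarrow> real_distribution (conv_pow F n)"
  by (induction n) (auto simp: real_distribution_return intro: real_distribution_convolution)

lemma char_return: "char (return borel x) t = iexp (t * x)"
  unfolding char_def by (subst integral_return) auto

lemma char_conv_pow: "real_distribution F \<Longrightarrow> char (conv_pow F n) t = char F t ^ n"
  by (induction n) (auto simp: char_return char_convolution real_distribution_conv_pow)

definition poisson_mixture :: "real \<Rightarrow> real measure \<Rightarrow> real measure" where
  "poisson_mixture l F = measure_pmf (poisson_pmf l) \<bind> conv_pow F"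

lemma measurable_conv_pow:
  assumes "real_distribution F"
  shows "conv_pow F \<in> measurable (measure_pmf p) (subprob_algebra borel)"
proof -
  have "conv_pow F n \<in> space (subprob_algebra borel)" for n
  proof -
    interpret real_distribution "conv_pow F n" by (rule real_distribution_conv_pow[OF assms])
    show ?thesis by (simp add: space_subprob_algebra subprob_space_axioms)
  qed
  then show ?thesis by simp
qed

lemma real_distribution_poisson_mixture:
  assumes F: "real_distribution F"
  shows "real_distribution (poisson_mixture l F)"
proof -
  have "prob_space (poisson_mixture l F)"
    unfolding poisson_mixture_def
  proof (rule prob_space.prob_space_bind[OF measure_pmf.prob_space_axioms _ measurable_conv_pow[OF F]])
    show "AE n in measure_pmf (poisson_pmf l). prob_space (conv_pow F n)"
      using real_distribution_conv_pow[OF F] by (auto simp: real_distribution_def)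
  qed
  moreover have "sets (poisson_mixture l F) = sets borel"
    unfolding poisson_mixture_def
    using real_distribution_conv_pow[OF F]
    by (intro sets_bind) (auto simp: real_distribution_def real_distribution_axioms_def)
  ultimately show ?thesis
    by (simp add: real_distribution_def real_distribution_axioms_def)
qed

lemma nn_integral_poisson_mixture:
  assumes F: "real_distribution F" and l: "0 < l" and f: "f \<in> borel_measurable borel"
  shows "(\<integral>\<^sup>+x. f x \<partial>poisson_mixture l F) =
    (\<Sum>n. ennreal (l ^ n / fact n * exp (- l)) * (\<integral>\<^sup>+x. f x \<partial>conv_pow F n))"
  unfolding poisson_mixture_def
  by (subst nn_integral_bind[OF f measurable_conv_pow[OF F]])
    (simp add: measure_pmf_eq_density[of "poisson_pmf l"] nn_integral_density
      nn_integral_count_space_nat pmf_poisson[OF l])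

lemma char_poisson_mixture:
  assumes F: "real_distribution F" and l: "0 < l"
  shows "char (poisson_mixture l F) t = exp (of_real l * (char F t - 1))"
proof -
  interpret F: real_distribution F by fact
  note bind = measurable_conv_pow[OF F, of "poisson_pmf l"]
  interpret W: real_distribution "poisson_mixture l F" by (rule real_distribution_poisson_mixture[OF F])
  have pow: "real_distribution (conv_pow F n)" for n by (rule real_distribution_conv_pow[OF F])
  have re: "(\<integral>x. f x \<partial>poisson_mixture l F) = (\<integral>n. \<integral>x. f x \<partial>conv_pow F n \<partial>measure_pmf (poisson_pmf l))"
    if f: "f \<in> borel_measurable borel" "\<And>x. \<bar>f x\<bar> \<le> (1::real)" for f
    unfolding poisson_mixture_def
  proof (rule integral_bind[OF _ _ bind measure_pmf.finite_measure_axioms, where B' = 1 and B = 1])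
    have "prob_space (conv_pow F n)" for n using pow[of n] by (simp add: real_distribution_def)
    then show "AE n in measure_pmf (poisson_pmf l). emeasure (conv_pow F n) (space (conv_pow F n)) \<le> ennreal 1"
      by (simp add: prob_space.emeasure_space_1)
  qed (use f in auto)
  have int: "integrable M (\<lambda>x. iexp (t * x))" if "real_distribution M" for M
  proof -
    interpret real_distribution M by fact
    show ?thesis by (rule integrable_const_bound[where B = 1]) auto
  qed
  have reim: "Re (char M t) = (\<integral>x. Re (iexp (t * x)) \<partial>M)" "Im (char M t) = (\<integral>x. Im (iexp (t * x)) \<partial>M)"
    if "real_distribution M" for M
    unfolding char_def using int[OF that] by simp_all
  have bnd: "\<bar>Re (iexp (t * x))\<bar> \<le> 1" "\<bar>Im (iexp (t * x))\<bar> \<le> 1" for x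
    using abs_Re_le_cmod[of "iexp (t * x)"] abs_Im_le_cmod[of "iexp (t * x)"] by simp_all
  have ci: "integrable (measure_pmf (poisson_pmf l)) (\<lambda>n. char (conv_pow F n) t)"
    using real_distribution.cmod_char_le_1[OF pow]
    by (intro measure_pmf.integrable_const_bound[where B = 1]) auto
  have "char (poisson_mixture l F) t = (\<integral>n. char (conv_pow F n) t \<partial>measure_pmf (poisson_pmf l))"
  proof (rule complex_eqI)
    have "Re (char (poisson_mixture l F) t) = (\<integral>n. Re (char (conv_pow F n) t) \<partial>measure_pmf (poisson_pmf l))"
      unfolding reim[OF pow] reim[OF W.real_distribution_axioms] by (rule re[OF _ bnd(1)]) measurable
    then show "Re (char (poisson_mixture l F) t) = Re (\<integral>n. char (conv_pow F n) t \<partial>measure_pmf (poisson_pmf l))"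
      using ci by simp
    have "Im (char (poisson_mixture l F) t) = (\<integral>n. Im (char (conv_pow F n) t) \<partial>measure_pmf (poisson_pmf l))"
      unfolding reim[OF pow] reim[OF W.real_distribution_axioms] by (rule re[OF _ bnd(2)]) measurable
    then show "Im (char (poisson_mixture l F) t) = Im (\<integral>n. char (conv_pow F n) t \<partial>measure_pmf (poisson_pmf l))"
      using ci by simp
  qed
  also have "\<dots> = (\<integral>n. complex_of_real (l ^ n / fact n * exp (- l)) * char F t ^ n \<partial>count_space UNIV)"
    by (simp add: char_conv_pow[OF F] measure_pmf_eq_density[of "poisson_pmf l"] integral_density
        pmf_poisson[OF l] scaleR_conv_of_real l less_imp_le)
  also have "\<dots> = (\<Sum>n. complex_of_real (l ^ n / fact n * exp (- l)) * char F t ^ n)"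
  proof (rule sums_unique[OF sums_integral_count_space_nat])
    have sm: "summable (\<lambda>n. l ^ n / fact n * exp (- l))"
      using summable_mult[OF summable_exp[of l], of "exp (- l)"] by (simp add: divide_inverse mult_ac)
    have bd: "norm (complex_of_real (l ^ n / fact n * exp (- l)) * char F t ^ n)
        \<le> l ^ n / fact n * exp (- l)" for n
    proof -
      have "norm (complex_of_real (l ^ n / fact n * exp (- l)) * char F t ^ n) =
          l ^ n / fact n * exp (- l) * norm (char F t) ^ n"
        using l by (simp add: norm_mult norm_power norm_divide)
      also have "\<dots> \<le> l ^ n / fact n * exp (- l)"
        using l by (intro mult_left_le power_le_one F.cmod_char_le_1) auto
      finally show ?thesis .
    qed
    show "integrable (count_space UNIV) (\<lambda>n. complex_of_real (l ^ n / fact n * exp (- l)) * char F t ^ n)"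
      unfolding integrable_count_space_nat_iff
      by (rule summable_comparison_test'[OF sm, of 0]) (use bd in simp)
  qed
  also have "(\<lambda>n. complex_of_real (l ^ n / fact n * exp (- l)) * char F t ^ n) =
      (\<lambda>n. of_real (exp (- l)) * ((of_real l * char F t) ^ n /\<^sub>R fact n))"
    by (auto simp: power_mult_distrib scaleR_conv_of_real divide_inverse)
  also have "(\<Sum>n. of_real (exp (- l)) * ((of_real l * char F t) ^ n /\<^sub>R fact n)) =
      of_real (exp (- l)) * exp (of_real l * char F t)"
    by (subst suminf_mult) (auto simp: exp_def summable_exp_generic)
  also have "\<dots> = exp (of_real l * (char F t - 1))"
    by (simp add: exp_of_real[symmetric] exp_add[symmetric] algebra_simps)
  finally show ?thesis .
qed

text \<open>The null measure is treated as 0 times \<open>\<delta>\<^sub>0\<close>, so that every finite measure is its mass times a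
  distribution.\<close>

definition mass_normalized :: "real measure \<Rightarrow> real measure" where
  "mass_normalized \<rho> = (if measure \<rho> UNIV = 0 then return borel 0 else
     scale_measure (ennreal (1 / measure \<rho> UNIV)) \<rho>)"

lemma (in finite_borel_measure) real_distribution_mass_normalized:
  "real_distribution (mass_normalized M)"
proof (cases "measure M UNIV = 0")
  case False
  then have "measure M UNIV > 0" by (simp add: zero_less_measure_iff)
  then have "prob_space (scale_measure (ennreal (1 / measure M UNIV)) M)"
    by (intro prob_spaceI)
      (simp add: space_scale_measure borel_UNIV emeasure_eq_measure ennreal_mult[symmetric])
  then show ?thesis
    using False by (simp add: mass_normalized_def real_distribution_def real_distribution_axioms_def M_is_borel)
qed (simp add: mass_normalized_def real_distribution_return)

lemma (in finite_borel_measure) nn_integral_mass_normalized: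
  assumes [measurable]: "f \<in> borel_measurable borel"
  shows "(\<integral>\<^sup>+x. f x \<partial>M) = ennreal (measure M UNIV) * (\<integral>\<^sup>+x. f x \<partial>mass_normalized M)"
proof (cases "measure M UNIV = 0")
  case True
  then have "emeasure M (space M) = 0" by (simp add: emeasure_eq_measure borel_UNIV)
  then have "(\<integral>\<^sup>+x. f x \<partial>M) = 0" using nn_integral_null_set emeasure_0_AE nn_integral_0_iff_AE
    by (metis (no_types, lifting) nn_integral_cong_AE nn_integral_0_iff_AE nn_integral_const mult_zero_left eventually_mono)
  then show ?thesis using True by simp
next
  case False
  then have "measure M UNIV > 0" by (simp add: zero_less_measure_iff)
  then show ?thesis
    by (simp add: mass_normalized_def nn_integral_scale_measure measurable_cong_sets[OF M_is_borel refl]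
        mult.assoc[symmetric] ennreal_mult[symmetric])
qed

lemma (in finite_borel_measure) integral_mass_normalized:
  fixes f :: "real \<Rightarrow> 'a :: {banach, second_countable_topology}"
  assumes [measurable]: "f \<in> borel_measurable borel"
  shows "(\<integral>x. f x \<partial>M) = measure M UNIV *\<^sub>R (\<integral>x. f x \<partial>mass_normalized M)"
proof -
  interpret N: real_distribution "mass_normalized M" by (rule real_distribution_mass_normalized)
  have "M = density (mass_normalized M) (\<lambda>_. ennreal (measure M UNIV))"
  proof (rule measure_eqI)
    fix A assume "A \<in> sets M"
    then have [measurable]: "A \<in> sets borel" by (simp add: M_is_borel)
    show "emeasure M A = emeasure (density (mass_normalized M) (\<lambda>_. ennreal (measure M UNIV))) A"
      using nn_integral_mass_normalized[of "indicator A"] M_is_borel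
      by (simp add: emeasure_density nn_integral_cmult)
  qed (simp add: M_is_borel)
  then have "(\<integral>x. f x \<partial>M) = (\<integral>x. f x \<partial>density (mass_normalized M) (\<lambda>_. ennreal (measure M UNIV)))"
    by simp
  also have "\<dots> = measure M UNIV *\<^sub>R (\<integral>x. f x \<partial>mass_normalized M)"
    by (subst integral_density) auto
  finally show ?thesis .
qed

definition cpois :: "real measure \<Rightarrow> real measure" where
  "cpois \<rho> = (if measure \<rho> UNIV = 0 then return borel 0 else
     poisson_mixture (measure \<rho> UNIV) (mass_normalized \<rho>))"

context finite_borel_measure
begin

lemma real_distribution_cpois: "real_distribution (cpois M)"
  by (simp add: cpois_def real_distribution_return real_distribution_poisson_mixture
      real_distribution_mass_normalized)

lemma char_cpois: "char (cpois M) t = exp (CLINT y|M. iexp (t * y) - 1)"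
proof -
  interpret N: real_distribution "mass_normalized M" by (rule real_distribution_mass_normalized)
  have "(CLINT y|M. iexp (t * y) - 1) = measure M UNIV *\<^sub>R (CLINT y|mass_normalized M. iexp (t * y) - 1)"
    by (rule integral_mass_normalized) measurable
  also have "(CLINT y|mass_normalized M. iexp (t * y) - 1) = char (mass_normalized M) t - 1"
    unfolding char_def using N.prob_space
    by (subst Bochner_Integration.integral_diff) (auto intro!: N.integrable_const_bound[where B = 1])
  finally have e: "(CLINT y|M. iexp (t * y) - 1) = of_real (measure M UNIV) * (char (mass_normalized M) t - 1)"
    by (simp add: scaleR_conv_of_real)
  show ?thesis
  proof (cases "measure M UNIV = 0")
    case True
    then show ?thesis unfolding e by (simp add: cpois_def char_return)
  next
    case False
    then have "0 < measure M UNIV" by (simp add: zero_less_measure_iff)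
    then show ?thesis unfolding e
      by (simp add: cpois_def char_poisson_mixture[OF real_distribution_mass_normalized])
  qed
qed

lemma compound_poisson_eq_cpois: "compound_poisson M m \<Longrightarrow> m = cpois M"
  unfolding compound_poisson_def
  by (intro Levy_uniqueness) (auto simp: real_distribution_cpois char_cpois)

end

lemma nn_integral_conv_pow_Suc:
  assumes F: "real_distribution F" and f: "f \<in> borel_measurable borel"
  shows "(\<integral>\<^sup>+x. f x \<partial>conv_pow F (Suc n)) = (\<integral>\<^sup>+y. \<integral>\<^sup>+z. f (y + z) \<partial>conv_pow F n \<partial>F)"
proof -
  interpret F: real_distribution F by fact
  interpret P: real_distribution "conv_pow F n" by (rule real_distribution_conv_pow[OF F])
  show ?thesis
    by (simp add: nn_integral_convolution[OF F.finite_measure_axioms P.finite_measure_axioms _ _ f])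
qed

lemma AE_conv_pow_nonneg:
  assumes F: "real_distribution F" and nonneg: "AE y in F. 0 \<le> y"
  shows "AE y in conv_pow F n. 0 \<le> y"
proof (induction n)
  case 0
  show ?case by (subst conv_pow.simps, subst AE_return) auto
next
  case (Suc n)
  interpret F: real_distribution F by fact
  interpret P: real_distribution "conv_pow F n" by (rule real_distribution_conv_pow[OF F])
  interpret Q: real_distribution "conv_pow F (Suc n)" by (rule real_distribution_conv_pow[OF F])
  have "(\<integral>\<^sup>+x. indicator {..<0} x \<partial>conv_pow F (Suc n)) =
      (\<integral>\<^sup>+y. \<integral>\<^sup>+z. indicator {..<0} (y + z) \<partial>conv_pow F n \<partial>F)"
    by (rule nn_integral_conv_pow_Suc[OF F]) simp
  also have "\<dots> = (\<integral>\<^sup>+y. 0 \<partial>F)"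
  proof (rule nn_integral_cong_AE)
    show "AE y in F. (\<integral>\<^sup>+z. indicator {..<0} (y + z) \<partial>conv_pow F n) = 0"
      using nonneg
    proof eventually_elim
      case (elim y)
      have "(\<integral>\<^sup>+z. indicator {..<0} (y + z) \<partial>conv_pow F n) = (\<integral>\<^sup>+z. 0 \<partial>conv_pow F n)"
        by (rule nn_integral_cong_AE) (use Suc elim in \<open>auto elim!: eventually_mono simp: indicator_def\<close>)
      then show ?case by simp
    qed
  qed
  finally have "emeasure (conv_pow F (Suc n)) {..<0} = 0"
    by (subst (asm) nn_integral_indicator) (auto simp del: conv_pow.simps)
  then have "AE y in conv_pow F (Suc n). y \<notin> {..<0}"
    by (intro AE_not_in null_setsI) (auto simp del: conv_pow.simps)
  then show ?case by (auto simp del: conv_pow.simps)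
qed

text \<open>By exchangeability each of the \<open>n + 1\<close> summands contributes equally to the sum that is
  the weight on the left.\<close>

lemma conv_pow_size_bias:
  assumes F: "real_distribution F" and nonneg: "AE y in F. 0 \<le> y" and f: "f \<in> borel_measurable borel"
  shows "(\<integral>\<^sup>+u. ennreal u * f u \<partial>conv_pow F (Suc n)) =
    of_nat (Suc n) * (\<integral>\<^sup>+y. \<integral>\<^sup>+z. ennreal y * f (y + z) \<partial>conv_pow F n \<partial>F)"
  using f
proof (induction n arbitrary: f)
  case 0
  note [measurable] = 0
  interpret F: real_distribution F by fact
  have "(\<integral>\<^sup>+u. ennreal u * f u \<partial>conv_pow F (Suc 0)) =
      (\<integral>\<^sup>+y. \<integral>\<^sup>+z. ennreal (y + z) * f (y + z) \<partial>conv_pow F 0 \<partial>F)"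
    by (rule nn_integral_conv_pow_Suc[OF F]) measurable
  also have "\<dots> = (\<integral>\<^sup>+y. \<integral>\<^sup>+z. ennreal y * f (y + z) \<partial>conv_pow F 0 \<partial>F)"
    by (simp add: nn_integral_return)
  finally show ?case by simp
next
  case (Suc n)
  note [measurable] = Suc.prems
  interpret F: real_distribution F by fact
  interpret P: real_distribution "conv_pow F n" by (rule real_distribution_conv_pow[OF F])
  interpret Q: real_distribution "conv_pow F (Suc n)" by (rule real_distribution_conv_pow[OF F])
  interpret FF: pair_sigma_finite F F by unfold_locales
  note [measurable_cong] = F.events_eq_borel P.events_eq_borel Q.events_eq_borel
  note [simp del] = conv_pow.simps
  let ?Q = "conv_pow F (Suc n)"
  have "(\<integral>\<^sup>+u. ennreal u * f u \<partial>conv_pow F (Suc (Suc n))) =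
      (\<integral>\<^sup>+y. \<integral>\<^sup>+z. ennreal (y + z) * f (y + z) \<partial>?Q \<partial>F)"
    by (rule nn_integral_conv_pow_Suc[OF F]) measurable
  also have "\<dots> = (\<integral>\<^sup>+y. (\<integral>\<^sup>+z. ennreal y * f (y + z) \<partial>?Q) + (\<integral>\<^sup>+z. ennreal z * f (y + z) \<partial>?Q) \<partial>F)"
  proof (rule nn_integral_cong_AE)
    show "AE y in F. (\<integral>\<^sup>+z. ennreal (y + z) * f (y + z) \<partial>?Q) =
        (\<integral>\<^sup>+z. ennreal y * f (y + z) \<partial>?Q) + (\<integral>\<^sup>+z. ennreal z * f (y + z) \<partial>?Q)"
      using nonneg
    proof eventually_elim
      case (elim y)
      have "(\<integral>\<^sup>+z. ennreal (y + z) * f (y + z) \<partial>?Q) =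
          (\<integral>\<^sup>+z. ennreal y * f (y + z) + ennreal z * f (y + z) \<partial>?Q)"
        using AE_conv_pow_nonneg[OF F nonneg, of "Suc n"] elim
        by (intro nn_integral_cong_AE) (auto elim!: eventually_mono simp: ennreal_plus distrib_right)
      also have "\<dots> = (\<integral>\<^sup>+z. ennreal y * f (y + z) \<partial>?Q) + (\<integral>\<^sup>+z. ennreal z * f (y + z) \<partial>?Q)"
        by (rule nn_integral_add) measurable
      finally show ?case .
    qed
  qed
  also have "\<dots> = (\<integral>\<^sup>+y. \<integral>\<^sup>+z. ennreal y * f (y + z) \<partial>?Q \<partial>F) + (\<integral>\<^sup>+y. \<integral>\<^sup>+z. ennreal z * f (y + z) \<partial>?Q \<partial>F)"
    by (rule nn_integral_add) measurable
  also have "(\<integral>\<^sup>+y. \<integral>\<^sup>+z. ennreal z * f (y + z) \<partial>?Q \<partial>F) =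
      (\<integral>\<^sup>+y. of_nat (Suc n) * (\<integral>\<^sup>+y'. \<integral>\<^sup>+z. ennreal y' * f (y + (y' + z)) \<partial>conv_pow F n \<partial>F) \<partial>F)"
    by (intro nn_integral_cong Suc.IH) measurable
  also have "\<dots> = of_nat (Suc n) * (\<integral>\<^sup>+y. \<integral>\<^sup>+y'. \<integral>\<^sup>+z. ennreal y' * f (y + (y' + z)) \<partial>conv_pow F n \<partial>F \<partial>F)"
    by (rule nn_integral_cmult) measurable
  also have "(\<integral>\<^sup>+y. \<integral>\<^sup>+y'. \<integral>\<^sup>+z. ennreal y' * f (y + (y' + z)) \<partial>conv_pow F n \<partial>F \<partial>F) =
      (\<integral>\<^sup>+y'. \<integral>\<^sup>+y. \<integral>\<^sup>+z. ennreal y' * f (y + (y' + z)) \<partial>conv_pow F n \<partial>F \<partial>F)"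
    by (rule FF.Fubini') measurable
  also have "\<dots> = (\<integral>\<^sup>+y'. \<integral>\<^sup>+y. \<integral>\<^sup>+z. ennreal y' * f (y' + (y + z)) \<partial>conv_pow F n \<partial>F \<partial>F)"
    by (simp add: add.left_commute)
  also have "\<dots> = (\<integral>\<^sup>+y'. \<integral>\<^sup>+z. ennreal y' * f (y' + z) \<partial>?Q \<partial>F)"
    by (intro nn_integral_cong nn_integral_conv_pow_Suc[OF F, symmetric]) measurable
  finally show ?case by (simp add: distrib_right)
qed

lemma AE_poisson_mixture_nonneg:
  assumes F: "real_distribution F" and l: "0 < l" and nonneg: "AE y in F. 0 \<le> y"
  shows "AE y in poisson_mixture l F. 0 \<le> y"
proof -
  interpret W: real_distribution "poisson_mixture l F" by (rule real_distribution_poisson_mixture[OF F])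
  have "(\<integral>\<^sup>+x. indicator {..<0} x \<partial>conv_pow F n) = 0" for n
  proof -
    have "(\<integral>\<^sup>+x. indicator {..<0} x \<partial>conv_pow F n) = (\<integral>\<^sup>+x. 0 \<partial>conv_pow F n)"
      using AE_conv_pow_nonneg[OF F nonneg, of n]
      by (intro nn_integral_cong_AE) (auto elim!: eventually_mono simp: indicator_def)
    then show ?thesis by simp
  qed
  then have "(\<integral>\<^sup>+x. indicator {..<0} x \<partial>poisson_mixture l F) = 0"
    by (subst nn_integral_poisson_mixture[OF F l]) auto
  then have "emeasure (poisson_mixture l F) {..<0} = 0"
    by (subst (asm) nn_integral_indicator) auto
  then have "AE y in poisson_mixture l F. y \<notin> {..<0}"
    by (intro AE_not_in null_setsI) auto
  then show ?thesis by auto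
qed

lemma poisson_mixture_size_bias:
  assumes F: "real_distribution F" and l: "0 < l" and nonneg: "AE y in F. 0 \<le> y"
    and f: "f \<in> borel_measurable borel"
  shows "(\<integral>\<^sup>+u. ennreal u * f u \<partial>poisson_mixture l F) =
    ennreal l * (\<integral>\<^sup>+y. \<integral>\<^sup>+z. ennreal y * f (y + z) \<partial>poisson_mixture l F \<partial>F)"
proof -
  note [measurable] = f
  interpret F: real_distribution F by fact
  let ?P = "conv_pow F"
  have P: "real_distribution (?P n)" for n by (rule real_distribution_conv_pow[OF F])
  define w where "w n = ennreal (l ^ n / fact n * exp (- l))" for n
  have w: "w (Suc n) * of_nat (Suc n) = ennreal l * w n" for n
  proof -
    have "l ^ Suc n / fact (Suc n) * exp (- l) * real (Suc n) = l * (l ^ n / fact n * exp (- l))"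
      by (simp add: fact_Suc del: of_nat_Suc)
    moreover have "w (Suc n) * of_nat (Suc n) = ennreal (l ^ Suc n / fact (Suc n) * exp (- l) * real (Suc n))"
      using l unfolding w_def ennreal_of_nat_eq_real_of_nat by (intro ennreal_mult[symmetric]) auto
    moreover have "ennreal (l * (l ^ n / fact n * exp (- l))) = ennreal l * w n"
      using l unfolding w_def by (intro ennreal_mult) auto
    ultimately show ?thesis by (simp only:)
  qed
  have meas: "(\<lambda>y. \<integral>\<^sup>+z. ennreal y * f (y + z) \<partial>?P n) \<in> borel_measurable F" for n
  proof -
    interpret P: real_distribution "?P n" by (rule P)
    note [measurable_cong] = P.events_eq_borel
    show ?thesis by measurable
  qed
  have "(\<integral>\<^sup>+u. ennreal u * f u \<partial>poisson_mixture l F) = (\<Sum>n. w n * (\<integral>\<^sup>+u. ennreal u * f u \<partial>?P n))"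
    unfolding w_def by (rule nn_integral_poisson_mixture[OF F l]) measurable
  also have "\<dots> = (\<Sum>n. w (n + 1) * (\<integral>\<^sup>+u. ennreal u * f u \<partial>?P (n + 1))) +
      (\<Sum>n<1. w n * (\<integral>\<^sup>+u. ennreal u * f u \<partial>?P n))"
    by (rule suminf_offset) simp
  also have "(\<Sum>n<1. w n * (\<integral>\<^sup>+u. ennreal u * f u \<partial>?P n)) = 0"
    by (simp add: nn_integral_return)
  also have "(\<Sum>n. w (n + 1) * (\<integral>\<^sup>+u. ennreal u * f u \<partial>?P (n + 1))) =
      (\<Sum>n. ennreal l * (w n * (\<integral>\<^sup>+y. \<integral>\<^sup>+z. ennreal y * f (y + z) \<partial>?P n \<partial>F)))"
    unfolding Suc_eq_plus1[symmetric] conv_pow_size_bias[OF F nonneg f] mult.assoc[symmetric] w ..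
  also have "\<dots> = ennreal l * (\<Sum>n. w n * (\<integral>\<^sup>+y. \<integral>\<^sup>+z. ennreal y * f (y + z) \<partial>?P n \<partial>F))"
    by (rule ennreal_suminf_cmult)
  also have "(\<Sum>n. w n * (\<integral>\<^sup>+y. \<integral>\<^sup>+z. ennreal y * f (y + z) \<partial>?P n \<partial>F)) =
      (\<Sum>n. \<integral>\<^sup>+y. w n * (\<integral>\<^sup>+z. ennreal y * f (y + z) \<partial>?P n) \<partial>F)"
    by (simp add: nn_integral_cmult[OF meas])
  also have "\<dots> = (\<integral>\<^sup>+y. (\<Sum>n. w n * (\<integral>\<^sup>+z. ennreal y * f (y + z) \<partial>?P n)) \<partial>F)"
    using meas by (intro nn_integral_suminf[symmetric]) auto
  also have "\<dots> = (\<integral>\<^sup>+y. \<integral>\<^sup>+z. ennreal y * f (y + z) \<partial>poisson_mixture l F \<partial>F)"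
    unfolding w_def by (intro nn_integral_cong nn_integral_poisson_mixture[OF F l, symmetric]) measurable
  finally show ?thesis by simp
qed

text \<open>The event of exactly one jump.\<close>

lemma poisson_mixture_ge:
  assumes F: "real_distribution F" and l: "0 < l" and [measurable]: "f \<in> borel_measurable borel"
  shows "ennreal (l * exp (- l)) * (\<integral>\<^sup>+x. f x \<partial>F) \<le> (\<integral>\<^sup>+x. f x \<partial>poisson_mixture l F)"
proof -
  have "(\<integral>\<^sup>+x. f x \<partial>conv_pow F 1) = (\<integral>\<^sup>+y. \<integral>\<^sup>+z. f (y + z) \<partial>return borel 0 \<partial>F)"
    using nn_integral_conv_pow_Suc[OF F, of f 0] by simp
  also have "\<dots> = (\<integral>\<^sup>+x. f x \<partial>F)" by (simp add: nn_integral_return)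
  finally have "ennreal (l * exp (- l)) * (\<integral>\<^sup>+x. f x \<partial>F) =
      (\<Sum>n\<in>{1}. ennreal (l ^ n / fact n * exp (- l)) * (\<integral>\<^sup>+x. f x \<partial>conv_pow F n))"
    by simp
  also have "\<dots> \<le> (\<Sum>n. ennreal (l ^ n / fact n * exp (- l)) * (\<integral>\<^sup>+x. f x \<partial>conv_pow F n))"
    by (rule sum_le_suminf) auto
  also have "\<dots> = (\<integral>\<^sup>+x. f x \<partial>poisson_mixture l F)"
    by (rule nn_integral_poisson_mixture[OF F l, symmetric]) measurable
  finally show ?thesis .
qed

lemma poisson_mixture_atom:
  assumes F: "real_distribution F" and l: "0 < l"
  shows "exp (- l) \<le> measure (poisson_mixture l F) {0}"
proof -
  interpret W: real_distribution "poisson_mixture l F" by (rule real_distribution_poisson_mixture[OF F])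
  have "ennreal (exp (- l)) =
      (\<Sum>n\<in>{0}. ennreal (l ^ n / fact n * exp (- l)) * (\<integral>\<^sup>+x. indicator {0} x \<partial>conv_pow F n))"
    by simp
  also have "\<dots> \<le> (\<Sum>n. ennreal (l ^ n / fact n * exp (- l)) * (\<integral>\<^sup>+x. indicator {0} x \<partial>conv_pow F n))"
    by (rule sum_le_suminf) auto
  also have "\<dots> = (\<integral>\<^sup>+x. indicator {0} x \<partial>poisson_mixture l F)"
    by (rule nn_integral_poisson_mixture[OF F l, symmetric]) measurable
  also have "\<dots> = emeasure (poisson_mixture l F) {0}" by (rule nn_integral_indicator) simp
  finally show ?thesis by (simp add: W.emeasure_eq_measure)
qed

text \<open>Exponential moments multiply over independent summands, whence the moment of the mixture.\<close>

lemma nn_integral_exp_conv_pow: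
  assumes F: "real_distribution F"
  shows "(\<integral>\<^sup>+x. ennreal (exp (s * x)) \<partial>conv_pow F n) = (\<integral>\<^sup>+x. ennreal (exp (s * x)) \<partial>F) ^ n"
proof (induction n)
  case 0
  show ?case by (simp add: nn_integral_return)
next
  case (Suc n)
  interpret F: real_distribution F by fact
  interpret P: real_distribution "conv_pow F n" by (rule real_distribution_conv_pow[OF F])
  have "(\<integral>\<^sup>+x. ennreal (exp (s * x)) \<partial>conv_pow F (Suc n)) =
      (\<integral>\<^sup>+y. \<integral>\<^sup>+z. ennreal (exp (s * (y + z))) \<partial>conv_pow F n \<partial>F)"
    by (rule nn_integral_conv_pow_Suc[OF F]) measurable
  also have "\<dots> = (\<integral>\<^sup>+y. \<integral>\<^sup>+z. ennreal (exp (s * y)) * ennreal (exp (s * z)) \<partial>conv_pow F n \<partial>F)"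
    by (simp add: distrib_left exp_add ennreal_mult)
  also have "\<dots> = (\<integral>\<^sup>+y. ennreal (exp (s * y)) * (\<integral>\<^sup>+z. ennreal (exp (s * z)) \<partial>conv_pow F n) \<partial>F)"
    by (intro nn_integral_cong nn_integral_cmult) simp
  also have "\<dots> = (\<integral>\<^sup>+y. ennreal (exp (s * y)) \<partial>F) * (\<integral>\<^sup>+z. ennreal (exp (s * z)) \<partial>conv_pow F n)"
    by (rule nn_integral_multc) simp
  finally show ?case using Suc by simp
qed

lemma nn_integral_exp_poisson_mixture:
  assumes F: "real_distribution F" and l: "0 < l" and int: "integrable F (\<lambda>x. exp (s * x))"
  shows "(\<integral>\<^sup>+x. ennreal (exp (s * x)) \<partial>poisson_mixture l F) =
    ennreal (exp (l * ((\<integral>x. exp (s * x) \<partial>F) - 1)))"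
proof -
  let ?e = "\<integral>x. exp (s * x) \<partial>F"
  have e: "0 \<le> ?e" by (rule Bochner_Integration.integral_nonneg) auto
  have "(\<integral>\<^sup>+x. ennreal (exp (s * x)) \<partial>F) = ennreal ?e"
    by (rule nn_integral_eq_integral[OF int]) auto
  then have "(\<integral>\<^sup>+x. ennreal (exp (s * x)) \<partial>poisson_mixture l F) =
      (\<Sum>n. ennreal (l ^ n / fact n * exp (- l)) * ennreal ?e ^ n)"
    by (subst nn_integral_poisson_mixture[OF F l]) (auto simp: nn_integral_exp_conv_pow[OF F])
  also have "(\<lambda>n. ennreal (l ^ n / fact n * exp (- l)) * ennreal ?e ^ n) =
      (\<lambda>n. ennreal (exp (- l) * (inverse (fact n) * (l * ?e) ^ n)))"
  proof
    fix n
    have "ennreal (l ^ n / fact n * exp (- l)) * ennreal ?e ^ n = ennreal (l ^ n / fact n * exp (- l) * ?e ^ n)"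
      using e l by (subst ennreal_mult) (auto simp: ennreal_power)
    also have "l ^ n / fact n * exp (- l) * ?e ^ n = exp (- l) * (inverse (fact n) * (l * ?e) ^ n)"
      by (simp add: power_mult_distrib divide_inverse)
    finally show "ennreal (l ^ n / fact n * exp (- l)) * ennreal ?e ^ n =
        ennreal (exp (- l) * (inverse (fact n) * (l * ?e) ^ n))" .
  qed
  also have "(\<Sum>n. ennreal (exp (- l) * (inverse (fact n) * (l * ?e) ^ n))) =
      ennreal (\<Sum>n. exp (- l) * (inverse (fact n) * (l * ?e) ^ n))"
    using e l by (intro suminf_ennreal2 summable_mult summable_exp) auto
  also have "(\<Sum>n. exp (- l) * (inverse (fact n) * (l * ?e) ^ n)) = exp (- l) * exp (l * ?e)"
    by (subst suminf_mult[OF summable_exp]) (simp add: exp_def divide_inverse)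
  also have "\<dots> = exp (l * (?e - 1))" by (simp add: algebra_simps flip: exp_add)
  finally show ?thesis .
qed

context finite_borel_measure
begin

lemma AE_mass_normalized_iff:
  assumes "0 < measure M UNIV" and [measurable]: "Measurable.pred borel P"
  shows "(AE y in mass_normalized M. P y) \<longleftrightarrow> (AE y in M. P y)"
proof -
  interpret N: real_distribution "mass_normalized M" by (rule real_distribution_mass_normalized)
  have "(\<integral>\<^sup>+y. indicator {y. \<not> P y} y \<partial>M) =
      ennreal (measure M UNIV) * (\<integral>\<^sup>+y. indicator {y. \<not> P y} y \<partial>mass_normalized M)"
    by (rule nn_integral_mass_normalized) measurable
  then have "emeasure M {y. \<not> P y} = ennreal (measure M UNIV) * emeasure (mass_normalized M) {y. \<not> P y}"
    by (subst (asm) (1 2) nn_integral_indicator) (auto simp: M_is_borel)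
  then have "emeasure M {y. \<not> P y} = 0 \<longleftrightarrow> emeasure (mass_normalized M) {y. \<not> P y} = 0"
    using assms(1) by auto
  moreover have "(AE y in M. P y) \<longleftrightarrow> emeasure M {y. \<not> P y} = 0"
    using AE_iff_measurable[of "{y. \<not> P y}" M P] by (simp add: M_is_borel borel_UNIV)
  moreover have "(AE y in mass_normalized M. P y) \<longleftrightarrow> emeasure (mass_normalized M) {y. \<not> P y} = 0"
    using AE_iff_measurable[of "{y. \<not> P y}" "mass_normalized M" P] by simp
  ultimately show ?thesis by simp
qed

lemma AE_cpois_nonneg:
  assumes "AE y in M. 0 \<le> y"
  shows "AE y in cpois M. 0 \<le> y"
proof (cases "measure M UNIV = 0")
  case False
  then have "0 < measure M UNIV" by (simp add: zero_less_measure_iff)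
  moreover from this have "AE y in mass_normalized M. 0 \<le> y"
    using assms by (subst AE_mass_normalized_iff) auto
  ultimately have "AE y in poisson_mixture (measure M UNIV) (mass_normalized M). 0 \<le> y"
    by (rule AE_poisson_mixture_nonneg[OF real_distribution_mass_normalized])
  moreover have "cpois M = poisson_mixture (measure M UNIV) (mass_normalized M)"
    using False by (simp add: cpois_def)
  ultimately show ?thesis by (simp only:)
next
  case True
  have "AE y in return borel 0. (0::real) \<le> y" by (subst AE_return) auto
  moreover have "cpois M = return borel 0" using True by (simp add: cpois_def)
  ultimately show ?thesis by (simp only:)
qed

lemma cpois_size_bias:
  assumes "AE y in M. 0 \<le> y" "0 < measure M UNIV" and [measurable]: "f \<in> borel_measurable borel"
  shows "(\<integral>\<^sup>+u. ennreal u * f u \<partial>cpois M) = (\<integral>\<^sup>+y. \<integral>\<^sup>+z. ennreal y * f (y + z) \<partial>cpois M \<partial>M)"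
proof -
  interpret N: real_distribution "mass_normalized M" by (rule real_distribution_mass_normalized)
  interpret W: real_distribution "cpois M" by (rule real_distribution_cpois)
  have "AE y in mass_normalized M. 0 \<le> y"
    using assms by (subst AE_mass_normalized_iff) auto
  from poisson_mixture_size_bias[OF real_distribution_mass_normalized assms(2) this assms(3)]
  have "(\<integral>\<^sup>+u. ennreal u * f u \<partial>cpois M) =
      ennreal (measure M UNIV) * (\<integral>\<^sup>+y. \<integral>\<^sup>+z. ennreal y * f (y + z) \<partial>cpois M \<partial>mass_normalized M)"
    using assms(2) by (simp add: cpois_def)
  also have "\<dots> = (\<integral>\<^sup>+y. \<integral>\<^sup>+z. ennreal y * f (y + z) \<partial>cpois M \<partial>M)"
    by (rule nn_integral_mass_normalized[symmetric]) measurable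
  finally show ?thesis .
qed

lemma cpois_ge:
  assumes "0 < measure M UNIV" and [measurable]: "f \<in> borel_measurable borel"
  shows "ennreal (exp (- measure M UNIV)) * (\<integral>\<^sup>+x. f x \<partial>M) \<le> (\<integral>\<^sup>+x. f x \<partial>cpois M)"
proof -
  have "ennreal (exp (- measure M UNIV)) * (\<integral>\<^sup>+x. f x \<partial>M) =
      ennreal (measure M UNIV * exp (- measure M UNIV)) * (\<integral>\<^sup>+x. f x \<partial>mass_normalized M)"
    unfolding nn_integral_mass_normalized[OF assms(2)] by (simp add: ennreal_mult mult_ac)
  also have "\<dots> \<le> (\<integral>\<^sup>+x. f x \<partial>poisson_mixture (measure M UNIV) (mass_normalized M))"
    by (rule poisson_mixture_ge[OF real_distribution_mass_normalized assms])
  also have "poisson_mixture (measure M UNIV) (mass_normalized M) = cpois M"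
    using assms(1) by (simp add: cpois_def)
  finally show ?thesis .
qed

lemma nn_integral_exp_cpois:
  assumes int: "integrable M (\<lambda>x. exp (s * x))"
  shows "(\<integral>\<^sup>+x. ennreal (exp (s * x)) \<partial>cpois M) = ennreal (exp (\<integral>x. exp (s * x) - 1 \<partial>M))"
proof (cases "measure M UNIV = 0")
  case True
  then have "(\<integral>x. exp (s * x) - 1 \<partial>M) = 0" by (subst integral_mass_normalized) auto
  then show ?thesis using True by (simp add: cpois_def nn_integral_return)
next
  case False
  then have pos: "0 < measure M UNIV" by (simp add: zero_less_measure_iff)
  interpret N: real_distribution "mass_normalized M" by (rule real_distribution_mass_normalized)
  have int': "integrable (mass_normalized M) (\<lambda>x. exp (s * x))"
  proof (rule integrableI_bounded)
    have "(\<integral>\<^sup>+x. ennreal (exp (s * x)) \<partial>M) < \<infinity>" using int by (simp add: integrable_iff_bounded)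
    moreover have "(\<integral>\<^sup>+x. ennreal (exp (s * x)) \<partial>M) =
        ennreal (measure M UNIV) * (\<integral>\<^sup>+x. ennreal (exp (s * x)) \<partial>mass_normalized M)"
      by (rule nn_integral_mass_normalized) measurable
    ultimately have "(\<integral>\<^sup>+x. ennreal (exp (s * x)) \<partial>mass_normalized M) < \<infinity>"
      using pos by (auto simp: ennreal_mult_less_top)
    then show "(\<integral>\<^sup>+x. ennreal (norm (exp (s * x))) \<partial>mass_normalized M) < \<infinity>" by simp
  qed simp
  have "(\<integral>x. exp (s * x) - 1 \<partial>M) = measure M UNIV * (\<integral>x. exp (s * x) - 1 \<partial>mass_normalized M)"
    by (subst integral_mass_normalized) auto
  also have "(\<integral>x. exp (s * x) - 1 \<partial>mass_normalized M) = (\<integral>x. exp (s * x) \<partial>mass_normalized M) - 1"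
    using int' N.prob_space by simp
  finally have e: "(\<integral>x. exp (s * x) - 1 \<partial>M) =
      measure M UNIV * ((\<integral>x. exp (s * x) \<partial>mass_normalized M) - 1)" .
  have "cpois M = poisson_mixture (measure M UNIV) (mass_normalized M)"
    using False by (simp add: cpois_def)
  then show ?thesis
    unfolding e by (simp only: nn_integral_exp_poisson_mixture[OF real_distribution_mass_normalized pos int'])
qed

end

section \<open>Compound Poisson distributions on the half-line\<close>

text \<open>The compound Poisson distribution \<open>m\<close> of a non-null finite Levy measure \<open>R\<close> on the half-line. The
  constant \<open>k\<close> below is such that the event of exactly one jump contributes \<open>k R\<close> to \<open>m\<close>.\<close>

locale positive_levy = finite_borel_measure R for R :: "real measure" +
  fixes c :: real
  assumes c_pos: "0 < c" and mass_pos: "0 < measure R UNIV" and nonneg: "AE y in R. 0 \<le> y"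
begin

abbreviation "m \<equiv> cpois R"
abbreviation "r \<equiv> local_mass c R"
abbreviation "lm \<equiv> local_mass c m"

definition k where "k = exp (- measure R UNIV)"

lemma k: "0 < k" "k \<le> 1" by (simp_all add: k_def)

sublocale m: real_distribution m by (rule real_distribution_cpois)

lemma m_fin: "finite_borel_measure m" by (rule m.finite_borel_measure_M)
lemma R_fin: "finite_borel_measure R" by (rule finite_borel_measure_axioms)

lemma m_nonneg: "measure m {..<0} = 0"
proof -
  have "AE y in m. y \<notin> {..<0}" using AE_cpois_nonneg[OF nonneg] by (rule AE_mp) auto
  then show ?thesis
    using AE_iff_null_sets[of "{..<0}" m] by (simp add: null_setsD1 measure_def)
qed

lemma r_le: "k * r x \<le> lm x"
proof -
  have "ennreal k * emeasure R {x<..x+c} \<le> emeasure m {x<..x+c}"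
    using cpois_ge[OF mass_pos, of "indicator {x<..x+c}"]
    by (simp add: k_def M_is_borel)
  then show ?thesis
    using k by (simp add: local_mass_def emeasure_eq_measure m.emeasure_eq_measure flip: ennreal_mult)
qed

lemma emeasure_sum_mass:
  assumes "finite_borel_measure F" "finite_borel_measure G"
  shows "emeasure (F \<Otimes>\<^sub>M G) {w. x < fst w + snd w \<and> fst w + snd w \<le> x + c \<and> P (fst w) (snd w)} =
    ennreal (sum_mass c F G P x)"
proof -
  interpret finite_measure "F \<Otimes>\<^sub>M G" by (rule finite_borel_pair[OF assms])
  show ?thesis by (simp add: sum_mass_def emeasure_eq_measure)
qed

lemma size_bias_local:
  "(\<integral>\<^sup>+u. ennreal u * indicator {x<..x+c} u \<partial>m) =
   (\<integral>\<^sup>+w. ennreal (fst w) * indicator {x<..x+c} (fst w + snd w) \<partial>(R \<Otimes>\<^sub>M m))"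
proof -
  note [measurable_cong] = M_is_borel m.events_eq_borel
  show ?thesis
    by (subst cpois_size_bias[OF nonneg mass_pos], measurable)
      (subst m.nn_integral_fst[symmetric], auto)
qed

text \<open>The size-bias identity \<open>u m(du) = \<integral> y R(dy) m(du - y)\<close> turns questions on infinitely many convolution
  powers into the analysis of a single convolution. In it the weight \<open>y\<close> of a pair with sum in \<open>x + \<Delta>\<close> is
  at most \<open>x + c\<close>, and at most \<open>B\<close> if \<open>y\<close> is the bounded summand, which makes the second term below
  small after division by \<open>x\<close>.\<close>

lemma lm_upper:
  assumes B: "0 \<le> B" and x: "0 \<le> x"
  shows "x * lm x \<le> (x + c) * sum_mass c R m (\<lambda>_ z. z \<in> {0..B}) x
    + B * sum_mass c R m (\<lambda>y _. y \<in> {0..B}) x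
    + (x + c) * sum_mass c R m (\<lambda>y z. B < y \<and> B < z) x"
proof -
  note [measurable_cong] = M_is_borel m.events_eq_borel
  let ?S = "\<lambda>P. {w. x < fst w + snd w \<and> fst w + snd w \<le> x + c \<and> P (fst w) (snd w)}"
  let ?P1 = "\<lambda>_ z. z \<in> {0..B}" and ?P2 = "\<lambda>y _. y \<in> {0..B}" and ?P3 = "\<lambda>y z. B < y \<and> B < z"
  interpret P: pair_sigma_finite R m by (rule finite_borel_pair[OF R_fin m_fin])
  have S: "?S ?P1 \<in> sets (R \<Otimes>\<^sub>M m)" "?S ?P2 \<in> sets (R \<Otimes>\<^sub>M m)" "?S ?P3 \<in> sets (R \<Otimes>\<^sub>M m)"
    using sum_set_measurable[OF R_fin m_fin, of ?P1 x c] sum_set_measurable[OF R_fin m_fin, of ?P2 x c]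
      sum_set_measurable[OF R_fin m_fin, of ?P3 x c] by simp_all
  have ae: "AE w in R \<Otimes>\<^sub>M m. 0 \<le> fst w \<and> 0 \<le> snd w"
  proof (rule P.AE_pair_measure)
    show "{w \<in> space (R \<Otimes>\<^sub>M m). 0 \<le> fst w \<and> 0 \<le> snd w} \<in> sets (R \<Otimes>\<^sub>M m)" by measurable
    show "AE y in R. AE z in m. 0 \<le> fst (y, z) \<and> 0 \<le> snd (y, z)"
      using nonneg AE_cpois_nonneg[OF nonneg] by auto
  qed
  have "ennreal (x * lm x) = (\<integral>\<^sup>+u. ennreal x * indicator {x<..x+c} u \<partial>m)"
    using x by (simp add: local_mass_def ennreal_mult m.emeasure_eq_measure nn_integral_cmult_indicator)
  also have "\<dots> \<le> (\<integral>\<^sup>+u. ennreal u * indicator {x<..x+c} u \<partial>m)"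
    by (intro nn_integral_mono) (auto simp: indicator_def intro: ennreal_leI)
  also have "\<dots> = (\<integral>\<^sup>+w. ennreal (fst w) * indicator {x<..x+c} (fst w + snd w) \<partial>(R \<Otimes>\<^sub>M m))"
    by (rule size_bias_local)
  also have "\<dots> \<le> (\<integral>\<^sup>+w. ennreal (x + c) * indicator (?S ?P1) w + ennreal B * indicator (?S ?P2) w
      + ennreal (x + c) * indicator (?S ?P3) w \<partial>(R \<Otimes>\<^sub>M m))"
  proof (rule nn_integral_mono_AE)
    show "AE w in R \<Otimes>\<^sub>M m. ennreal (fst w) * indicator {x<..x+c} (fst w + snd w) \<le>
        ennreal (x + c) * indicator (?S ?P1) w + ennreal B * indicator (?S ?P2) w
        + ennreal (x + c) * indicator (?S ?P3) w"
      using ae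
    proof eventually_elim
      case (elim w)
      show ?case
      proof (cases "x < fst w + snd w \<and> fst w + snd w \<le> x + c")
        case True
        consider "snd w \<le> B" | "fst w \<le> B" | "B < fst w \<and> B < snd w" by linarith
        then show ?thesis
        proof cases
          case 1
          have "ennreal (fst w) * indicator {x<..x+c} (fst w + snd w) \<le> ennreal (x + c) * indicator (?S ?P1) w"
            using True elim 1 by (auto simp: indicator_def intro!: ennreal_leI)
          then show ?thesis by (simp add: add_increasing2)
        next
          case 2
          have "ennreal (fst w) * indicator {x<..x+c} (fst w + snd w) \<le> ennreal B * indicator (?S ?P2) w"
            using True elim 2 by (auto simp: indicator_def intro!: ennreal_leI)
          then show ?thesis by (simp add: add_increasing2 add_increasing)
        next
          case 3
          have "ennreal (fst w) * indicator {x<..x+c} (fst w + snd w) \<le> ennreal (x + c) * indicator (?S ?P3) w"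
            using True elim 3 by (auto simp: indicator_def intro!: ennreal_leI)
          then show ?thesis by (simp add: add_increasing)
        qed
      qed (auto simp: indicator_def)
    qed
  qed
  also have "\<dots> = ennreal (x + c) * emeasure (R \<Otimes>\<^sub>M m) (?S ?P1) + ennreal B * emeasure (R \<Otimes>\<^sub>M m) (?S ?P2)
      + ennreal (x + c) * emeasure (R \<Otimes>\<^sub>M m) (?S ?P3)"
    using S by (simp add: nn_integral_add nn_integral_cmult_indicator)
  also have "\<dots> = ennreal ((x + c) * sum_mass c R m ?P1 x + B * sum_mass c R m ?P2 x + (x + c) * sum_mass c R m ?P3 x)"
    unfolding emeasure_sum_mass[OF R_fin m_fin, of x ?P1] emeasure_sum_mass[OF R_fin m_fin, of x ?P2]
      emeasure_sum_mass[OF R_fin m_fin, of x ?P3] using x B c_pos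
    by (simp add: ennreal_mult ennreal_plus)
  finally show ?thesis
    using x B c_pos by (subst (asm) ennreal_le_iff) (auto intro!: add_nonneg_nonneg mult_nonneg_nonneg)
qed

text \<open>For \<open>z \<le> B\<close> the weight is at least \<open>x - B\<close>. For two large summands it may be small compared with \<open>x\<close>, but
  after replacing \<open>m\<close> by the smaller \<open>k R\<close> the two summands are exchangeable, so that each contributes half
  of their sum, which exceeds \<open>x\<close>.\<close>

lemma lm_lower:
  assumes B: "0 \<le> B" and x: "B \<le> x"
  shows "(x - B) * sum_mass c R m (\<lambda>_ z. z \<in> {0..B}) x
    + k * x / 2 * sum_mass c R R (\<lambda>y z. B < y \<and> B < z) x \<le> (x + c) * lm x"
proof -
  note [measurable_cong] = M_is_borel m.events_eq_borel
  let ?S = "\<lambda>P. {w. x < fst w + snd w \<and> fst w + snd w \<le> x + c \<and> P (fst w) (snd w)}"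
  let ?P1 = "\<lambda>_ z. z \<in> {0..B}" and ?P3 = "\<lambda>y z. B < y \<and> B < z"
  interpret RR: pair_sigma_finite R R by (rule finite_borel_pair[OF R_fin R_fin])
  have sets: "?S ?P1 \<in> sets (borel \<Otimes>\<^sub>M borel)" "?S ?P3 \<in> sets (borel \<Otimes>\<^sub>M borel)"
    using sum_set_measurable[OF R_fin R_fin, of ?P1 x c] sum_set_measurable[OF R_fin R_fin, of ?P3 x c]
    by (simp_all add: finite_borel_pair[OF R_fin R_fin])
  note [measurable] = sets
  have S: "?S ?P1 \<in> sets (R \<Otimes>\<^sub>M m)" "?S ?P3 \<in> sets (R \<Otimes>\<^sub>M R)"
    using sets by (simp_all add: finite_borel_pair[OF R_fin R_fin] finite_borel_pair[OF R_fin m_fin])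
  define D where "D = (\<integral>\<^sup>+w. ennreal (fst w) * indicator (?S ?P3) w \<partial>(R \<Otimes>\<^sub>M R))"
  have "D = (\<integral>\<^sup>+y. \<integral>\<^sup>+z. ennreal y * indicator (?S ?P3) (y, z) \<partial>R \<partial>R)"
    unfolding D_def by (subst nn_integral_fst[symmetric]) auto
  also have "\<dots> = (\<integral>\<^sup>+z. \<integral>\<^sup>+y. ennreal y * indicator (?S ?P3) (y, z) \<partial>R \<partial>R)"
    by (rule RR.Fubini') measurable
  also have "\<dots> = (\<integral>\<^sup>+z. \<integral>\<^sup>+y. ennreal (snd (z, y)) * indicator (?S ?P3) (z, y) \<partial>R \<partial>R)"
    by (intro nn_integral_cong) (auto simp: indicator_def add.commute)
  also have "\<dots> = (\<integral>\<^sup>+w. ennreal (snd w) * indicator (?S ?P3) w \<partial>(R \<Otimes>\<^sub>M R))"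
    by (subst nn_integral_fst[symmetric]) auto
  finally have D2: "D = (\<integral>\<^sup>+w. ennreal (snd w) * indicator (?S ?P3) w \<partial>(R \<Otimes>\<^sub>M R))" .
  have "ennreal (x * sum_mass c R R ?P3 x) = ennreal x * emeasure (R \<Otimes>\<^sub>M R) (?S ?P3)"
    unfolding emeasure_sum_mass[OF R_fin R_fin, of x ?P3] using x B by (simp add: ennreal_mult)
  also have "\<dots> = (\<integral>\<^sup>+w. ennreal x * indicator (?S ?P3) w \<partial>(R \<Otimes>\<^sub>M R))"
    using S by (simp add: nn_integral_cmult_indicator)
  also have "\<dots> \<le> (\<integral>\<^sup>+w. ennreal (fst w) * indicator (?S ?P3) w + ennreal (snd w) * indicator (?S ?P3) w \<partial>(R \<Otimes>\<^sub>M R))"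
  proof (rule nn_integral_mono)
    fix w :: "real \<times> real"
    have "ennreal x \<le> ennreal (fst w) + ennreal (snd w)" if "w \<in> ?S ?P3"
    proof -
      have "ennreal x \<le> ennreal (fst w + snd w)" by (rule ennreal_leI) (use that in auto)
      also have "\<dots> = ennreal (fst w) + ennreal (snd w)" by (rule ennreal_plus) (use that B in auto)
      finally show ?thesis .
    qed
    then show "ennreal x * indicator (?S ?P3) w \<le>
        ennreal (fst w) * indicator (?S ?P3) w + ennreal (snd w) * indicator (?S ?P3) w"
      by (auto split: split_indicator)
  qed
  also have "\<dots> = (\<integral>\<^sup>+w. ennreal (fst w) * indicator (?S ?P3) w \<partial>(R \<Otimes>\<^sub>M R)) +
      (\<integral>\<^sup>+w. ennreal (snd w) * indicator (?S ?P3) w \<partial>(R \<Otimes>\<^sub>M R))"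
    by (rule nn_integral_add) measurable
  also have "\<dots> = D + D" by (simp only: D2[symmetric] D_def[symmetric])
  finally have xD: "ennreal (x * sum_mass c R R ?P3 x) \<le> D + D" .
  have "ennreal k * D = ennreal k * (\<integral>\<^sup>+y. \<integral>\<^sup>+z. ennreal y * indicator (?S ?P3) (y, z) \<partial>R \<partial>R)"
    unfolding D_def by (subst nn_integral_fst[symmetric]) auto
  also have "\<dots> = (\<integral>\<^sup>+y. ennreal k * (\<integral>\<^sup>+z. ennreal y * indicator (?S ?P3) (y, z) \<partial>R) \<partial>R)"
    by (rule nn_integral_cmult[symmetric]) measurable
  also have "\<dots> \<le> (\<integral>\<^sup>+y. (\<integral>\<^sup>+z. ennreal y * indicator (?S ?P3) (y, z) \<partial>m) \<partial>R)"
    unfolding k_def by (intro nn_integral_mono cpois_ge mass_pos) measurable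
  also have "\<dots> = (\<integral>\<^sup>+w. ennreal (fst w) * indicator (?S ?P3) w \<partial>(R \<Otimes>\<^sub>M m))"
    by (subst m.nn_integral_fst[symmetric]) auto
  finally have kD: "ennreal k * D \<le> (\<integral>\<^sup>+w. ennreal (fst w) * indicator (?S ?P3) w \<partial>(R \<Otimes>\<^sub>M m))" .
  have "ennreal (k / 2) * ennreal (x * sum_mass c R R ?P3 x) \<le> ennreal (k / 2) * (D + D)"
    by (rule mult_left_mono[OF xD]) simp
  also have "\<dots> = ennreal k * D"
  proof -
    have "ennreal k = ennreal (k / 2) * ennreal 2" using k by (subst ennreal_mult[symmetric]) auto
    moreover have "ennreal 2 * D = D + D" by (simp add: mult_2)
    ultimately show ?thesis by (simp only: mult.assoc)
  qed
  also note kD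
  also have "ennreal (k / 2) * ennreal (x * sum_mass c R R ?P3 x) = ennreal (k * x / 2 * sum_mass c R R ?P3 x)"
  proof -
    have "k * x / 2 * sum_mass c R R ?P3 x = k / 2 * (x * sum_mass c R R ?P3 x)" by simp
    moreover have "ennreal (k / 2 * (x * sum_mass c R R ?P3 x)) = ennreal (k / 2) * ennreal (x * sum_mass c R R ?P3 x)"
      using k x B by (intro ennreal_mult) auto
    ultimately show ?thesis by (simp only:)
  qed
  finally have D3: "ennreal (k * x / 2 * sum_mass c R R ?P3 x) \<le>
      (\<integral>\<^sup>+w. ennreal (fst w) * indicator (?S ?P3) w \<partial>(R \<Otimes>\<^sub>M m))" .
  have "ennreal ((x - B) * sum_mass c R m ?P1 x + k * x / 2 * sum_mass c R R ?P3 x) =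
      ennreal (x - B) * emeasure (R \<Otimes>\<^sub>M m) (?S ?P1) + ennreal (k * x / 2 * sum_mass c R R ?P3 x)"
    unfolding emeasure_sum_mass[OF R_fin m_fin, of x ?P1] using x B k
    by (subst ennreal_plus) (auto simp: ennreal_mult)
  also have "\<dots> \<le> (\<integral>\<^sup>+w. ennreal (x - B) * indicator (?S ?P1) w \<partial>(R \<Otimes>\<^sub>M m))
      + (\<integral>\<^sup>+w. ennreal (fst w) * indicator (?S ?P3) w \<partial>(R \<Otimes>\<^sub>M m))"
    using S D3 by (intro add_mono) (auto simp: nn_integral_cmult_indicator)
  also have "\<dots> = (\<integral>\<^sup>+w. ennreal (x - B) * indicator (?S ?P1) w + ennreal (fst w) * indicator (?S ?P3) w \<partial>(R \<Otimes>\<^sub>M m))"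
    by (rule nn_integral_add[symmetric]) measurable
  also have "\<dots> \<le> (\<integral>\<^sup>+w. ennreal (fst w) * indicator {x<..x+c} (fst w + snd w) \<partial>(R \<Otimes>\<^sub>M m))"
  proof (rule nn_integral_mono)
    fix w :: "real \<times> real"
    have "ennreal (x - B) \<le> ennreal (fst w)" if "w \<in> ?S ?P1"
      using that by (intro ennreal_leI) auto
    then show "ennreal (x - B) * indicator (?S ?P1) w + ennreal (fst w) * indicator (?S ?P3) w \<le>
        ennreal (fst w) * indicator {x<..x+c} (fst w + snd w)"
      by (auto split: split_indicator)
  qed
  also have "\<dots> = (\<integral>\<^sup>+u. ennreal u * indicator {x<..x+c} u \<partial>m)"
    by (rule size_bias_local[symmetric])
  also have "\<dots> \<le> (\<integral>\<^sup>+u. ennreal (x + c) * indicator {x<..x+c} u \<partial>m)"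
    by (intro nn_integral_mono) (auto simp: indicator_def intro: ennreal_leI)
  also have "\<dots> = ennreal ((x + c) * lm x)"
    using x B c_pos by (simp add: local_mass_def ennreal_mult m.emeasure_eq_measure nn_integral_cmult_indicator)
  finally show ?thesis
    using x B c_pos by (subst (asm) ennreal_le_iff) auto
qed

end

context positive_levy
begin

lemma m_mass_le_1: "measure m A \<le> 1" by (rule m.prob_le_1)

lemma bounded_R_part_swap:
  "sum_mass c R m (\<lambda>_ z. z \<in> {0..B}) x = sum_mass c m R (\<lambda>y _. y \<in> {0..B}) x"
  by (rule sum_mass_swap[OF R_fin m_fin]) simp

lemma ex_m_interval:
  assumes "0 < e"
  obtains B0 where "0 < B0" "\<And>B. B0 \<le> B \<Longrightarrow> 1 - e < measure m {0..B}"
proof -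
  obtain B0 where B0: "0 < B0" "\<And>B. B0 \<le> B \<Longrightarrow> measure m UNIV - e < measure m {-B..B}"
    by (rule m.ex_symmetric_interval[OF assms]) blast
  show ?thesis
  proof (rule that[OF B0(1)])
    fix B assume B: "B0 \<le> B"
    have "measure m {-B..B} \<le> measure m ({..<0} \<union> {0..B})"
      by (rule m.finite_measure_mono) auto
    also have "\<dots> \<le> measure m {..<0} + measure m {0..B}" by (rule measure_Un_le) auto
    finally show "1 - e < measure m {0..B}" using B0(2)[OF B] m.prob_space by (simp add: m_nonneg)
  qed
qed

lemma quotients_tendsto:
  fixes B :: real
  shows "((\<lambda>x. (x + c) / x) \<longlongrightarrow> 1) at_top" "((\<lambda>x. B / x) \<longlongrightarrow> 0) at_top"
    "((\<lambda>x. (x - B) / (x + c)) \<longlongrightarrow> 1) at_top" "((\<lambda>x. (x + c) / (x - B)) \<longlongrightarrow> 1) at_top"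
  using c_pos by real_asymp+

text \<open>The supremum \<open>q\<close> of the ratio \<open>m (x) / R (x)\<close> on a window \<open>[x\<^sub>0, t]\<close> is finite. By \<open>lm_upper\<close> the ratio is
  at most a constant plus \<open>q / 2\<close> for all \<open>x\<close> in the window beyond some \<open>x\<^sub>1\<close> independent of \<open>t\<close>: the
  terms with a bounded \<open>y\<close> and with two large summands, in which \<open>m\<close> is estimated by \<open>q R\<close>, each receive a factor of at most \<open>1 / 4\<close>. Hence the bound is uniform in \<open>t\<close>.\<close>

lemma lm_le_r:
  assumes lt: "long_tailed r" and neg: "negligible_pairs c R R r"
  obtains K T where "0 < K" "\<And>x. T \<le> x \<Longrightarrow> lm x \<le> K * r x"
proof -
  obtain x0 C where x0: "0 < x0" and C: "1 \<le> C"
    and rpos: "\<And>x. x0 \<le> x \<Longrightarrow> 0 < r x"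
    and dn: "\<And>x y. x0 \<le> x \<Longrightarrow> 0 \<le> y \<Longrightarrow> r x \<le> C * exp (1 * y) * r (x + y)"
    by (rule long_tailed_growth[OF c_pos lt, of 1], simp, blast)
  obtain B0 where B0: "\<And>B. B0 \<le> B \<Longrightarrow>
      \<forall>\<^sub>F x in at_top. sum_mass c R R (\<lambda>y z. B < y \<and> B < z) x \<le> 1 / 8 * r x"
    using neg unfolding negligible_pairs_def by (meson zero_less_divide_1_iff zero_less_numeral)
  \<comment> \<open>the summand \<open>c\<close> ensures that \<open>x - y \<ge> x0\<close> if \<open>y < x + c - B\<close>\<close>
  define B where "B = max B0 x0 + c"
  have B: "B0 \<le> B - c" "x0 \<le> B - c" "0 < B" using x0 c_pos by (auto simp: B_def)
  obtain D where D: "1 \<le> D" "\<forall>\<^sub>F x in at_top. \<forall>y\<in>{-B..B}. r (x - y) \<le> D * r x"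
    by (rule long_tailed_compact_bound[OF c_pos lt])
  define mass where "mass = measure R UNIV"
  have "\<forall>\<^sub>F x in at_top. (\<forall>y\<in>{-B..B}. r (x - y) \<le> D * r x)
      \<and> sum_mass c R R (\<lambda>y z. B - c < y \<and> B - c < z) x \<le> 1 / 8 * r x
      \<and> x0 + B \<le> x \<and> c \<le> x \<and> 4 * B * D * mass \<le> x"
    using D(2) B0[OF B(1)] by (intro eventually_conj eventually_ge_at_top) auto
  then obtain x1 where x1: "\<And>x. x1 \<le> x \<Longrightarrow> (\<forall>y\<in>{-B..B}. r (x - y) \<le> D * r x)
      \<and> sum_mass c R R (\<lambda>y z. B - c < y \<and> B - c < z) x \<le> 1 / 8 * r x
      \<and> x0 + B \<le> x \<and> c \<le> x \<and> 4 * B * D * mass \<le> x"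
    unfolding eventually_at_top_linorder by blast
  define K1 where "K1 = C * exp \<bar>x1 - x0\<bar> / r x0"
  define K where "K = max K1 (4 * D)"
  have crude: "lm x / r x \<le> C * exp (x - x0) / r x0" if "x0 \<le> x" for x
  proof -
    have "r x0 \<le> C * exp (x - x0) * r x" using dn[of x0 "x - x0"] that by simp
    then have "1 / r x \<le> C * exp (x - x0) / r x0"
      using rpos[OF that] rpos[of x0] by (simp add: field_simps)
    moreover have "lm x \<le> 1"
      using m.local_mass_le_mass[of c x] m_mass_le_1[of UNIV] by linarith
    then have "lm x / r x \<le> 1 / r x"
      using rpos[OF that] by (intro divide_right_mono) auto
    ultimately show ?thesis by linarith
  qed
  have le_K: "lm t \<le> K * r t" if t: "x0 \<le> t" for t
  proof -
    define q where "q = (SUP x\<in>{x0..t}. lm x / r x)"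
    have bdd: "bdd_above ((\<lambda>x. lm x / r x) ` {x0..t})"
    proof (rule bdd_aboveI2)
      fix x assume "x \<in> {x0..t}"
      then have "C * exp (x - x0) / r x0 \<le> C * exp (t - x0) / r x0"
        using C rpos[of x0] by (intro divide_right_mono mult_left_mono) auto
      then show "lm x / r x \<le> C * exp (t - x0) / r x0" using crude[of x] \<open>x \<in> {x0..t}\<close> by auto
    qed
    have qx: "lm x \<le> q * r x" if "x0 \<le> x" "x \<le> t" for x
      using cSUP_upper[OF _ bdd, of x] that rpos[of x] by (auto simp: q_def field_simps)
    have q0: "0 \<le> q" using cSUP_upper[OF _ bdd, of x0] t rpos[of x0] unfolding q_def
      by (intro order_trans[OF _ cSUP_upper[OF _ bdd, of x0]]) auto
    have "q \<le> max K1 (2 * D + q / 2)"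
      unfolding q_def
    proof (rule cSUP_least, goal_cases)
      case (2 x)
      show ?case
        unfolding q_def[symmetric]
      proof (cases "x \<le> x1")
        case True
        have "C * exp (x - x0) / r x0 \<le> K1"
          unfolding K1_def using True C rpos[of x0] by (intro divide_right_mono mult_left_mono) auto
        with crude[of x] 2 show "lm x / r x \<le> max K1 (2 * D + q / 2)" by auto
      next
        case False
        then have "x1 \<le> x" by simp
        note x1 = x1[OF this]
        have x: "0 < x" "x0 \<le> x" using x1 x0 B by auto
        have "sum_mass c R m (\<lambda>_ z. z \<in> {0..B}) x \<le> D * r x * measure m {0..B}"
          unfolding bounded_R_part_swap
          by (rule sum_mass_le_const[OF m_fin R_fin c_pos]) (use x1 in auto)
        also have "\<dots> \<le> D * r x" using D rpos[of x] x by (intro mult_left_le m_mass_le_1) auto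
        finally have P: "sum_mass c R m (\<lambda>_ z. z \<in> {0..B}) x \<le> D * r x" .
        have "sum_mass c R m (\<lambda>y _. y \<in> {0..B}) x \<le> q * (D * r x) * measure R {0..B}"
        proof (rule sum_mass_le_const[OF R_fin m_fin c_pos])
          fix y assume y: "y \<in> {0..B}"
          have "lm (x - y) \<le> q * r (x - y)" using x1 y 2 by (intro qx) auto
          also have "\<dots> \<le> q * (D * r x)" using x1 y q0 by (intro mult_left_mono) auto
          finally show "lm (x - y) \<le> q * (D * r x)" .
        qed simp
        also have "\<dots> \<le> q * (D * r x) * mass"
          unfolding mass_def using q0 D rpos[of x] x by (intro mult_left_mono finite_measure_mono) (auto simp: M_is_borel)
        finally have Q: "sum_mass c R m (\<lambda>y _. y \<in> {0..B}) x \<le> q * (D * r x) * mass" .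
        have "sum_mass c R m (\<lambda>y z. B < y \<and> B < z) x \<le> sum_mass c R m (\<lambda>y _. y \<in> {B<..<x + c - B}) x"
          by (rule sum_mass_mono[OF R_fin m_fin]) auto
        also have "\<dots> \<le> q * sum_mass c R R (\<lambda>y _. y \<in> {B<..<x + c - B}) x"
          using B 2 by (intro sum_mass_le_mult[OF R_fin m_fin R_fin c_pos] qx) auto
        also have "\<dots> \<le> q * sum_mass c R R (\<lambda>y z. B - c < y \<and> B - c < z) x"
          using q0 c_pos by (intro mult_left_mono sum_mass_mono[OF R_fin R_fin]) auto
        also have "\<dots> \<le> q * (1 / 8 * r x)"
          using x1 q0 by (intro mult_left_mono) auto
        finally have E: "sum_mass c R m (\<lambda>y z. B < y \<and> B < z) x \<le> q * (1 / 8 * r x)" .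
        have "x * lm x \<le> (x + c) * sum_mass c R m (\<lambda>_ z. z \<in> {0..B}) x
            + B * sum_mass c R m (\<lambda>y _. y \<in> {0..B}) x
            + (x + c) * sum_mass c R m (\<lambda>y z. B < y \<and> B < z) x"
          using B x by (intro lm_upper) auto
        also have "\<dots> \<le> 2 * x * (D * r x) + B * (q * (D * r x) * mass) + 2 * x * (q * (1 / 8 * r x))"
        proof (intro add_mono mult_mono P Q E)
          show "x + c \<le> 2 * x" "x + c \<le> 2 * x" using x1 by auto
        qed (use x B D rpos[of x] in auto)
        also have "B * (q * (D * r x) * mass) = (4 * B * D * mass) * (q * r x / 4)" by simp
        also have "\<dots> \<le> x * (q * r x / 4)"
          using x1 q0 rpos[of x] x by (intro mult_right_mono) auto
        finally have "x * lm x \<le> x * (2 * D * r x + q / 2 * r x)"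
          by (simp add: algebra_simps)
        then have "lm x \<le> 2 * D * r x + q / 2 * r x" using x(1) by (simp only: mult_le_cancel_left_pos)
        then have "lm x \<le> (2 * D + q / 2) * r x" by (simp only: distrib_right)
        then have "lm x / r x \<le> 2 * D + q / 2" using rpos[OF x(2)] by (simp add: pos_divide_le_eq)
        then show "lm x / r x \<le> max K1 (2 * D + q / 2)" by simp
      qed
    qed (use t in auto)
    then have "q \<le> K" using D by (auto simp: K_def max_def split: if_splits)
    have "lm t \<le> q * r t" using t by (intro qx) auto
    also have "\<dots> \<le> K * r t" using \<open>q \<le> K\<close> by (intro mult_right_mono) auto
    finally show ?thesis .
  qed
  show ?thesis
    by (rule that[of K x0]) (use le_K D in \<open>auto simp: K_def\<close>)
qed

lemma r_part_ratio:
  assumes "long_tailed r"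
  shows "((\<lambda>x. sum_mass c R m (\<lambda>_ z. z \<in> {0..B}) x / r x) \<longlongrightarrow> measure m {0..B}) at_top"
  unfolding bounded_R_part_swap
  by (rule sum_mass_ratio_compact[OF m_fin R_fin c_pos assms, where B = B]) auto

lemma lm_asymp_r:
  assumes lt: "long_tailed r" and neg: "negligible_pairs c R R r"
  shows "lm \<sim>[at_top] r"
proof -
  note pos = long_tailed_pos[OF lt]
  obtain K T where K: "0 < K" "\<And>x. T \<le> x \<Longrightarrow> lm x \<le> K * r x"
    using lm_le_r[OF lt neg] by blast
  have neg': "negligible_pairs c R m r"
  proof (rule negligible_pairs_transfer[OF c_pos R_fin R_fin m_fin neg])
    show "0 < max 1 K" by simp
    show "r x \<le> max 1 K * r x" if "T \<le> x" for x
      using mult_right_mono[of 1 "max 1 K" "r x"] by simp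
    show "lm x \<le> max 1 K * r x" if "T \<le> x" for x
      using K(2)[OF that] mult_right_mono[of K "max 1 K" "r x"] by simp
  qed
  have "((\<lambda>x. lm x / r x) \<longlongrightarrow> 1) at_top"
  proof (rule order_tendstoI)
    fix a :: real assume "a < 1"
    then obtain B0 where B0: "0 < B0" "\<And>B. B0 \<le> B \<Longrightarrow> 1 - (1 - a) < measure m {0..B}"
      using ex_m_interval[of "1 - a"] by auto
    define B where "B = B0"
    have mB: "a < measure m {0..B}" using B0(2)[of B] by (simp add: B_def)
    have "((\<lambda>x. (x - B) / (x + c) * (sum_mass c R m (\<lambda>_ z. z \<in> {0..B}) x / r x))
        \<longlongrightarrow> 1 * measure m {0..B}) at_top"
      by (intro tendsto_mult quotients_tendsto r_part_ratio[OF lt])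
    then have "\<forall>\<^sub>F x in at_top. a < (x - B) / (x + c) * (sum_mass c R m (\<lambda>_ z. z \<in> {0..B}) x / r x)"
      using mB by (intro order_tendstoD(1)) auto
    then show "\<forall>\<^sub>F x in at_top. a < lm x / r x"
      using pos eventually_ge_at_top[of B]
    proof eventually_elim
      case (elim x)
      have x: "0 < x" "0 < x + c" using elim B0(1) c_pos by (auto simp: B_def)
      have "(x - B) * sum_mass c R m (\<lambda>_ z. z \<in> {0..B}) x
          + k * x / 2 * sum_mass c R R (\<lambda>y z. B < y \<and> B < z) x \<le> (x + c) * lm x"
        using elim B0 by (intro lm_lower) (auto simp: B_def)
      moreover have "0 \<le> k * x / 2 * sum_mass c R R (\<lambda>y z. B < y \<and> B < z) x" using k x by simp
      ultimately have "(x - B) * sum_mass c R m (\<lambda>_ z. z \<in> {0..B}) x \<le> (x + c) * lm x" by linarith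
      then have "((x - B) * sum_mass c R m (\<lambda>_ z. z \<in> {0..B}) x) / ((x + c) * r x)
          \<le> ((x + c) * lm x) / ((x + c) * r x)"
        using elim x by (intro divide_right_mono) auto
      then have "(x - B) / (x + c) * (sum_mass c R m (\<lambda>_ z. z \<in> {0..B}) x / r x) \<le> lm x / r x"
        using x by simp
      with elim show ?case by linarith
    qed
  next
    fix a :: real assume a: "1 < a"
    define e where "e = (a - 1) / 2"
    have e: "0 < e" using a by (simp add: e_def)
    obtain B0 where B0: "\<And>B. B0 \<le> B \<Longrightarrow>
        \<forall>\<^sub>F x in at_top. sum_mass c R m (\<lambda>y z. B < y \<and> B < z) x \<le> e * r x"
      using neg' e unfolding negligible_pairs_def by meson
    define B where "B = max B0 1"
    have B: "0 \<le> B" by (simp add: B_def)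
    have "((\<lambda>x. (x + c) / x * (sum_mass c R m (\<lambda>_ z. z \<in> {0..B}) x / r x)
          + B / x * (K * (sum_mass c R R (\<lambda>y _. y \<in> {0..B}) x / r x)) + (x + c) / x * e)
        \<longlongrightarrow> 1 * measure m {0..B} + 0 * (K * measure R {0..B}) + 1 * e) at_top"
      by (intro tendsto_add tendsto_mult tendsto_const quotients_tendsto r_part_ratio[OF lt]
          sum_mass_ratio_compact[OF R_fin R_fin c_pos lt, where B = B]) auto
    moreover have "1 * measure m {0..B} + 0 * (K * measure R {0..B}) + 1 * e < a"
    proof -
      have "measure m {0..B} \<le> 1" by (rule m_mass_le_1)
      moreover have "1 + e < a" using a by (simp add: e_def field_simps)
      ultimately have "measure m {0..B} + e < a" by linarith
      then show ?thesis by simp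
    qed
    ultimately have "\<forall>\<^sub>F x in at_top. (x + c) / x * (sum_mass c R m (\<lambda>_ z. z \<in> {0..B}) x / r x)
          + B / x * (K * (sum_mass c R R (\<lambda>y _. y \<in> {0..B}) x / r x)) + (x + c) / x * e < a"
      by (rule order_tendstoD(2))
    moreover have "\<forall>\<^sub>F x in at_top. sum_mass c R m (\<lambda>y z. B < y \<and> B < z) x \<le> e * r x"
      by (rule B0) (simp add: B_def)
    ultimately show "\<forall>\<^sub>F x in at_top. lm x / r x < a"
      using pos eventually_gt_at_top[of 0] eventually_ge_at_top[of "T + B"]
    proof eventually_elim
      case (elim x)
      have Q: "sum_mass c R m (\<lambda>y _. y \<in> {0..B}) x \<le> K * sum_mass c R R (\<lambda>y _. y \<in> {0..B}) x"
        using elim by (intro sum_mass_le_mult[OF R_fin m_fin R_fin c_pos] K) auto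
      have "x * lm x \<le> (x + c) * sum_mass c R m (\<lambda>_ z. z \<in> {0..B}) x
          + B * sum_mass c R m (\<lambda>y _. y \<in> {0..B}) x
          + (x + c) * sum_mass c R m (\<lambda>y z. B < y \<and> B < z) x"
        using B elim by (intro lm_upper) auto
      also have "\<dots> \<le> (x + c) * sum_mass c R m (\<lambda>_ z. z \<in> {0..B}) x
          + B * (K * sum_mass c R R (\<lambda>y _. y \<in> {0..B}) x) + (x + c) * (e * r x)"
        using elim Q B c_pos by (intro add_mono mult_left_mono) auto
      finally have le: "x * lm x \<le> (x + c) * sum_mass c R m (\<lambda>_ z. z \<in> {0..B}) x
          + B * (K * sum_mass c R R (\<lambda>y _. y \<in> {0..B}) x) + (x + c) * (e * r x)" .
      \<comment> \<open>opaque names for the quotients, so that the division by \<open>x * r x\<close> becomes a ring identity\<close>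
      define u v p q where "u = (x + c) / x" and "v = B / x"
        and "p = sum_mass c R m (\<lambda>_ z. z \<in> {0..B}) x / r x"
        and "q = sum_mass c R R (\<lambda>y _. y \<in> {0..B}) x / r x"
      have nz: "x \<noteq> 0" "r x \<noteq> 0" using elim by auto
      have eqs: "x + c = x * u" "B = x * v" "sum_mass c R m (\<lambda>_ z. z \<in> {0..B}) x = p * r x"
        "sum_mass c R R (\<lambda>y _. y \<in> {0..B}) x = q * r x"
        using nz by (simp_all add: u_def v_def p_def q_def)
      have "(x + c) * sum_mass c R m (\<lambda>_ z. z \<in> {0..B}) x
          + B * (K * sum_mass c R R (\<lambda>y _. y \<in> {0..B}) x) + (x + c) * (e * r x)
          = x * u * (p * r x) + x * v * (K * (q * r x)) + x * u * (e * r x)"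
        by (rule arg_cong2[where f = "(+)"] arg_cong2[where f = "(*)"] eqs refl)+
      also have "\<dots> = x * ((u * p + v * (K * q) + u * e) * r x)" by (simp add: algebra_simps)
      finally have "x * lm x \<le> x * ((u * p + v * (K * q) + u * e) * r x)" using le by linarith
      then have "lm x \<le> (u * p + v * (K * q) + u * e) * r x" using elim by simp
      then have "lm x / r x \<le> u * p + v * (K * q) + u * e" using elim by (simp add: pos_divide_le_eq)
      moreover have "u * p + v * (K * q) + u * e < a" using elim by (simp only: u_def v_def p_def q_def)
      ultimately show ?case by linarith
    qed
  qed
  then show ?thesis using asymp_equiv_iff_quotient[OF pos] by simp
qed

text \<open>In \<open>lm_lower\<close> the first term alone is asymptotically at least \<open>m [0, B]\<close> times \<open>x R (x)\<close>, whereas the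
  right-hand side is asymptotically at most \<open>x R (x)\<close>.\<close>

lemma negligible_pairs_if_asymp_le:
  assumes lt: "long_tailed r" and le: "asymp_le lm r"
  shows "negligible_pairs c R R r"
  unfolding negligible_pairs_def
proof (intro allI impI)
  fix e :: real assume e: "e > 0"
  note pos = long_tailed_pos[OF lt]
  \<comment> \<open>the limit obtained below is smaller than \<open>2 / k * (2 * d) = e / 2\<close>\<close>
  define d where "d = e * k / 8"
  have d: "0 < d" using e k by (simp add: d_def)
  obtain B0 where B0: "0 < B0" "\<And>B. B0 \<le> B \<Longrightarrow> 1 - d < measure m {0..B}"
    using ex_m_interval[OF d] by blast
  show "\<exists>B0. \<forall>B\<ge>B0. \<forall>\<^sub>F x in at_top. sum_mass c R R (\<lambda>y z. B < y \<and> B < z) x \<le> e * r x"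
  proof (intro exI allI impI)
    fix B assume B: "B0 \<le> B"
    have "((\<lambda>x. 2 / k * ((x + c) / x * (1 + d)
        - (1 - B / x) * (sum_mass c R m (\<lambda>_ z. z \<in> {0..B}) x / r x)))
        \<longlongrightarrow> 2 / k * (1 * (1 + d) - (1 - 0) * measure m {0..B})) at_top"
      by (intro tendsto_mult tendsto_diff tendsto_const quotients_tendsto r_part_ratio[OF lt])
    moreover have "2 / k * (1 * (1 + d) - (1 - 0) * measure m {0..B}) < e"
    proof -
      have "1 * (1 + d) - (1 - 0) * measure m {0..B} < 2 * d" using B0(2)[OF B] by simp
      then have "2 / k * (1 * (1 + d) - (1 - 0) * measure m {0..B}) < 2 / k * (2 * d)"
        using k by (intro mult_strict_left_mono) auto
      also have "\<dots> < e" using k e by (simp add: d_def)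
      finally show ?thesis .
    qed
    ultimately have "\<forall>\<^sub>F x in at_top. 2 / k * ((x + c) / x * (1 + d)
        - (1 - B / x) * (sum_mass c R m (\<lambda>_ z. z \<in> {0..B}) x / r x)) < e"
      by (rule order_tendstoD(2))
    then show "\<forall>\<^sub>F x in at_top. sum_mass c R R (\<lambda>y z. B < y \<and> B < z) x \<le> e * r x"
      using pos eventually_ge_at_top[of B] asymp_leD[OF le d]
    proof eventually_elim
      case (elim x)
      have x: "0 < x" using elim B B0 by auto
      let ?P = "sum_mass c R m (\<lambda>_ z. z \<in> {0..B}) x" and ?D = "sum_mass c R R (\<lambda>y z. B < y \<and> B < z) x"
      have "(x - B) * ?P + k * x / 2 * ?D \<le> (x + c) * lm x"
        using elim B B0 by (intro lm_lower) auto
      also have "\<dots> \<le> (x + c) * ((1 + d) * r x)"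
        using elim x c_pos by (intro mult_left_mono) auto
      finally have le: "k * x / 2 * ?D \<le> (x + c) * ((1 + d) * r x) - (x - B) * ?P" by simp
      define u v p where "u = (x + c) / x" and "v = 1 - B / x" and "p = ?P / r x"
      have nz: "x \<noteq> 0" "r x \<noteq> 0" using x elim by auto
      have e: "x + c = x * u" "x - B = x * v" "?P = p * r x"
        using nz by (simp_all add: u_def v_def p_def right_diff_distrib)
      define w where "w = u * (1 + d) - v * p"
      have "(x + c) * ((1 + d) * r x) - (x - B) * ?P = x * (r x * w)"
      proof -
        have "(x + c) * ((1 + d) * r x) - (x - B) * ?P = x * u * ((1 + d) * r x) - x * v * (p * r x)"
          by (rule arg_cong2[where f = "(-)"] arg_cong2[where f = "(*)"] e refl)+
        also have "\<dots> = x * (r x * (u * (1 + d) - v * p))" by (simp add: algebra_simps)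
        finally show ?thesis unfolding w_def .
      qed
      with le have "k * x / 2 * ?D \<le> x * (r x * w)" by (simp only:)
      moreover have "x * (k * ?D) = 2 * (k * x / 2 * ?D)" "x * (2 * (r x * w)) = 2 * (x * (r x * w))" by simp_all
      ultimately have "x * (k * ?D) \<le> x * (2 * (r x * w))" by linarith
      then have "k * ?D \<le> 2 * (r x * w)" using x by simp
      then have "?D \<le> 2 / k * w * r x" using k by (simp add: field_simps)
      moreover have "2 / k * w < e" using elim by (simp only: w_def u_def v_def p_def)
      then have "2 / k * w * r x \<le> e * r x" using elim by (intro mult_right_mono) auto
      ultimately show ?case by linarith
    qed
  qed
qed

end

section \<open>Deconvolution\<close>

text \<open>With an atom of more than half of the mass at 0, \<open>h * g \<rightarrow> 0\<close> bounds \<open>g\<close> at infinity by a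
  fixed fraction of any bound for \<open>g\<close> at infinity.\<close>

lemma deconvolution_half_atom:
  assumes h: "real_distribution h" and atom: "1 / 2 < measure h {0}"
    and g: "g \<in> borel_measurable borel" "\<And>x. \<bar>g x\<bar> \<le> (S::real)"
    and lim: "((\<lambda>x. \<integral>y. g (x - y) \<partial>h) \<longlongrightarrow> 0) at_top"
  shows "(g \<longlongrightarrow> 0) at_top"
proof -
  interpret h: real_distribution h by fact
  note [measurable] = g(1)
  define a where "a = measure h {0}"
  have a: "1 / 2 < a" "a \<le> 1" using atom by (auto simp: a_def)
  have S: "0 \<le> S" using g(2)[of 0] by linarith
  have int: "integrable h (\<lambda>y. g (x - y) * indicator A y)" if [measurable]: "A \<in> sets borel" for x A
    using g(2) S by (intro h.integrable_const_bound[where B = S] AE_I2) (auto simp: indicator_def)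
  have step: "\<forall>\<^sub>F x in at_top. \<bar>g x\<bar> \<le> s / (2 * a)" if ev: "\<forall>\<^sub>F x in at_top. \<bar>g x\<bar> \<le> s" and s: "0 < s" for s
  proof -
    \<comment> \<open>chosen such that \<open>s * (1 - a) + 2 * e = s / 2\<close>\<close>
    define e where "e = s * (a - 1 / 2) / 2"
    have e: "0 < e" using s a by (simp add: e_def)
    obtain x0 where x0: "\<And>x. x0 \<le> x \<Longrightarrow> \<bar>g x\<bar> \<le> s" using ev by (auto simp: eventually_at_top_linorder)
    have "((\<lambda>x. S * (1 - cdf h (x - x0))) \<longlongrightarrow> S * (1 - 1)) at_top"
      by (intro tendsto_intros filterlim_compose[OF h.cdf_lim_at_top_prob]) real_asymp
    then have "\<forall>\<^sub>F x in at_top. S * (1 - cdf h (x - x0)) < e"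
      using e by (intro order_tendstoD(2)) auto
    moreover have "\<forall>\<^sub>F x in at_top. \<bar>\<integral>y. g (x - y) \<partial>h\<bar> < e"
      using tendstoD[OF lim e] by simp
    ultimately show ?thesis using eventually_ge_at_top[of x0]
    proof eventually_elim
      case (elim x)
      have split: "g (x - y) = g x * indicator {0} y + g (x - y) * indicator (- {0}) y" for y
        by (auto simp: indicator_def)
      have "(\<integral>y. g (x - y) \<partial>h) = (\<integral>y. g x * indicator {0} y \<partial>h) + (\<integral>y. g (x - y) * indicator (- {0}) y \<partial>h)"
        by (subst split, rule Bochner_Integration.integral_add)
          (auto intro!: int integrable_real_indicator simp: h.emeasure_eq_measure)
      also have "(\<integral>y. g x * indicator {0} y \<partial>h) = g x * a" by (simp add: a_def)
      finally have ga: "g x * a = (\<integral>y. g (x - y) \<partial>h) - (\<integral>y. g (x - y) * indicator (- {0}) y \<partial>h)" by simp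
      have "\<bar>\<integral>y. g (x - y) * indicator (- {0}) y \<partial>h\<bar> \<le> (\<integral>y. \<bar>g (x - y) * indicator (- {0}) y\<bar> \<partial>h)"
        by (rule integral_abs_bound)
      also have "\<dots> \<le> (\<integral>y. s * indicator (- {0}) y + S * indicator {x - x0<..} y \<partial>h)"
      proof (rule integral_mono)
        show "integrable h (\<lambda>y. \<bar>g (x - y) * indicator (- {0}) y\<bar>)"
          by (intro integrable_abs int) simp
        show "integrable h (\<lambda>y. s * indicator (- {0}) y + S * indicator {x - x0<..} y)"
          by (auto intro!: integrable_real_indicator simp: h.emeasure_eq_measure)
        show "\<bar>g (x - y) * indicator (- {0}) y\<bar> \<le> s * indicator (- {0}) y + S * indicator {x - x0<..} y" for y
          using x0[of "x - y"] g(2)[of "x - y"] s S by (auto simp: indicator_def)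
      qed
      also have "\<dots> = s * measure h (- {0}) + S * measure h {x - x0<..}"
        by (subst Bochner_Integration.integral_add)
          (auto intro!: integrable_real_indicator simp: h.emeasure_eq_measure)
      also have "measure h (- {0}) = 1 - a"
        using h.prob_compl[of "{0}"] by (simp add: a_def Compl_eq_Diff_UNIV)
      also have "measure h {x - x0<..} = 1 - cdf h (x - x0)"
      proof -
        have "{x - x0<..} = UNIV - {..x - x0}" by auto
        then show ?thesis using h.prob_compl[of "{..x - x0}"] by (simp add: cdf_def)
      qed
      finally have "\<bar>\<integral>y. g (x - y) * indicator (- {0}) y \<partial>h\<bar> \<le> s * (1 - a) + e" using elim by linarith
      then have "\<bar>g x * a\<bar> \<le> e + (s * (1 - a) + e)" using elim ga by linarith
      also have "\<dots> = s / 2" by (simp add: e_def algebra_simps)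
      finally have "\<bar>g x\<bar> * a \<le> s / 2" using a by (simp add: abs_mult)
      then show ?case using a by (simp add: field_simps)
    qed
  qed
  have pow: "\<forall>\<^sub>F x in at_top. \<bar>g x\<bar> \<le> (S + 1) / (2 * a) ^ n" for n
  proof (induction n)
    case 0
    have "\<bar>g x\<bar> \<le> S + 1" for x using g(2)[of x] by linarith
    then show ?case by simp
  next
    case (Suc n)
    have "0 < (S + 1) / (2 * a) ^ n" using S a by (intro divide_pos_pos zero_less_power) auto
    from step[OF Suc this] show ?case by (simp add: field_simps)
  qed
  show ?thesis
  proof (rule tendstoI)
    fix e :: real assume e: "0 < e"
    have "(\<lambda>n. (S + 1) / (2 * a) ^ n) \<longlonglongrightarrow> 0"
      using a by (intro LIMSEQ_divide_realpow_zero) auto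
    then have "\<forall>\<^sub>F n in sequentially. (S + 1) / (2 * a) ^ n < e" using e by (rule order_tendstoD(2))
    then obtain n where "(S + 1) / (2 * a) ^ n < e" by (auto simp: eventually_sequentially)
    then show "\<forall>\<^sub>F x in at_top. dist (g x) 0 < e"
      using pow[of n] by (auto elim!: eventually_mono simp: dist_real_def)
  qed
qed

lemma deconvolution_conv_pow:
  assumes h: "real_distribution h" and atom: "1 / 2 < measure h {0}"
    and g: "g \<in> borel_measurable borel" "\<And>x. \<bar>g x\<bar> \<le> (S::real)"
    and lim: "((\<lambda>x. \<integral>y. g (x - y) \<partial>conv_pow h n) \<longlongrightarrow> 0) at_top"
  shows "(g \<longlongrightarrow> 0) at_top"
  using lim
proof (induction n)
  case 0
  have "(\<integral>y. g (x - y) \<partial>return borel 0) = g x" for x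
    using g(1) by (subst integral_return) auto
  with 0 show ?case by simp
next
  case (Suc n)
  interpret h: real_distribution h by fact
  interpret P: real_distribution "conv_pow h n" by (rule real_distribution_conv_pow[OF h])
  interpret hP: pair_prob_space h "conv_pow h n" by unfold_locales
  note [measurable] = g(1) and [measurable_cong] = h.events_eq_borel P.events_eq_borel
  define G where "G x = (\<integral>y. g (x - y) \<partial>conv_pow h n)" for x
  have G: "G \<in> borel_measurable borel" unfolding G_def by measurable
  have S: "0 \<le> S" using g(2)[of 0] by linarith
  have Gb: "\<bar>G x\<bar> \<le> S" for x
  proof -
    have "\<bar>G x\<bar> \<le> (\<integral>y. \<bar>g (x - y)\<bar> \<partial>conv_pow h n)" unfolding G_def by (rule integral_abs_bound)
    also have "\<dots> \<le> (\<integral>y. S \<partial>conv_pow h n)"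
      using g(2) S by (intro integral_mono P.integrable_const_bound[where B = S] AE_I2) auto
    finally show ?thesis using P.prob_space by simp
  qed
  have "(\<integral>y. g (x - y) \<partial>conv_pow h (Suc n)) = (\<integral>y. G (x - y) \<partial>h)" for x
  proof -
    have "(\<integral>y. g (x - y) \<partial>conv_pow h (Suc n)) = (\<integral>w. g (x - (fst w + snd w)) \<partial>(h \<Otimes>\<^sub>M conv_pow h n))"
      by (simp add: convolution_def case_prod_beta integral_distr)
    also have "\<dots> = (\<integral>y. \<integral>z. g (x - (y + z)) \<partial>conv_pow h n \<partial>h)"
      using g(2) by (subst hP.integral_fst'[symmetric])
        (auto intro!: hP.P.integrable_const_bound[where B = S])
    finally show ?thesis by (simp add: G_def diff_diff_eq)
  qed
  with Suc.prems have "((\<lambda>x. \<integral>y. G (x - y) \<partial>h) \<longlongrightarrow> 0) at_top" by (simp only:)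
  then have "(G \<longlongrightarrow> 0) at_top" by (rule deconvolution_half_atom[OF h atom G Gb])
  then show ?case by (rule Suc.IH[folded G_def])
qed

context positive_levy
begin

text \<open>A compound Poisson distribution is a convolution power of one with so small a rate that it
  has more than half of its mass at 0.\<close>

lemma deconvolution_m:
  assumes g: "g \<in> borel_measurable borel" "\<And>x. \<bar>g x\<bar> \<le> (S::real)"
    and lim: "((\<lambda>x. \<integral>y. g (x - y) \<partial>m) \<longlongrightarrow> 0) at_top"
  shows "(g \<longlongrightarrow> 0) at_top"
proof -
  define l where "l = measure R UNIV"
  define F where "F = mass_normalized R"
  have F: "real_distribution F" unfolding F_def by (rule real_distribution_mass_normalized)
  have l: "0 < l" using mass_pos by (simp add: l_def)
  obtain n where n: "2 * l < real n" using reals_Archimedean2 by blast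
  have n0: "0 < real n" using n l by linarith
  define h where "h = poisson_mixture (l / real n) F"
  have ln: "0 < l / real n" using l n0 by simp
  have h: "real_distribution h" unfolding h_def by (rule real_distribution_poisson_mixture[OF F])
  interpret h: real_distribution h by fact
  have "m = poisson_mixture l F" using l by (simp add: cpois_def F_def l_def)
  also have "\<dots> = conv_pow h n"
  proof (rule Levy_uniqueness[OF real_distribution_poisson_mixture[OF F] real_distribution_conv_pow[OF h]])
    show "char (poisson_mixture l F) = char (conv_pow h n)"
    proof
      fix t
      have "char (conv_pow h n) t = exp (of_real (l / real n) * (char F t - 1)) ^ n"
        unfolding char_conv_pow[OF h] unfolding h_def char_poisson_mixture[OF F ln] ..
      also have "\<dots> = exp (of_nat n * (of_real (l / real n) * (char F t - 1)))"
        by (rule exp_of_nat_mult[symmetric])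
      also have "of_nat n * (of_real (l / real n) * (char F t - 1)) = of_real l * (char F t - 1)"
        using n0 by simp
      finally show "char (poisson_mixture l F) t = char (conv_pow h n) t"
        by (simp only: char_poisson_mixture[OF F l])
    qed
  qed
  finally have m: "m = conv_pow h n" .
  have "l / real n < 1 / 2" using n n0 by (simp add: field_simps)
  then have "1 / 2 < exp (- (l / real n))" using exp_ge_add_one_self[of "- (l / real n)"] by linarith
  also have "\<dots> \<le> measure h {0}" unfolding h_def by (rule poisson_mixture_atom[OF F ln])
  finally show ?thesis
    using deconvolution_conv_pow[OF h _ g] lim unfolding m by blast
qed

lemma lm_part_ratio:
  assumes "long_tailed lm"
  shows "((\<lambda>x. sum_mass c R m (\<lambda>y _. y \<in> {0..B}) x / lm x) \<longlongrightarrow> measure R {0..B}) at_top"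
  by (rule sum_mass_ratio_compact[OF R_fin m_fin c_pos assms, where B = B]) auto

text \<open>Divide the estimate \<open>m (x) \<approx> \<integral>\<^sub>z\<^sub>\<le>\<^sub>B m(dz) R (x - z)\<close> by \<open>m (x)\<close>. Since \<open>m\<close> is long-tailed, the denominator
  may be replaced by \<open>m (x - z)\<close> inside the integral; so the convolution of \<open>m\<close> with the bounded function
  \<open>q = R (\<cdot>) / m (\<cdot>)\<close> tends to 1, and deconvolution yields the limit of \<open>q\<close> itself.\<close>

lemma r_asymp_lm:
  assumes lt: "long_tailed lm" and neg: "negligible_pairs c m m lm"
  shows "r \<sim>[at_top] lm"
proof -
  note pos = long_tailed_pos[OF lt]
  have r_le': "r x \<le> 1 / k * lm x" for x using r_le[of x] k by (simp add: field_simps)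
  have neg': "negligible_pairs c R m lm"
  proof (rule negligible_pairs_transfer[OF c_pos m_fin R_fin m_fin neg, where K = "1 / k" and T = 0])
    show "lm x \<le> 1 / k * lm x" for x using k mult_right_mono[of 1 "1 / k" "lm x"] by simp
  qed (use k r_le' in auto)
  note [measurable] = borel_measurable_local_mass[OF c_pos] m.borel_measurable_local_mass[OF c_pos]
  define q where "q x = r x / lm x" for x
  have q: "0 \<le> q x" "q x \<le> 1 / k" for x
    using r_le'[of x] k by (cases "lm x = 0"; simp add: q_def divide_le_eq less_le)+
  have qm: "q \<in> borel_measurable borel" unfolding q_def by measurable
  note [measurable] = qm
  have intq: "integrable m (\<lambda>y. q (x - y) * indicator A y)" if [measurable]: "A \<in> sets borel" for x A
    using q k by (intro m.integrable_const_bound[where B = "1 / k"] AE_I2) (auto simp: indicator_def)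
  have lim: "((\<lambda>x. (\<integral>y. q (x - y) \<partial>m) - 1) \<longlongrightarrow> 0) at_top"
  proof (rule tendstoI)
    fix e0 :: real assume e0: "0 < e0"
    \<comment> \<open>the truncation, the replaced denominator and the estimate cost at most \<open>4 * e\<close> in total\<close>
    define e where "e = e0 / 8"
    have e: "0 < e" using e0 by (simp add: e_def)
    have "0 < e * k" using e k by simp
    obtain B0 where B0: "0 < B0" "\<And>B. B0 \<le> B \<Longrightarrow> 1 - e * k < measure m {0..B}"
      using ex_m_interval[OF \<open>0 < e * k\<close>] by blast
    obtain B1 where B1: "\<And>B. B1 \<le> B \<Longrightarrow>
        \<forall>\<^sub>F x in at_top. sum_mass c R m (\<lambda>y z. B < y \<and> B < z) x \<le> e * lm x"
      using neg' e unfolding negligible_pairs_def by meson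
    define B where "B = max B0 B1"
    have B: "0 < B" using B0 by (simp add: B_def)
    let ?P = "\<lambda>x. sum_mass c R m (\<lambda>_ z. z \<in> {0..B}) x"
    let ?Q = "\<lambda>x. sum_mass c R m (\<lambda>y _. y \<in> {0..B}) x"
    obtain D where D: "1 \<le> D" "\<forall>\<^sub>F x in at_top. \<forall>y\<in>{-B..B}. lm (x - y) \<le> D * lm x"
      by (rule m.long_tailed_compact_bound[OF c_pos lt])
    have diff: "((\<lambda>x. ?P x / lm x - (\<integral>y. q (x - y) * indicator {0..B} y \<partial>m)) \<longlongrightarrow> 0) at_top"
    proof -
      have "((\<lambda>x. \<integral>y. q (x - y) * (lm (x - y) / lm x - 1) * indicator {0..B} y \<partial>m) \<longlongrightarrow> (\<integral>y. 0 \<partial>m)) at_top"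
      proof (rule integral_dominated_convergence_at_top[where w = "\<lambda>_. 1 / k * (D + 1)"])
        show "\<forall>\<^sub>F x in at_top. AE y in m. norm (q (x - y) * (lm (x - y) / lm x - 1) * indicator {0..B} y) \<le> 1 / k * (D + 1)"
          using D(2) pos
        proof eventually_elim
          case (elim x)
          show ?case
          proof (rule AE_I2)
            fix y
            show "norm (q (x - y) * (lm (x - y) / lm x - 1) * indicator {0..B} y) \<le> 1 / k * (D + 1)"
            proof (cases "y \<in> {0..B}")
              case True
              then have "0 \<le> lm (x - y) / lm x" "lm (x - y) / lm x \<le> D"
                using elim by (auto simp: pos_divide_le_eq)
              then have "\<bar>lm (x - y) / lm x - 1\<bar> \<le> D + 1" using D by linarith
              then have "\<bar>q (x - y)\<bar> * \<bar>lm (x - y) / lm x - 1\<bar> \<le> 1 / k * (D + 1)"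
                using q[of "x - y"] k by (intro mult_mono) auto
              then show ?thesis using True by (simp add: abs_mult)
            qed (use k D in auto)
          qed
        qed
        show "AE y in m. ((\<lambda>x. q (x - y) * (lm (x - y) / lm x - 1) * indicator {0..B} y) \<longlongrightarrow> 0) at_top"
        proof (rule AE_I2)
          fix y
          have "((\<lambda>x. lm (x + - y) / lm x - 1) \<longlongrightarrow> 1 - 1) at_top"
            by (intro tendsto_diff long_tailed_shift[OF lt] tendsto_const)
          then have "((\<lambda>x. lm (x - y) / lm x - 1) \<longlongrightarrow> 0) at_top" by simp
          then have z: "((\<lambda>x. 1 / k * \<bar>lm (x - y) / lm x - 1\<bar>) \<longlongrightarrow> 0) at_top"
            by (intro tendsto_mult_right_zero tendsto_rabs_zero)
          have "((\<lambda>x. q (x - y) * (lm (x - y) / lm x - 1)) \<longlongrightarrow> 0) at_top"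
          proof (rule tendsto_0_le[OF z, where K = 1], rule always_eventually, rule allI)
            fix x
            have "\<bar>q (x - y)\<bar> * \<bar>lm (x - y) / lm x - 1\<bar> \<le> 1 / k * \<bar>lm (x - y) / lm x - 1\<bar>"
              using q[of "x - y"] by (intro mult_right_mono) auto
            then show "norm (q (x - y) * (lm (x - y) / lm x - 1)) \<le> norm (1 / k * \<bar>lm (x - y) / lm x - 1\<bar>) * 1"
              using k by (simp add: abs_mult)
          qed
          then show "((\<lambda>x. q (x - y) * (lm (x - y) / lm x - 1) * indicator {0..B} y) \<longlongrightarrow> 0) at_top"
            by (rule tendsto_mult_left_zero)
        qed
      qed auto
      moreover have "\<forall>\<^sub>F x in at_top. (\<integral>y. q (x - y) * (lm (x - y) / lm x - 1) * indicator {0..B} y \<partial>m) =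
          ?P x / lm x - (\<integral>y. q (x - y) * indicator {0..B} y \<partial>m)"
      proof -
        obtain x0 where x0: "\<And>x. x0 \<le> x \<Longrightarrow> 0 < lm x" using pos by (auto simp: eventually_at_top_linorder)
        show ?thesis
          using eventually_ge_at_top[of "x0 + B"]
        proof eventually_elim
          case (elim x)
          have "?P x / lm x = (\<integral>y. indicator {0..B} y * r (x - y) / lm x \<partial>m)"
            unfolding bounded_R_part_swap by (subst sum_mass_eq_integral[OF m_fin R_fin c_pos]) auto
          then have "?P x / lm x - (\<integral>y. q (x - y) * indicator {0..B} y \<partial>m) =
              (\<integral>y. indicator {0..B} y * r (x - y) / lm x - q (x - y) * indicator {0..B} y \<partial>m)"
            using integrable_local_mass[OF m_fin R_fin c_pos, of "{0..B}" x] intq[of "{0..B}" x]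
            by (subst Bochner_Integration.integral_diff) auto
          also have "\<dots> = (\<integral>y. q (x - y) * (lm (x - y) / lm x - 1) * indicator {0..B} y \<partial>m)"
          proof (rule Bochner_Integration.integral_cong[OF refl])
            fix y
            show "indicator {0..B} y * r (x - y) / lm x - q (x - y) * indicator {0..B} y =
                q (x - y) * (lm (x - y) / lm x - 1) * indicator {0..B} y"
              using x0[of "x - y"] elim by (cases "y \<in> {0..B}") (auto simp: q_def right_diff_distrib)
          qed
          finally show ?case by simp
        qed
      qed
      ultimately show ?thesis using Lim_transform_eventually by fastforce
    qed
    have "\<forall>\<^sub>F x in at_top. \<bar>?P x / lm x - (\<integral>y. q (x - y) * indicator {0..B} y \<partial>m)\<bar> < e"
      using tendstoD[OF diff e] by simp
    moreover have "\<forall>\<^sub>F x in at_top. ?P x / lm x < 1 + e"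
    proof -
      have "\<forall>\<^sub>F x in at_top. (x + c) / (x - B) < 1 + e"
        using e by (intro order_tendstoD(2)[OF quotients_tendsto(4)]) auto
      then show ?thesis using pos eventually_gt_at_top[of B]
      proof eventually_elim
        case (elim x)
        have "(x - B) * ?P x + k * x / 2 * sum_mass c R R (\<lambda>y z. B < y \<and> B < z) x \<le> (x + c) * lm x"
          using elim B by (intro lm_lower) auto
        moreover have "0 \<le> k * x / 2 * sum_mass c R R (\<lambda>y z. B < y \<and> B < z) x" using k elim B by simp
        ultimately have "(x - B) * ?P x \<le> (x + c) * lm x" by linarith
        then have "((x - B) * ?P x) / ((x - B) * lm x) \<le> ((x + c) * lm x) / ((x - B) * lm x)"
          using elim by (intro divide_right_mono) auto
        then have "?P x / lm x \<le> (x + c) / (x - B)" using elim by simp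
        with elim show ?case by linarith
      qed
    qed
    moreover have "\<forall>\<^sub>F x in at_top. 1 - 2 * e < ?P x / lm x"
    proof -
      have "((\<lambda>x. (1 - B / x * (?Q x / lm x) - (x + c) / x * e) / ((x + c) / x))
          \<longlongrightarrow> (1 - 0 * measure R {0..B} - 1 * e) / 1) at_top"
        by (intro tendsto_divide tendsto_diff tendsto_mult tendsto_const quotients_tendsto lm_part_ratio[OF lt]) simp
      then have "\<forall>\<^sub>F x in at_top. 1 - 2 * e < (1 - B / x * (?Q x / lm x) - (x + c) / x * e) / ((x + c) / x)"
        using e by (intro order_tendstoD(1)) auto
      moreover have "\<forall>\<^sub>F x in at_top. sum_mass c R m (\<lambda>y z. B < y \<and> B < z) x \<le> e * lm x"
        by (rule B1) (simp add: B_def)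
      ultimately show ?thesis using pos eventually_gt_at_top[of 0]
      proof eventually_elim
        case (elim x)
        have "x * lm x \<le> (x + c) * ?P x + B * ?Q x + (x + c) * sum_mass c R m (\<lambda>y z. B < y \<and> B < z) x"
          using elim B by (intro lm_upper) auto
        also have "\<dots> \<le> (x + c) * ?P x + B * ?Q x + (x + c) * (e * lm x)"
          using elim c_pos by (intro add_left_mono mult_left_mono) auto
        finally have le: "x * lm x \<le> (x + c) * ?P x + B * ?Q x + (x + c) * (e * lm x)" .
        define u v p w where "u = (x + c) / x" and "v = B / x" and "p = ?P x / lm x" and "w = ?Q x / lm x"
        have nz: "x \<noteq> 0" "lm x \<noteq> 0" using elim by auto
        have eqs: "x + c = x * u" "B = x * v" "?P x = p * lm x" "?Q x = w * lm x"
          using nz by (simp_all add: u_def v_def p_def w_def)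
        have "(x + c) * ?P x + B * ?Q x + (x + c) * (e * lm x) =
            x * u * (p * lm x) + x * v * (w * lm x) + x * u * (e * lm x)"
          by (rule arg_cong2[where f = "(+)"] arg_cong2[where f = "(*)"] eqs refl)+
        also have "\<dots> = (x * lm x) * (u * p + v * w + u * e)" by (simp add: algebra_simps)
        finally have "(x * lm x) * 1 \<le> (x * lm x) * (u * p + v * w + u * e)" using le by simp
        moreover have "0 < x * lm x" using elim by simp
        ultimately have "1 \<le> u * p + v * w + u * e" by (simp only: mult_le_cancel_left_pos)
        moreover have u: "0 < u" using elim c_pos by (simp add: u_def)
        ultimately have "(1 - v * w - u * e) / u \<le> p" by (simp add: pos_divide_le_eq mult.commute)
        moreover have "1 - 2 * e < (1 - v * w - u * e) / u" using elim by (simp only: u_def v_def w_def)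
        ultimately show ?case unfolding p_def by linarith
      qed
    qed
    ultimately have ev: "\<forall>\<^sub>F x in at_top. \<bar>?P x / lm x - (\<integral>y. q (x - y) * indicator {0..B} y \<partial>m)\<bar> < e
        \<and> ?P x / lm x < 1 + e \<and> 1 - 2 * e < ?P x / lm x"
      by eventually_elim simp
    have tail: "\<bar>(\<integral>y. q (x - y) \<partial>m) - (\<integral>y. q (x - y) * indicator {0..B} y \<partial>m)\<bar> \<le> e" for x
    proof -
      have "(\<integral>y. q (x - y) \<partial>m) = (\<integral>y. q (x - y) * indicator {0..B} y + q (x - y) * indicator (- {0..B}) y \<partial>m)"
        by (intro Bochner_Integration.integral_cong) (auto simp: indicator_def)
      also have "\<dots> = (\<integral>y. q (x - y) * indicator {0..B} y \<partial>m) + (\<integral>y. q (x - y) * indicator (- {0..B}) y \<partial>m)"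
        by (intro Bochner_Integration.integral_add intq) auto
      finally have eq: "(\<integral>y. q (x - y) \<partial>m) - (\<integral>y. q (x - y) * indicator {0..B} y \<partial>m) =
          (\<integral>y. q (x - y) * indicator (- {0..B}) y \<partial>m)" by simp
      have "(\<integral>y. q (x - y) * indicator (- {0..B}) y \<partial>m) \<le> (\<integral>y. 1 / k * indicator (- {0..B}) y \<partial>m)"
        using q by (intro integral_mono intq integrable_mult_right integrable_real_indicator)
          (auto simp: indicator_def m.emeasure_eq_measure)
      also have "\<dots> = 1 / k * (1 - measure m {0..B})"
        using m.prob_compl[of "{0..B}"] by (simp add: Compl_eq_Diff_UNIV)
      also have "\<dots> \<le> 1 / k * (e * k)"
        using B0(2)[of B] k by (intro mult_left_mono) (auto simp: B_def)
      also have "\<dots> = e" using k by simp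
      finally have "(\<integral>y. q (x - y) * indicator (- {0..B}) y \<partial>m) \<le> e" .
      moreover have "0 \<le> (\<integral>y. q (x - y) * indicator (- {0..B}) y \<partial>m)"
        using q by (intro Bochner_Integration.integral_nonneg) auto
      ultimately show ?thesis unfolding eq by simp
    qed
    show "\<forall>\<^sub>F x in at_top. dist ((\<integral>y. q (x - y) \<partial>m) - 1) 0 < e0"
      using ev
    proof eventually_elim
      case (elim x)
      have "e0 = 8 * e" by (simp add: e_def)
      then have "\<bar>(\<integral>y. q (x - y) \<partial>m) - 1\<bar> < e0" using elim tail[of x] e by linarith
      then show ?case by (simp add: dist_real_def)
    qed
  qed
  have "((\<lambda>x. q x - 1) \<longlongrightarrow> 0) at_top"
  proof (rule deconvolution_m)
    show "(\<lambda>x. q x - 1) \<in> borel_measurable borel" by measurable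
    show "\<bar>q x - 1\<bar> \<le> 1 / k + 1" for x using q[of x] k by (simp add: abs_le_iff)
    have "(\<integral>y. q (x - y) - 1 \<partial>m) = (\<integral>y. q (x - y) \<partial>m) - 1" for x
      using intq[of UNIV x] m.prob_space by simp
    then show "((\<lambda>x. \<integral>y. q (x - y) - 1 \<partial>m) \<longlongrightarrow> 0) at_top" using lim by simp
  qed
  then have "(q \<longlongrightarrow> 1) at_top" using Lim_null by blast
  then show ?thesis unfolding q_def using asymp_equiv_iff_quotient[OF pos] by simp
qed

end

section \<open>The light-tailed component of an infinitely divisible distribution\<close>

definition levy_integrand :: "real \<Rightarrow> real \<Rightarrow> complex" where
  "levy_integrand z y = iexp (z * y) - 1 - \<i> * of_real (z * y * indicator {y. \<bar>y\<bar> \<le> 1} y)"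

lemma levy_integrand_measurable [measurable]: "levy_integrand z \<in> borel_measurable borel"
  unfolding levy_integrand_def by measurable

lemma norm_levy_integrand_le: "norm (levy_integrand z y) \<le> (2 + z\<^sup>2) * min 1 (y\<^sup>2)"
proof (cases "\<bar>y\<bar> \<le> 1")
  case True
  have "norm (iexp (z * y) - (\<Sum>k\<le>1. (\<i> * of_real (z * y)) ^ k / fact k)) \<le> \<bar>z * y\<bar> ^ Suc 1 / fact (Suc 1)"
    by (rule iexp_approx1)
  then have "norm (levy_integrand z y) \<le> (z * y)\<^sup>2 / 2"
    using True by (simp add: levy_integrand_def diff_diff_eq power2_eq_square abs_mult[symmetric])
  also have "\<dots> \<le> (2 + z\<^sup>2) * y\<^sup>2" by (simp add: power_mult_distrib algebra_simps)
  also have "y\<^sup>2 = min 1 (y\<^sup>2)" using True abs_square_le_1[of y] by (simp add: min_def)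
  finally show ?thesis .
next
  case False
  have "norm (levy_integrand z y) \<le> norm (iexp (z * y)) + norm (1 :: complex)"
    using False norm_triangle_ineq4[of "iexp (z * y)" 1] by (simp add: levy_integrand_def)
  also have "\<dots> \<le> (2 + z\<^sup>2)" by simp
  also have "\<dots> = (2 + z\<^sup>2) * min 1 (y\<^sup>2)" using False abs_square_le_1[of y] by (simp add: min_def)
  finally show ?thesis .
qed

text \<open>For negative \<open>t\<close> use \<open>e\<^sup>t \<le> 1 / (1 - t)\<close>.\<close>

lemma exp_minus_linear_le:
  fixes t :: real
  assumes "\<bar>t\<bar> \<le> 1"
  shows "exp t - 1 - t \<le> t\<^sup>2"
proof (cases "0 \<le> t")
  case True
  then show ?thesis using exp_bound[of t] assms by simp
next
  case False
  have "exp t * exp (- t) = 1" by (simp flip: exp_add)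
  moreover have "1 - t \<le> exp (- t)" using exp_ge_add_one_self[of "- t"] by simp
  ultimately have "exp t * (1 - t) \<le> 1"
    using mult_left_mono[of "1 - t" "exp (- t)" "exp t"] by simp
  also have "1 \<le> (1 + t + t\<^sup>2) * (1 - t)"
  proof -
    have "t * t\<^sup>2 \<le> 0" using False by (simp add: mult_nonpos_nonneg)
    moreover have "(1 + t + t\<^sup>2) * (1 - t) = 1 - t * t\<^sup>2" by (simp add: algebra_simps power2_eq_square)
    ultimately show ?thesis by linarith
  qed
  finally have "exp t * (1 - t) \<le> (1 + t + t\<^sup>2) * (1 - t)" .
  then have "exp t \<le> 1 + t + t\<^sup>2" by (rule mult_right_le_imp_le) (use False in auto)
  then show ?thesis by simp
qed

lemma integral_density_indicator:
  fixes f :: "real \<Rightarrow> 'a :: {banach, second_countable_topology}"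
  assumes s: "sets \<nu> = sets borel" and [measurable]: "A \<in> sets borel" "f \<in> borel_measurable borel"
  shows "(\<integral>y. f y \<partial>density \<nu> (indicator A)) = (\<integral>y. indicator A y *\<^sub>R f y \<partial>\<nu>)"
proof -
  note [measurable_cong] = s
  have "(\<integral>y. f y \<partial>density \<nu> (\<lambda>y. ennreal (indicator A y))) = (\<integral>y. indicator A y *\<^sub>R f y \<partial>\<nu>)"
    by (rule integral_density) auto
  then show ?thesis by (simp add: ennreal_indicator)
qed

lemma levy_measure_integrable_min:
  assumes "levy_measure \<nu>"
  shows "integrable \<nu> (\<lambda>y. min 1 (y\<^sup>2))"
proof -
  have [measurable_cong]: "sets \<nu> = sets borel" using assms by (simp add: levy_measure_def)
  show ?thesis
    using assms by (intro integrableI_bounded) (auto simp: levy_measure_def abs_of_nonneg)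
qed

lemma levy_measure_integrable_bound:
  fixes f :: "real \<Rightarrow> 'a :: {banach, second_countable_topology}"
  assumes "levy_measure \<nu>" and f: "f \<in> borel_measurable borel" "\<And>y. norm (f y) \<le> C * min 1 (y\<^sup>2)"
  shows "integrable \<nu> f"
proof (rule Bochner_Integration.integrable_bound)
  show "integrable \<nu> (\<lambda>y. C * min 1 (y\<^sup>2))"
    by (rule integrable_mult_right[OF levy_measure_integrable_min[OF assms(1)]])
  have s: "sets \<nu> = sets borel" using assms by (simp add: levy_measure_def)
  show "f \<in> borel_measurable \<nu>" using f(1) by (simp add: measurable_cong_sets[OF s refl])
  show "AE y in \<nu>. norm (f y) \<le> norm (C * min 1 (y\<^sup>2))"
  proof (rule AE_I2)
    fix y
    show "norm (f y) \<le> norm (C * min 1 (y\<^sup>2))"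
      using f(2)[of y] abs_ge_self[of "C * min 1 (y\<^sup>2)"] unfolding real_norm_def by linarith
  qed
qed

lemma levy_measure_density_finite:
  assumes nu: "levy_measure \<nu>" and A: "A \<in> sets borel" "\<And>y. y \<in> A \<Longrightarrow> d \<le> \<bar>y\<bar>" and d: "0 < d" "d \<le> 1"
  shows "finite_borel_measure (density \<nu> (indicator A))"
proof -
  have s [measurable_cong]: "sets \<nu> = sets borel" using nu by (simp add: levy_measure_def)
  note [measurable] = A(1)
  have ge: "d\<^sup>2 \<le> min 1 (y\<^sup>2)" if "y \<in> A" for y
    using A(2)[OF that] d power_mono[of d "\<bar>y\<bar>" 2] power_le_one[of d 2] by auto
  have "integrable \<nu> (indicat_real A)"
  proof (rule levy_measure_integrable_bound[OF nu, where C = "1 / d\<^sup>2"])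
    show "norm (indicat_real A y) \<le> 1 / d\<^sup>2 * min 1 (y\<^sup>2)" for y
      using ge[of y] d by (auto simp: indicator_def field_simps)
  qed measurable
  then have "emeasure \<nu> A < \<infinity>" using A s by (simp add: integrable_indicator_iff)
  then have "finite_measure (density \<nu> (indicator A))"
    using A s by (intro finite_measureI) (auto simp: emeasure_density top.not_eq_extremum)
  then show ?thesis
    by (auto simp: finite_borel_measure_def finite_borel_measure_axioms_def s)
qed

lemma char_affine_normal:
  "char (distr std_normal_distribution borel (\<lambda>x. a + b * x)) t =
    exp (\<i> * of_real (a * t) - of_real (b\<^sup>2 * t\<^sup>2 / 2))"
proof -
  have "char (distr std_normal_distribution borel (\<lambda>x. a + b * x)) t =
      (\<integral>x. iexp (t * (a + b * x)) \<partial>std_normal_distribution)"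
    unfolding char_def by (rule integral_distr) auto
  also have "(\<lambda>x. iexp (t * (a + b * x))) = (\<lambda>x. iexp (a * t) * iexp ((b * t) * x))"
    by (rule ext) (simp add: distrib_left exp_add mult_ac)
  also have "(\<integral>x. iexp (a * t) * iexp ((b * t) * x) \<partial>std_normal_distribution) = iexp (a * t) * char std_normal_distribution (b * t)"
    unfolding char_def by (rule integral_mult_right_zero)
  also have "\<dots> = exp (\<i> * of_real (a * t) - of_real (b\<^sup>2 * t\<^sup>2 / 2))"
  proof -
    have "of_real (exp (- ((b * t)\<^sup>2) / 2)) = exp (- (of_real (b\<^sup>2 * t\<^sup>2 / 2) :: complex))"
    proof -
      have "of_real (exp (- ((b * t)\<^sup>2) / 2)) = exp (of_real (- ((b * t)\<^sup>2) / 2) :: complex)"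
        by (rule exp_of_real[symmetric])
      also have "of_real (- ((b * t)\<^sup>2) / 2) = - (of_real (b\<^sup>2 * t\<^sup>2 / 2) :: complex)"
        by (simp add: power_mult_distrib)
      finally show ?thesis .
    qed
    then show ?thesis
      unfolding char_std_normal_distribution by (simp only: diff_conv_add_uminus exp_add)
  qed
  finally show ?thesis .
qed

lemma nn_integral_exp_std_normal:
  "(\<integral>\<^sup>+x. ennreal (exp (b * x)) \<partial>std_normal_distribution) = ennreal (exp (b\<^sup>2 / 2))"
proof -
  have "(\<integral>\<^sup>+x. ennreal (exp (b * x)) \<partial>std_normal_distribution) =
      (\<integral>\<^sup>+x. ennreal (std_normal_density x * exp (b * x)) \<partial>lborel)"
    by (subst nn_integral_density) (auto simp: ennreal_mult normal_density_nonneg)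
  also have "(\<lambda>x. std_normal_density x * exp (b * x)) = (\<lambda>x. exp (b\<^sup>2 / 2) * normal_density b 1 x)"
  proof
    fix x
    have "- x\<^sup>2 / 2 + b * x = b\<^sup>2 / 2 + - (x - b)\<^sup>2 / 2"
      by (simp add: power2_eq_square field_simps)
    then have "exp (- x\<^sup>2 / 2) * exp (b * x) = exp (b\<^sup>2 / 2) * exp (- (x - b)\<^sup>2 / 2)"
      by (simp only: exp_add[symmetric])
    then show "std_normal_density x * exp (b * x) = exp (b\<^sup>2 / 2) * normal_density b 1 x"
      by (simp add: normal_density_def)
  qed
  also have "(\<integral>\<^sup>+x. ennreal (exp (b\<^sup>2 / 2) * normal_density b 1 x) \<partial>lborel) =
      ennreal (exp (b\<^sup>2 / 2)) * (\<integral>\<^sup>+x. ennreal (normal_density b 1 x) \<partial>lborel)"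
    by (subst nn_integral_cmult[symmetric]) (auto simp: ennreal_mult normal_density_nonneg)
  also have "(\<integral>\<^sup>+x. ennreal (normal_density b 1 x) \<partial>lborel) = 1"
    using prob_space.emeasure_space_1[OF prob_space_normal_density[of 1 b]]
    by (simp add: emeasure_density)
  finally show ?thesis by simp
qed

lemma nn_integral_exp_convolution:
  assumes "real_distribution F" "real_distribution G"
  shows "(\<integral>\<^sup>+x. ennreal (exp (s * x)) \<partial>(F \<star> G)) =
    (\<integral>\<^sup>+x. ennreal (exp (s * x)) \<partial>F) * (\<integral>\<^sup>+x. ennreal (exp (s * x)) \<partial>G)"
proof -
  interpret F: real_distribution F by fact
  interpret G: real_distribution G by fact
  have "(\<integral>\<^sup>+x. ennreal (exp (s * x)) \<partial>(F \<star> G)) = (\<integral>\<^sup>+y. \<integral>\<^sup>+z. ennreal (exp (s * (y + z))) \<partial>G \<partial>F)"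
    by (rule nn_integral_convolution)
      (simp_all add: F.finite_measure_axioms G.finite_measure_axioms)
  also have "\<dots> = (\<integral>\<^sup>+y. \<integral>\<^sup>+z. ennreal (exp (s * y)) * ennreal (exp (s * z)) \<partial>G \<partial>F)"
    by (simp add: distrib_left exp_add ennreal_mult)
  also have "\<dots> = (\<integral>\<^sup>+y. ennreal (exp (s * y)) * (\<integral>\<^sup>+z. ennreal (exp (s * z)) \<partial>G) \<partial>F)"
    by (intro nn_integral_cong nn_integral_cmult) simp
  also have "\<dots> = (\<integral>\<^sup>+x. ennreal (exp (s * x)) \<partial>F) * (\<integral>\<^sup>+x. ennreal (exp (s * x)) \<partial>G)"
    by (rule nn_integral_multc) simp
  finally show ?thesis .
qed

lemma tight_if_exp_moments:
  assumes M: "\<And>n. real_distribution (M n)" and C: "0 \<le> C"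
    and mom: "\<And>n. (\<integral>\<^sup>+x. ennreal (exp x) \<partial>M n) \<le> ennreal C" "\<And>n. (\<integral>\<^sup>+x. ennreal (exp (- x)) \<partial>M n) \<le> ennreal C"
  shows "tight M"
  unfolding tight_def
proof (intro conjI allI impI)
  fix e :: real assume e: "0 < e"
  define A where "A = \<bar>ln (2 * C / e + 1)\<bar> + 1"
  have "2 * C / e + 1 \<le> exp A"
  proof -
    have "2 * C / e + 1 = exp (ln (2 * C / e + 1))" using C e by (simp add: add_nonneg_pos)
    also have "\<dots> \<le> exp A" by (simp add: A_def)
    finally show ?thesis .
  qed
  then have A: "2 * C < e * exp A" using e C by (simp add: field_simps)
  show "\<exists>a b. a < b \<and> (\<forall>n. 1 - e < measure (M n) {a<..b})"
  proof (intro exI conjI allI)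
    show "- A < A" by (simp add: A_def)
    fix n
    interpret real_distribution "M n" by (rule M)
    have "ennreal (exp A) * emeasure (M n) (UNIV - {-A<..A}) =
        (\<integral>\<^sup>+x. ennreal (exp A) * indicator (UNIV - {-A<..A}) x \<partial>M n)"
      by (rule nn_integral_cmult_indicator[symmetric]) simp
    also have "\<dots> \<le> (\<integral>\<^sup>+x. ennreal (exp x) + ennreal (exp (- x)) \<partial>M n)"
    proof (rule nn_integral_mono)
      fix x
      have "exp A \<le> exp x + exp (- x)" if "x \<notin> {-A<..A}"
      proof (cases "A < x")
        case True
        then have "exp A \<le> exp x" by simp
        then show ?thesis using exp_gt_zero[of "- x"] by linarith
      next
        case False
        then have "exp A \<le> exp (- x)" using that by simp
        then show ?thesis using exp_gt_zero[of x] by linarith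
      qed
      then show "ennreal (exp A) * indicator (UNIV - {-A<..A}) x \<le> ennreal (exp x) + ennreal (exp (- x))"
        by (auto simp: indicator_def simp flip: ennreal_plus intro!: ennreal_leI)
    qed
    also have "\<dots> = (\<integral>\<^sup>+x. ennreal (exp x) \<partial>M n) + (\<integral>\<^sup>+x. ennreal (exp (- x)) \<partial>M n)"
      by (rule nn_integral_add) auto
    also have "\<dots> \<le> ennreal C + ennreal C" by (intro add_mono mom)
    finally have "ennreal (exp A * measure (M n) (UNIV - {-A<..A})) \<le> ennreal (2 * C)"
      using C by (simp add: emeasure_eq_measure ennreal_mult flip: ennreal_plus)
    then have "exp A * measure (M n) (UNIV - {-A<..A}) \<le> 2 * C"
      using C by (subst (asm) ennreal_le_iff) auto
    also have "\<dots> < e * exp A" by (rule A)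
    finally have "exp A * measure (M n) (UNIV - {-A<..A}) < exp A * e" by (simp only: mult.commute)
    then have "measure (M n) (UNIV - {-A<..A}) < e" by (simp only: mult_less_cancel_left_pos exp_gt_zero)
    then show "1 - e < measure (M n) {-A<..A}" using prob_compl[of "{-A<..A}"] by simp
  qed
qed (rule M)

text \<open>Weak convergence applies to the truncated exponential function, and monotone convergence removes the
  truncation.\<close>

lemma weak_limit_integrable_exp:
  assumes M: "\<And>n. real_distribution (M n)" and L: "real_distribution L" and w: "weak_conv_m M L"
    and C: "0 \<le> C" and mom: "\<And>n. (\<integral>\<^sup>+x. ennreal (exp x) \<partial>M n) \<le> ennreal C"
  shows "integrable L exp"
proof -
  interpret L: real_distribution L by fact
  have trunc: "(\<integral>\<^sup>+x. ennreal (min (exp x) (real k)) \<partial>L) \<le> ennreal C" for k :: nat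
  proof -
    have lim: "(\<lambda>n. \<integral>x. min (exp x) (real k) \<partial>M n) \<longlonglongrightarrow> (\<integral>x. min (exp x) (real k) \<partial>L)"
      using M L w
      by (rule weak_conv_imp_integral_bdd_continuous_conv[where B = "real k"])
        (auto intro!: continuous_min isCont_exp continuous_const simp: abs_le_iff min_le_iff_disj)
    have int: "integrable N (\<lambda>x. min (exp x) (real k))" if "real_distribution N" for N
    proof -
      interpret N: real_distribution N by fact
      show ?thesis by (rule N.integrable_const_bound[where B = "real k"]) auto
    qed
    have "(\<integral>x. min (exp x) (real k) \<partial>M n) \<le> C" for n
    proof -
      have "ennreal (\<integral>x. min (exp x) (real k) \<partial>M n) = (\<integral>\<^sup>+x. ennreal (min (exp x) (real k)) \<partial>M n)"
        by (rule nn_integral_eq_integral[symmetric]) (auto intro: int M)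
      also have "\<dots> \<le> (\<integral>\<^sup>+x. ennreal (exp x) \<partial>M n)" by (intro nn_integral_mono ennreal_leI) simp
      also note mom
      finally show ?thesis using C by (simp add: ennreal_le_iff)
    qed
    then have "(\<integral>x. min (exp x) (real k) \<partial>L) \<le> C" by (intro LIMSEQ_le_const2[OF lim]) auto
    then show ?thesis
      by (subst nn_integral_eq_integral) (auto intro!: int L ennreal_leI)
  qed
  have "(\<lambda>k. \<integral>\<^sup>+x. ennreal (min (exp x) (real k)) \<partial>L) \<longlonglongrightarrow> (\<integral>\<^sup>+x. ennreal (exp x) \<partial>L)"
  proof (rule nn_integral_LIMSEQ)
    show "incseq (\<lambda>k x. ennreal (min (exp x) (real k)))"
      by (auto simp: incseq_def le_fun_def intro!: ennreal_leI min.mono)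
    show "(\<lambda>k. ennreal (min (exp x) (real k))) \<longlonglongrightarrow> ennreal (exp x)" for x :: real
    proof (rule tendsto_eventually)
      obtain N where "exp x \<le> real N" using real_arch_simple by blast
      then have "\<forall>k\<ge>N. min (exp x) (real k) = exp x" by auto
      then show "\<forall>\<^sub>F k in sequentially. ennreal (min (exp x) (real k)) = ennreal (exp x)"
        by (auto simp: eventually_sequentially)
    qed
  qed auto
  then have "(\<integral>\<^sup>+x. ennreal (exp x) \<partial>L) \<le> ennreal C"
    by (rule LIMSEQ_le_const2) (use trunc in auto)
  then show ?thesis
    by (intro integrableI_bounded) (auto simp: le_less_trans[OF _ ennreal_less_top])
qed


text \<open>The component with jumps of size at most \<open>K\<close> is a weak limit of compound Poisson
  distributions with jumps larger than \<open>1 / n\<close>, recentred and convolved with a normal one. As the jumps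
  are bounded, exponential moments of both signs are bounded in \<open>n\<close>; they provide tightness and pass to
  the limit.\<close>

lemma bounded_jump_component:
  assumes nu: "levy_measure \<nu>" and K: "1 \<le> K"
  obtains \<eta> where "real_distribution \<eta>" "integrable \<eta> exp"
    "\<And>z. char \<eta> z = exp ((CLINT y|\<nu>. indicator {-K..K} y *\<^sub>R levy_integrand z y)
      + \<i> * of_real (a * z) - of_real (b\<^sup>2 * z\<^sup>2 / 2))"
proof -
  have s [measurable_cong]: "sets \<nu> = sets borel" using nu by (simp add: levy_measure_def)
  define J where "J = (\<integral>y. min 1 (y\<^sup>2) \<partial>\<nu>)"
  define t where "t y = y * indicator {y. \<bar>y\<bar> \<le> 1} y" for y :: real
  have [measurable]: "t \<in> borel_measurable borel" unfolding t_def by measurable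
  define E where "E n = {y. 1 / real (Suc n) < \<bar>y\<bar> \<and> \<bar>y\<bar> \<le> K}" for n
  have [measurable]: "E n \<in> sets borel" for n unfolding E_def by measurable
  define N where "N n = density \<nu> (indicator (E n))" for n
  have N: "finite_borel_measure (N n)" for n
    unfolding N_def by (rule levy_measure_density_finite[OF nu, where d = "1 / real (Suc n)"]) (auto simp: E_def)
  have int_N: "(\<integral>y. f y \<partial>N n) = (\<integral>y. indicator (E n) y *\<^sub>R f y \<partial>\<nu>)"
    if [measurable]: "f \<in> borel_measurable borel" for n and f :: "real \<Rightarrow> 'b :: {banach, second_countable_topology}"
    unfolding N_def by (rule integral_density_indicator[OF s]) measurable
  define d where "d n = (\<integral>y. indicator (E n) y * t y \<partial>\<nu>)" for n
  have int_t: "integrable \<nu> (\<lambda>y. indicator (E n) y * t y)" for n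
  proof (rule levy_measure_integrable_bound[OF nu, where C = "real (Suc n)"])
    fix y
    show "norm (indicator (E n) y * t y) \<le> real (Suc n) * min 1 (y\<^sup>2)"
    proof (cases "y \<in> E n \<and> \<bar>y\<bar> \<le> 1")
      case True
      then have "1 < real (Suc n) * \<bar>y\<bar>" by (simp add: E_def field_simps)
      then have "\<bar>y\<bar> * 1 \<le> \<bar>y\<bar> * (real (Suc n) * \<bar>y\<bar>)" by (intro mult_left_mono) auto
      also have "\<dots> = real (Suc n) * y\<^sup>2" by (simp add: power2_eq_square)
      also have "y\<^sup>2 = min 1 (y\<^sup>2)" using True abs_square_le_1[of y] by (simp add: min_def)
      finally show ?thesis using True by (simp add: t_def)
    qed (auto simp: t_def indicator_def)
  qed measurable
  have int_psi: "integrable \<nu> (\<lambda>y. indicator A y *\<^sub>R levy_integrand z y)" if [measurable]: "A \<in> sets borel" for z A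
  proof (rule levy_measure_integrable_bound[OF nu, where C = "2 + z\<^sup>2"])
    show "norm (indicator A y *\<^sub>R levy_integrand z y) \<le> (2 + z\<^sup>2) * min 1 (y\<^sup>2)" for y
      using norm_levy_integrand_le[of z y] by (auto simp: indicator_def)
  qed measurable
  define G where "G n = distr std_normal_distribution borel (\<lambda>x. (a - d n) + b * x)" for n
  interpret SN: real_distribution std_normal_distribution by (rule real_dist_normal_dist)
  have G: "real_distribution (G n)" for n
    unfolding G_def by (rule SN.real_distribution_distr) simp
  define M where "M n = (cpois (N n) \<star> G n)" for n
  have cN: "real_distribution (cpois (N n))" for n by (rule finite_borel_measure.real_distribution_cpois[OF N])
  have M: "real_distribution (M n)" for n unfolding M_def by (rule real_distribution_convolution[OF cN G])

  \<comment> \<open>recentring by \<open>d n\<close> turns the exponent of the compound Poisson part into the compensated one\<close>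
  have char_M: "char (M n) z = exp ((CLINT y|\<nu>. indicator (E n) y *\<^sub>R levy_integrand z y)
      + \<i> * of_real (a * z) - of_real (b\<^sup>2 * z\<^sup>2 / 2))" for n z
  proof -
    have "(CLINT y|N n. iexp (z * y) - 1) = (CLINT y|\<nu>. indicator (E n) y *\<^sub>R (iexp (z * y) - 1))"
      by (rule int_N) measurable
    also have "(\<lambda>y. indicator (E n) y *\<^sub>R (iexp (z * y) - 1)) =
        (\<lambda>y. indicator (E n) y *\<^sub>R levy_integrand z y + \<i> * of_real z * of_real (indicator (E n) y * t y))"
      by (rule ext) (simp add: levy_integrand_def t_def scaleR_conv_of_real algebra_simps)
    also have "(CLINT y|\<nu>. indicator (E n) y *\<^sub>R levy_integrand z y + \<i> * of_real z * of_real (indicator (E n) y * t y)) =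
        (CLINT y|\<nu>. indicator (E n) y *\<^sub>R levy_integrand z y) + (CLINT y|\<nu>. \<i> * of_real z * of_real (indicator (E n) y * t y))"
      using int_t[of n]
      by (intro Bochner_Integration.integral_add int_psi integrable_mult_right integrable_of_real) measurable
    also have "(CLINT y|\<nu>. \<i> * of_real z * of_real (indicator (E n) y * t y)) = \<i> * of_real z * of_real (d n)"
      unfolding d_def by (simp only: integral_mult_right_zero integral_complex_of_real)
    finally have "char (M n) z = exp ((CLINT y|\<nu>. indicator (E n) y *\<^sub>R levy_integrand z y) + \<i> * of_real z * of_real (d n))
        * exp (\<i> * of_real ((a - d n) * z) - of_real (b\<^sup>2 * z\<^sup>2 / 2))"
      unfolding M_def char_convolution[OF cN G] finite_borel_measure.char_cpois[OF N]
      unfolding G_def char_affine_normal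
      by (simp only:)
    also have "\<dots> = exp ((CLINT y|\<nu>. indicator (E n) y *\<^sub>R levy_integrand z y)
        + \<i> * of_real (a * z) - of_real (b\<^sup>2 * z\<^sup>2 / 2))"
      unfolding exp_add[symmetric] by (rule arg_cong[where f = exp]) (simp add: algebra_simps)
    finally show ?thesis .
  qed

  define C where "C = exp (exp K * J + \<bar>a\<bar> + b\<^sup>2 / 2)"
  \<comment> \<open>the compensated exponent is of order \<open>min 1 (y\<^sup>2)\<close>, hence bounded independently of \<open>n\<close>\<close>
  have mom: "(\<integral>\<^sup>+x. ennreal (exp (u * x)) \<partial>M n) \<le> ennreal C" if u: "\<bar>u\<bar> = 1" for u n
  proof -
    have le: "\<bar>exp (u * y) - 1 - u * t y\<bar> \<le> exp K * min 1 (y\<^sup>2)" if "\<bar>y\<bar> \<le> K" for y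
    proof (cases "\<bar>y\<bar> \<le> 1")
      case True
      have uy: "\<bar>u * y\<bar> \<le> 1" "(u * y)\<^sup>2 = y\<^sup>2" using True u by (auto simp: abs_mult power_mult_distrib abs_square_eq_1)
      have "0 \<le> exp (u * y) - 1 - u * y" using exp_ge_add_one_self[of "u * y"] by linarith
      moreover have "exp (u * y) - 1 - u * y \<le> y\<^sup>2" using exp_minus_linear_le[OF uy(1)] uy(2) by simp
      moreover have "1 * y\<^sup>2 \<le> exp K * y\<^sup>2" using K by (intro mult_right_mono) auto
      moreover have "y\<^sup>2 = min 1 (y\<^sup>2)" using True abs_square_le_1[of y] by (simp add: min_def)
      ultimately show ?thesis using True by (simp add: t_def)
    next
      case False
      have "u * y \<le> \<bar>u * y\<bar>" by simp
      also have "\<dots> \<le> K" using that u by (simp add: abs_mult)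
      finally have "exp (u * y) \<le> exp K" by simp
      moreover have "0 < exp (u * y)" "1 \<le> exp K" using K by auto
      ultimately have "\<bar>exp (u * y) - 1\<bar> \<le> exp K" by linarith
      moreover have "1 = min 1 (y\<^sup>2)" using False abs_square_le_1[of y] by (simp add: min_def)
      ultimately show ?thesis using False by (simp add: t_def)
    qed
    have int_q: "integrable \<nu> (\<lambda>y. indicator (E n) y * (exp (u * y) - 1 - u * t y))"
    proof (rule levy_measure_integrable_bound[OF nu, where C = "exp K"])
      show "norm (indicator (E n) y * (exp (u * y) - 1 - u * t y)) \<le> exp K * min 1 (y\<^sup>2)" for y
        using le[of y] by (auto simp: indicator_def E_def)
    qed measurable
    have "(\<integral>y. indicator (E n) y * (exp (u * y) - 1 - u * t y) \<partial>\<nu>) \<le> (\<integral>y. exp K * min 1 (y\<^sup>2) \<partial>\<nu>)"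
    proof (rule integral_mono[OF int_q])
      show "integrable \<nu> (\<lambda>y. exp K * min 1 (y\<^sup>2))"
        by (rule integrable_mult_right[OF levy_measure_integrable_min[OF nu]])
      show "indicator (E n) y * (exp (u * y) - 1 - u * t y) \<le> exp K * min 1 (y\<^sup>2)" for y
        using abs_le_D1[OF le[of y]] by (auto simp: indicator_def E_def)
    qed
    also have "\<dots> = exp K * J" unfolding J_def by (rule integral_mult_right_zero)
    finally have q_le: "(\<integral>y. indicator (E n) y * (exp (u * y) - 1 - u * t y) \<partial>\<nu>) \<le> exp K * J" .
    interpret Nn: finite_borel_measure "N n" by (rule N)
    have "integrable (N n) (\<lambda>y. exp (u * y))"
    proof (rule Nn.integrable_const_bound[where B = "exp K"])
      have "u * y \<le> K" if "\<bar>y\<bar> \<le> K" for y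
      proof -
        have "u * y \<le> \<bar>u * y\<bar>" by simp
        also have "\<dots> \<le> K" using that u by (simp add: abs_mult)
        finally show ?thesis .
      qed
      then show "AE y in N n. norm (exp (u * y)) \<le> exp K"
        unfolding N_def by (subst AE_density) (auto simp: indicator_def E_def)
      show "(\<lambda>y. exp (u * y)) \<in> borel_measurable (N n)"
        unfolding measurable_cong_sets[OF Nn.M_is_borel refl] by measurable
    qed
    then have "(\<integral>\<^sup>+x. ennreal (exp (u * x)) \<partial>cpois (N n)) = ennreal (exp (\<integral>y. exp (u * y) - 1 \<partial>N n))"
      by (rule Nn.nn_integral_exp_cpois)
    also have "(\<integral>y. exp (u * y) - 1 \<partial>N n) = (\<integral>y. indicator (E n) y *\<^sub>R (exp (u * y) - 1) \<partial>\<nu>)"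
      by (rule int_N) measurable
    also have "(\<lambda>y. indicator (E n) y *\<^sub>R (exp (u * y) - 1)) =
        (\<lambda>y. indicator (E n) y * (exp (u * y) - 1 - u * t y) + u * (indicator (E n) y * t y))"
      by (rule ext) (simp add: algebra_simps)
    also have "(\<integral>y. indicator (E n) y * (exp (u * y) - 1 - u * t y) + u * (indicator (E n) y * t y) \<partial>\<nu>) =
        (\<integral>y. indicator (E n) y * (exp (u * y) - 1 - u * t y) \<partial>\<nu>) + (\<integral>y. u * (indicator (E n) y * t y) \<partial>\<nu>)"
      by (intro Bochner_Integration.integral_add int_q integrable_mult_right int_t)
    also have "(\<integral>y. u * (indicator (E n) y * t y) \<partial>\<nu>) = u * d n"
      unfolding d_def by (rule integral_mult_right_zero)
    finally have 1: "(\<integral>\<^sup>+x. ennreal (exp (u * x)) \<partial>cpois (N n)) =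
        ennreal (exp ((\<integral>y. indicator (E n) y * (exp (u * y) - 1 - u * t y) \<partial>\<nu>) + u * d n))" .
    have "(\<integral>\<^sup>+x. ennreal (exp (u * x)) \<partial>G n) = (\<integral>\<^sup>+x. ennreal (exp (u * ((a - d n) + b * x))) \<partial>std_normal_distribution)"
      unfolding G_def by (rule nn_integral_distr) auto
    also have "\<dots> = (\<integral>\<^sup>+x. ennreal (exp (u * (a - d n))) * ennreal (exp ((u * b) * x)) \<partial>std_normal_distribution)"
      by (simp add: distrib_left exp_add ennreal_mult mult.assoc)
    also have "\<dots> = ennreal (exp (u * (a - d n))) * ennreal (exp ((u * b)\<^sup>2 / 2))"
      unfolding nn_integral_exp_std_normal[symmetric] by (rule nn_integral_cmult) simp
    finally have 2: "(\<integral>\<^sup>+x. ennreal (exp (u * x)) \<partial>G n) = ennreal (exp (u * (a - d n)) * exp ((u * b)\<^sup>2 / 2))"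
      by (simp add: ennreal_mult)
    have "(\<integral>\<^sup>+x. ennreal (exp (u * x)) \<partial>M n) =
        ennreal (exp ((\<integral>y. indicator (E n) y * (exp (u * y) - 1 - u * t y) \<partial>\<nu>) + u * d n) *
          (exp (u * (a - d n)) * exp ((u * b)\<^sup>2 / 2)))"
      unfolding M_def nn_integral_exp_convolution[OF cN G] 1 2 by (rule ennreal_mult[symmetric]) auto
    also have "\<dots> \<le> ennreal C"
    proof (rule ennreal_leI)
      have "u * a \<le> \<bar>u * a\<bar>" by simp
      also have "\<dots> = \<bar>a\<bar>" using u by (simp add: abs_mult)
      finally have ua: "u * a \<le> \<bar>a\<bar>" .
      have "u\<^sup>2 = 1" using u by (simp add: abs_square_eq_1)
      then have ub: "(u * b)\<^sup>2 / 2 = b\<^sup>2 / 2" by (simp add: power_mult_distrib)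
      show "exp ((\<integral>y. indicator (E n) y * (exp (u * y) - 1 - u * t y) \<partial>\<nu>) + u * d n) *
          (exp (u * (a - d n)) * exp ((u * b)\<^sup>2 / 2)) \<le> C"
        unfolding C_def exp_add[symmetric] exp_le_cancel_iff ub right_diff_distrib[of u a "d n"] using q_le ua by linarith
    qed
    finally show ?thesis .
  qed

  have "tight M"
    using mom[of 1] mom[of "-1"] by (intro tight_if_exp_moments[where C = C] M) (auto simp: C_def)
  from tight_imp_convergent_subsubsequence[OF this strict_mono_id]
  obtain r \<eta> where r: "strict_mono (r :: nat \<Rightarrow> nat)" and eta: "real_distribution \<eta>"
    and w: "weak_conv_m (M \<circ> id \<circ> r) \<eta>" by blast
  have w': "weak_conv_m (\<lambda>n. M (r n)) \<eta>" using w by (simp add: o_def)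
  show ?thesis
  proof (rule that[OF eta])
    show "integrable \<eta> exp"
      using mom[of 1] by (intro weak_limit_integrable_exp[OF M eta w', where C = C]) (auto simp: C_def)
    fix z
    have "(\<lambda>n. CLINT y|\<nu>. indicator (E n) y *\<^sub>R levy_integrand z y) \<longlonglongrightarrow>
        (CLINT y|\<nu>. indicator {-K..K} y *\<^sub>R levy_integrand z y)"
    proof (rule integral_dominated_convergence[where w = "\<lambda>y. (2 + z\<^sup>2) * min 1 (y\<^sup>2)"])
      show "integrable \<nu> (\<lambda>y. (2 + z\<^sup>2) * min 1 (y\<^sup>2))"
        by (rule integrable_mult_right[OF levy_measure_integrable_min[OF nu]])
      show "AE y in \<nu>. norm (indicator (E n) y *\<^sub>R levy_integrand z y) \<le> (2 + z\<^sup>2) * min 1 (y\<^sup>2)" for n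
        using norm_levy_integrand_le[of z] by (intro AE_I2) (auto simp: indicator_def)
      show "AE y in \<nu>. (\<lambda>n. indicator (E n) y *\<^sub>R levy_integrand z y) \<longlonglongrightarrow> indicator {-K..K} y *\<^sub>R levy_integrand z y"
      proof (rule AE_I2, rule tendsto_eventually)
        fix y :: real
        show "\<forall>\<^sub>F n in sequentially. indicator (E n) y *\<^sub>R levy_integrand z y = indicator {-K..K} y *\<^sub>R levy_integrand z y"
        proof (cases "y = 0")
          case True
          then show ?thesis by (simp add: levy_integrand_def)
        next
          case False
          have "(\<lambda>n. 1 / real (Suc n)) \<longlonglongrightarrow> 0" by (rule LIMSEQ_Suc[OF lim_1_over_n])
          then have "\<forall>\<^sub>F n in sequentially. 1 / real (Suc n) < \<bar>y\<bar>"
            using False by (intro order_tendstoD(2)) auto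
          then show ?thesis
            by eventually_elim (auto simp: indicator_def E_def)
        qed
      qed
    qed measurable
    then have "(\<lambda>n. char (M n) z) \<longlonglongrightarrow> exp ((CLINT y|\<nu>. indicator {-K..K} y *\<^sub>R levy_integrand z y)
        + \<i> * of_real (a * z) - of_real (b\<^sup>2 * z\<^sup>2 / 2))"
      unfolding char_M by (intro tendsto_intros)
    from LIMSEQ_subseq_LIMSEQ[OF this r]
    have "(\<lambda>n. char (M (r n)) z) \<longlonglongrightarrow> exp ((CLINT y|\<nu>. indicator {-K..K} y *\<^sub>R levy_integrand z y)
        + \<i> * of_real (a * z) - of_real (b\<^sup>2 * z\<^sup>2 / 2))" by (simp only: o_def)
    moreover have "(\<lambda>n. char (M (r n)) z) \<longlonglongrightarrow> char \<eta> z"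
      by (rule levy_continuity1[OF M eta w'])
    ultimately show "char \<eta> z = exp ((CLINT y|\<nu>. indicator {-K..K} y *\<^sub>R levy_integrand z y)
        + \<i> * of_real (a * z) - of_real (b\<^sup>2 * z\<^sup>2 / 2))"
      using LIMSEQ_unique by blast
  qed
qed

text \<open>Large negative jumps may have heavy tails, but their compound Poisson distribution lives
  on the negative half-line, so that convolution with it keeps the integral of \<open>exp\<close> finite.\<close>

lemma infinitely_divisible_decompose:
  assumes id: "infinitely_divisible_with \<mu> \<nu>" and K: "1 \<le> K"
  obtains \<eta> where "real_distribution \<eta>" "integrable \<eta> exp" "\<mu> = (\<eta> \<star> cpois (levy_above \<nu> K))"
proof -
  have nu: "levy_measure \<nu>" and mu: "real_distribution \<mu>" using id by (auto simp: infinitely_divisible_with_def)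
  obtain a b where ab: "\<And>z. char \<mu> z = exp (levy_exponent \<nu> a b z)"
    using id by (auto simp: infinitely_divisible_with_def)
  have s [measurable_cong]: "sets \<nu> = sets borel" using nu by (simp add: levy_measure_def)
  obtain \<eta>\<^sub>0 where eta0: "real_distribution \<eta>\<^sub>0" "integrable \<eta>\<^sub>0 exp"
    and char0: "\<And>z. char \<eta>\<^sub>0 z = exp ((CLINT y|\<nu>. indicator {-K..K} y *\<^sub>R levy_integrand z y)
      + \<i> * of_real (a * z) - of_real (b\<^sup>2 * z\<^sup>2 / 2))"
    using bounded_jump_component[OF nu K] by blast
  define P where "P = levy_above \<nu> K"
  define N where "N = density \<nu> (indicator {..<-K})"
  have Pf: "finite_borel_measure P" unfolding P_def levy_above_def
    by (rule levy_measure_density_finite[OF nu, where d = 1]) (use K in auto)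
  have Nf: "finite_borel_measure N" unfolding N_def
    by (rule levy_measure_density_finite[OF nu, where d = 1]) (use K in auto)
  interpret P: finite_borel_measure P by (rule Pf)
  interpret N: finite_borel_measure N by (rule Nf)
  define \<eta> where "\<eta> = (\<eta>\<^sub>0 \<star> cpois N)"
  have eta: "real_distribution \<eta>"
    unfolding \<eta>_def by (rule real_distribution_convolution[OF eta0(1) N.real_distribution_cpois])
  have "integrable N (\<lambda>y. exp (1 * y))"
  proof (rule N.integrable_const_bound[where B = 1])
    show "AE y in N. norm (exp (1 * y)) \<le> 1"
      unfolding N_def by (subst AE_density) (use K in \<open>auto simp: indicator_def\<close>)
    show "(\<lambda>y. exp (1 * y)) \<in> borel_measurable N"
      unfolding measurable_cong_sets[OF N.M_is_borel refl] by measurable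
  qed
  note momN = N.nn_integral_exp_cpois[OF this]
  have "(\<integral>\<^sup>+x. ennreal (exp (1 * x)) \<partial>\<eta>) < \<infinity>"
    unfolding \<eta>_def nn_integral_exp_convolution[OF eta0(1) N.real_distribution_cpois] momN
    using eta0(2) by (simp add: integrable_iff_bounded ennreal_mult_less_top)
  then have eta_exp: "integrable \<eta> exp"
    using eta by (intro integrableI_bounded) (auto simp: real_distribution.measurable_finite_borel)
  have "\<mu> = (\<eta> \<star> cpois P)"
  proof (rule Levy_uniqueness[OF mu real_distribution_convolution[OF eta P.real_distribution_cpois]], rule ext)
    fix z
    let ?p = "levy_integrand z"
    have int: "integrable \<nu> (\<lambda>y. indicator A y *\<^sub>R ?p y)" if [measurable]: "A \<in> sets borel" for A
    proof (rule levy_measure_integrable_bound[OF nu, where C = "2 + z\<^sup>2"])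
      show "norm (indicator A y *\<^sub>R ?p y) \<le> (2 + z\<^sup>2) * min 1 (y\<^sup>2)" for y
        using norm_levy_integrand_le[of z y] by (auto simp: indicator_def)
    qed measurable
    have "(CLINT y|P. iexp (z * y) - 1) = (CLINT y|\<nu>. indicator {K<..} y *\<^sub>R (iexp (z * y) - 1))"
      unfolding P_def levy_above_def by (rule integral_density_indicator[OF s]) auto
    also have "\<dots> = (CLINT y|\<nu>. indicator {K<..} y *\<^sub>R ?p y)"
      using K by (intro Bochner_Integration.integral_cong) (auto simp: indicator_def levy_integrand_def)
    finally have cP: "char (cpois P) z = exp (CLINT y|\<nu>. indicator {K<..} y *\<^sub>R ?p y)"
      by (simp only: P.char_cpois)
    have "(CLINT y|N. iexp (z * y) - 1) = (CLINT y|\<nu>. indicator {..<-K} y *\<^sub>R (iexp (z * y) - 1))"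
      unfolding N_def by (rule integral_density_indicator[OF s]) auto
    also have "\<dots> = (CLINT y|\<nu>. indicator {..<-K} y *\<^sub>R ?p y)"
      using K by (intro Bochner_Integration.integral_cong) (auto simp: indicator_def levy_integrand_def)
    finally have cN: "char (cpois N) z = exp (CLINT y|\<nu>. indicator {..<-K} y *\<^sub>R ?p y)"
      by (simp only: N.char_cpois)
    have "(CLINT y|\<nu>. ?p y) = (CLINT y|\<nu>. (indicator {-K..K} y *\<^sub>R ?p y + indicator {..<-K} y *\<^sub>R ?p y) + indicator {K<..} y *\<^sub>R ?p y)"
      using K by (intro Bochner_Integration.integral_cong) (auto simp: indicator_def)
    also have "\<dots> = (CLINT y|\<nu>. indicator {-K..K} y *\<^sub>R ?p y) + (CLINT y|\<nu>. indicator {..<-K} y *\<^sub>R ?p y)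
        + (CLINT y|\<nu>. indicator {K<..} y *\<^sub>R ?p y)"
      by (subst Bochner_Integration.integral_add | (intro Bochner_Integration.integrable_add int; simp) | rule refl)+
    finally have split: "(CLINT y|\<nu>. ?p y) = (CLINT y|\<nu>. indicator {-K..K} y *\<^sub>R ?p y)
        + (CLINT y|\<nu>. indicator {..<-K} y *\<^sub>R ?p y) + (CLINT y|\<nu>. indicator {K<..} y *\<^sub>R ?p y)" .
    have "char (\<eta> \<star> cpois P) z = char \<eta>\<^sub>0 z * char (cpois N) z * char (cpois P) z"
      unfolding \<eta>_def
      by (simp only: char_convolution[OF eta[unfolded \<eta>_def] P.real_distribution_cpois]
          char_convolution[OF eta0(1) N.real_distribution_cpois])
    also have "\<dots> = exp ((CLINT y|\<nu>. ?p y) + \<i> * of_real (a * z) - of_real (b\<^sup>2 * z\<^sup>2 / 2))"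
      unfolding char0 cN cP split exp_add[symmetric]
      by (rule arg_cong[where f = exp]) (simp only: algebra_simps)
    also have "\<dots> = char \<mu> z"
      unfolding ab levy_exponent_def levy_integrand_def by (simp only:)
    finally show "char \<mu> z = char (\<eta> \<star> cpois P) z" by (rule sym)
  qed
  with eta eta_exp show ?thesis unfolding P_def by (rule that)
qed

section \<open>Transfer between distributions with comparable local masses\<close>

lemma negligible_pairs_mono:
  assumes neg: "negligible_pairs c F G h" and K: "0 < K" and le: "\<forall>\<^sub>F x in at_top. h x \<le> K * h' x"
  shows "negligible_pairs c F G h'"
  unfolding negligible_pairs_def
proof (intro allI impI)
  fix e :: real assume "e > 0"
  then have e: "0 < e / K" using K by simp
  then obtain B0 where B0: "\<And>B. B0 \<le> B \<Longrightarrow>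
      \<forall>\<^sub>F x in at_top. sum_mass c F G (\<lambda>y z. B < y \<and> B < z) x \<le> e / K * h x"
    using neg unfolding negligible_pairs_def by meson
  show "\<exists>B0. \<forall>B\<ge>B0. \<forall>\<^sub>F x in at_top. sum_mass c F G (\<lambda>y z. B < y \<and> B < z) x \<le> e * h' x"
  proof (intro exI allI impI)
    fix B assume "B0 \<le> B"
    from B0[OF this] le show "\<forall>\<^sub>F x in at_top. sum_mass c F G (\<lambda>y z. B < y \<and> B < z) x \<le> e * h' x"
    proof eventually_elim
      case (elim x)
      have "e / K * h x \<le> e / K * (K * h' x)" using elim e by (intro mult_left_mono) auto
      also have "\<dots> = e * h' x" using K by simp
      finally show ?case using elim by linarith
    qed
  qed
qed

lemma almost_decreasing_transfer:
  assumes f: "almost_decreasing f" and g: "\<And>x. 0 \<le> g x" and ab: "0 < a" "0 < b"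
    and le: "\<forall>\<^sub>F x in at_top. g x \<le> a * f x" "\<forall>\<^sub>F x in at_top. f x \<le> b * g x"
  shows "almost_decreasing g"
proof -
  obtain x0 K where x0: "0 < x0" and K: "0 < K" and fK: "\<And>x y. x0 < x \<Longrightarrow> 0 < y \<Longrightarrow> f (x + y) \<le> K * f x"
    using f unfolding almost_decreasing_def by blast
  obtain x1 where x1: "\<And>x. x1 \<le> x \<Longrightarrow> g x \<le> a * f x \<and> f x \<le> b * g x"
    using eventually_conj[OF le] by (auto simp: eventually_at_top_linorder)
  have "g (x + y) \<le> (a * K * b) * g x" if x: "max x0 x1 < x" and y: "0 < y" for x y
  proof -
    have "g (x + y) \<le> a * f (x + y)" using x1[of "x + y"] x y by simp
    also have "\<dots> \<le> a * (K * f x)" using fK[of x y] x y ab by (intro mult_left_mono) auto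
    also have "\<dots> \<le> a * (K * (b * g x))" using x1[of x] x ab K by (intro mult_left_mono) auto
    finally show ?thesis by (simp add: mult_ac)
  qed
  then show ?thesis
    unfolding almost_decreasing_def using g ab K x0
    by (intro conjI allI exI[of _ "max x0 x1"] exI[of _ "a * K * b"]) auto
qed

lemma asymp_equiv_le_double:
  fixes f g :: "real \<Rightarrow> real"
  assumes "f \<sim>[at_top] g" "\<forall>\<^sub>F x in at_top. 0 < g x"
  shows "\<forall>\<^sub>F x in at_top. f x \<le> 2 * g x" "\<forall>\<^sub>F x in at_top. g x \<le> 2 * f x"
  using asymp_equiv_iff_asymp_le[OF assms(2), of f] assms(1)
    asymp_leD[of f g 1] asymp_leD[of g f 1] by auto

lemma long_tailed_scale:
  assumes f: "long_tailed f" and p: "0 < p" and g: "g \<in> borel_measurable borel" "\<And>x. 0 \<le> g x"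
    and eq: "\<forall>\<^sub>F x in at_top. g x = p * f x"
  shows "long_tailed g"
proof -
  have [measurable]: "f \<in> borel_measurable borel" using f by (simp add: long_tailed_def)
  have "long_tailed (\<lambda>x. p * f x)"
    using f p unfolding long_tailed_def by (auto intro!: asymp_equiv_mult)
  moreover have "g \<sim>[at_top] (\<lambda>x. p * f x)"
    using eq by (rule asymp_equiv_refl_ev)
  ultimately show ?thesis using long_tailed_cong_asymp[of "\<lambda>x. p * f x" g] g by blast
qed

text \<open>A comparison up to a shift is as good as one without, provided that one of the functions involved is
  long-tailed.\<close>

lemma asymp_le_long_tailed_left:
  assumes f: "long_tailed f" and h: "\<And>x. 0 \<le> h x"
    and le: "\<And>e. 0 < e \<Longrightarrow> \<exists>A. \<forall>\<^sub>F x in at_top. f (x + A) \<le> (1 + e) * h x"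
  shows "asymp_le f h"
  unfolding asymp_le_def
proof (intro allI impI)
  fix e :: real assume e: "e > 0"
  define d where "d = min 1 (e / 3)"
  have d: "0 < d" "d \<le> 1" "d \<le> e / 3" using e by (auto simp: d_def)
  have "d * d \<le> d" using d mult_left_mono[of d 1 d] by simp
  moreover have "(1 + d) * (1 + d) = 1 + 2 * d + d * d" by (simp add: algebra_simps)
  ultimately have de: "(1 + d) * (1 + d) \<le> 1 + e" using d by linarith
  obtain A where A: "\<forall>\<^sub>F x in at_top. f (x + A) \<le> (1 + d) * h x" using le[OF d(1)] by blast
  from A asymp_leD[OF long_tailed_asymp_le(2)[OF f, of A] d(1)]
  show "\<forall>\<^sub>F x in at_top. f x \<le> (1 + e) * h x"
  proof eventually_elim
    case (elim x)
    have "(1 + d) * f (x + A) \<le> (1 + d) * ((1 + d) * h x)" using elim d by (intro mult_left_mono) auto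
    also have "\<dots> = (1 + d) * (1 + d) * h x" by (simp only: mult.assoc)
    also have "\<dots> \<le> (1 + e) * h x" using de h by (intro mult_right_mono) auto
    finally show ?case using elim by linarith
  qed
qed

lemma asymp_le_long_tailed_right:
  assumes g: "long_tailed g" and h: "asymp_le h g"
    and le: "\<And>e. 0 < e \<Longrightarrow> \<exists>A. \<forall>\<^sub>F x in at_top. f (x + A) \<le> (1 + e) * h x"
  shows "asymp_le f g"
  unfolding asymp_le_def
proof (intro allI impI)
  fix e :: real assume e: "e > 0"
  have g0: "0 \<le> g x" for x using g by (simp add: long_tailed_def)
  \<comment> \<open>\<open>(1 + d)\<^sup>3 \<le> 1 + 7 * d\<close> for \<open>d \<le> 1\<close>\<close>
  define d where "d = min 1 (e / 7)"
  have d: "0 < d" "d \<le> 1" "d \<le> e / 7" using e by (auto simp: d_def)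
  have dd: "d * d \<le> d" using d mult_left_mono[of d 1 d] by simp
  have "d * d \<le> 1" using dd d by linarith
  then have "d * (d * d) \<le> d" using d mult_left_mono[of "d * d" 1 d] by simp
  moreover note dd
  moreover have "(1 + d) * ((1 + d) * (1 + d)) = 1 + 3 * d + 3 * (d * d) + d * (d * d)"
    by (simp add: algebra_simps)
  ultimately have de: "(1 + d) * ((1 + d) * (1 + d)) \<le> 1 + e" using d by linarith
  obtain A where A: "\<forall>\<^sub>F x in at_top. f (x + A) \<le> (1 + d) * h x" using le[OF d(1)] by blast
  from A asymp_leD[OF h d(1)] asymp_leD[OF long_tailed_asymp_le(2)[OF g, of A] d(1)]
  have "\<forall>\<^sub>F x in at_top. f (x + A) \<le> (1 + e) * g (x + A)"
  proof eventually_elim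
    case (elim x)
    have "(1 + d) * g x \<le> (1 + d) * ((1 + d) * g (x + A))" using elim d by (intro mult_left_mono) auto
    with elim have "h x \<le> (1 + d) * ((1 + d) * g (x + A))" by linarith
    then have "(1 + d) * h x \<le> (1 + d) * ((1 + d) * ((1 + d) * g (x + A)))"
      using d by (intro mult_left_mono) auto
    also have "\<dots> = (1 + d) * ((1 + d) * (1 + d)) * g (x + A)" by (simp only: mult_ac)
    also have "\<dots> \<le> (1 + e) * g (x + A)" using de g0 by (intro mult_right_mono) auto
    finally show ?case using elim by linarith
  qed
  then obtain x0 where x0: "\<And>x. x0 \<le> x \<Longrightarrow> f (x + A) \<le> (1 + e) * g (x + A)"
    by (auto simp: eventually_at_top_linorder)
  have "f x \<le> (1 + e) * g x" if "x0 + A \<le> x" for x using x0[of "x - A"] that by simp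
  then show "\<forall>\<^sub>F x in at_top. f x \<le> (1 + e) * g x"
    unfolding eventually_at_top_linorder by blast
qed


section \<open>Functions asymptotic to a non-increasing one\<close>

lemma asymp_nonincreasing_pos: "asymp_nonincreasing f \<Longrightarrow> \<forall>\<^sub>F x in at_top. 0 < f x"
  unfolding asymp_nonincreasing_def eventually_at_top_linorder by blast

lemma asymp_nonincreasing_upper:
  assumes f: "asymp_nonincreasing f" and e: "0 < e"
  shows "\<forall>\<^sub>F x in at_top. \<forall>t\<ge>x. f t \<le> (1 + e) * f x"
proof -
  obtain x0 where bdd: "bdd_above (f ` {x0..})" and S: "(\<lambda>x. SUP t\<in>{x..}. f t) \<sim>[at_top] f"
    using f unfolding asymp_nonincreasing_def by blast
  have "asymp_le (\<lambda>x. SUP t\<in>{x..}. f t) f"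
    using S asymp_equiv_iff_asymp_le[OF asymp_nonincreasing_pos[OF f]] by blast
  from asymp_leD[OF this e] eventually_ge_at_top[of x0] show ?thesis
  proof eventually_elim
    case (elim x)
    have "bdd_above (f ` {x..})" by (rule bdd_above_mono[OF bdd]) (use elim in auto)
    then have "f t \<le> (SUP t\<in>{x..}. f t)" if "x \<le> t" for t using that by (intro cSUP_upper) auto
    then show ?case using elim by force
  qed
qed

lemma asymp_nonincreasing_lower:
  assumes f: "asymp_nonincreasing f" and e: "0 < e"
  shows "\<forall>\<^sub>F x in at_top. \<forall>t\<in>{x - A..x + A}. f (x + A) \<le> (1 + e) * f t"
proof -
  have f0: "0 \<le> f x" for x using f by (simp add: asymp_nonincreasing_def)
  obtain x0 where I: "(\<lambda>x. INF t\<in>{x0..x}. f t) \<sim>[at_top] f"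
    using f unfolding asymp_nonincreasing_def by blast
  have "asymp_le f (\<lambda>x. INF t\<in>{x0..x}. f t)"
    using I asymp_equiv_iff_asymp_le[OF asymp_nonincreasing_pos[OF f]] by blast
  from asymp_leD[OF this e] obtain x1 where x1: "\<And>x. x1 \<le> x \<Longrightarrow> f x \<le> (1 + e) * (INF t\<in>{x0..x}. f t)"
    by (auto simp: eventually_at_top_linorder)
  show ?thesis
    using eventually_ge_at_top[of "x1 - A"] eventually_ge_at_top[of "x0 + A"]
  proof eventually_elim
    case (elim x)
    show ?case
    proof
      fix t assume t: "t \<in> {x - A..x + A}"
      have "(INF t\<in>{x0..x + A}. f t) \<le> f t"
        using t elim f0 by (intro cINF_lower bdd_belowI2[where m = 0]) auto
      then have "(1 + e) * (INF t\<in>{x0..x + A}. f t) \<le> (1 + e) * f t" using e by (intro mult_left_mono) auto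
      then show "f (x + A) \<le> (1 + e) * f t" using x1[of "x + A"] elim by linarith
    qed
  qed
qed

lemma asymp_nonincreasing_imp_almost_decreasing:
  assumes f: "asymp_nonincreasing f"
  shows "almost_decreasing f"
proof -
  obtain x1 where x1: "\<And>x. x1 \<le> x \<Longrightarrow> \<forall>t\<ge>x. f t \<le> (1 + 1) * f x"
    using asymp_nonincreasing_upper[OF f, of 1] by (auto simp: eventually_at_top_linorder)
  have "f (x + y) \<le> 2 * f x" if "max 1 x1 < x" "0 < y" for x y
    using x1[of x, rule_format, of "x + y"] that by simp
  then show ?thesis
    using f unfolding almost_decreasing_def asymp_nonincreasing_def
    by (intro conjI exI[of _ "max 1 x1"] exI[of _ "2::real"]) auto
qed

text \<open>The summand \<open>\<eta>\<close> lies in some \<open>[-A, A]\<close> with probability close to 1, and by asymptotic monotonicity all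
  values of the local mass of \<open>F\<close> on \<open>[x - A, x + A]\<close> are at least nearly that at \<open>x + A\<close>.\<close>

lemma convolution_lower_shift:
  assumes c: "0 < c" and eta: "real_distribution \<eta>" and F: "finite_borel_measure F"
    and A: "asymp_nonincreasing (local_mass c F)" and e: "0 < e"
  shows "\<exists>A. \<forall>\<^sub>F x in at_top. local_mass c F (x + A) \<le> (1 + e) * local_mass c (\<eta> \<star> F) x"
proof -
  interpret E: real_distribution \<eta> by fact
  note fin = E.finite_borel_measure_M F
  \<comment> \<open>the solution of \<open>(1 + d) / (1 - d) = 1 + e\<close>\<close>
  define d where "d = e / (2 + e)"
  have d: "0 < d" "d < 1" using e by (auto simp: d_def field_simps)
  have de: "1 + d = (1 + e) * (1 - d)" using e by (simp add: d_def field_simps)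
  obtain B0 where B0: "0 < B0" "\<And>B. B0 \<le> B \<Longrightarrow> measure \<eta> UNIV - d < measure \<eta> {-B..B}"
    using E.ex_symmetric_interval[OF d(1)] by blast
  have mB: "1 - d \<le> measure \<eta> {-B0..B0}" using B0(2)[of B0] E.prob_space by simp
  have "\<forall>\<^sub>F x in at_top. local_mass c F (x + B0) \<le> (1 + e) * local_mass c (\<eta> \<star> F) x"
    using asymp_nonincreasing_lower[OF A d(1), of B0]
  proof eventually_elim
    case (elim x)
    define q where "q = local_mass c F (x + B0) / (1 + d)"
    have q: "0 \<le> q" "local_mass c F (x + B0) = (1 + d) * q" using d by (simp_all add: q_def)
    have "q * measure \<eta> {-B0..B0} \<le> sum_mass c \<eta> F (\<lambda>y _. y \<in> {-B0..B0}) x"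
    proof (rule sum_mass_ge_const[OF fin c])
      fix y assume "y \<in> {-B0..B0}"
      then have "local_mass c F (x + B0) \<le> (1 + d) * local_mass c F (x - y)" using elim by auto
      then have "(1 + d) * q \<le> (1 + d) * local_mass c F (x - y)" using q(2) by linarith
      then show "q \<le> local_mass c F (x - y)" using d by simp
    qed simp
    also have "\<dots> \<le> local_mass c (\<eta> \<star> F) x"
      unfolding local_mass_convolution[OF fin] by (rule sum_mass_mono[OF fin]) auto
    finally have "(1 - d) * q \<le> local_mass c (\<eta> \<star> F) x"
      using mult_right_mono[OF mB q(1)] by (simp add: mult.commute)
    then have "(1 + e) * ((1 - d) * q) \<le> (1 + e) * local_mass c (\<eta> \<star> F) x"
      using e by (intro mult_left_mono) auto
    then show ?case using q(2) de by (simp add: mult.assoc)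
  qed
  then show ?thesis by blast
qed

text \<open>Let \<open>g\<close> be the local mass of \<open>\<eta> * F\<close> and \<open>f\<close> that of \<open>F\<close>. Values \<open>y \<le> B\<close> of the light-tailed summand contribute
  at most about \<open>f (x - B)\<close>. For \<open>B < y \<le> x - T\<close> the bound \<open>f \<le> 2 g\<close> and the growth bound for the long-tailed \<open>g\<close>
  give at most a multiple of \<open>g (x) \<integral>\<^sub>y\<^sub>>\<^sub>B e\<^sup>y \<eta>(dy)\<close>, a small fraction of \<open>g (x)\<close> itself, and so do the
  remaining \<open>y\<close>.\<close>

lemma convolution_upper_shift:
  assumes c: "0 < c" and eta: "real_distribution \<eta>" "integrable \<eta> exp" and F: "real_distribution F"
    and A: "asymp_nonincreasing (local_mass c F)" and lt: "long_tailed (local_mass c (\<eta> \<star> F))"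
    and dom: "\<forall>\<^sub>F x in at_top. local_mass c F x \<le> 2 * local_mass c (\<eta> \<star> F) x"
  shows "asymp_le (local_mass c (\<eta> \<star> F)) (local_mass c F)"
proof -
  interpret E: real_distribution \<eta> by fact
  interpret F: real_distribution F by fact
  interpret M: real_distribution "\<eta> \<star> F" by (rule real_distribution_convolution[OF eta(1) F])
  note fin = E.finite_borel_measure_M F.finite_borel_measure_M
  let ?f = "local_mass c F" and ?g = "local_mass c (\<eta> \<star> F)"
  obtain x0 C where x0: "0 < x0" and C: "1 \<le> C" and pos: "\<And>x. x0 \<le> x \<Longrightarrow> 0 < ?g x"
    and dn: "\<And>x y. x0 \<le> x \<Longrightarrow> 0 \<le> y \<Longrightarrow> ?g x \<le> C * exp (1 * y) * ?g (x + y)"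
    by (rule M.long_tailed_growth[OF c lt, of 1], simp, blast)
  obtain x1 where x1: "\<And>x. x1 \<le> x \<Longrightarrow> ?f x \<le> 2 * ?g x"
    using dom by (auto simp: eventually_at_top_linorder)
  define T where "T = max x0 x1"
  have T: "x0 \<le> T" "x1 \<le> T" by (auto simp: T_def)
  define tau where "tau B = (\<integral>y. indicator {B<..} y * exp y \<partial>\<eta>)" for B
  have int_tau: "integrable \<eta> (\<lambda>y. indicator {B<..} y * exp y)" for B
    using eta(2) by (rule Bochner_Integration.integrable_bound) (auto simp: indicator_def)
  have tau: "(tau \<longlongrightarrow> 0) at_top"
  proof -
    have "((\<lambda>B. \<integral>y. indicator {B<..} y * exp y \<partial>\<eta>) \<longlongrightarrow> (\<integral>y. 0 \<partial>\<eta>)) at_top"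
    proof (rule integral_dominated_convergence_at_top[where w = exp])
      show "AE y in \<eta>. ((\<lambda>B. indicator {B<..} y * exp y) \<longlongrightarrow> 0) at_top"
      proof (rule AE_I2, rule tendsto_eventually)
        fix y :: real
        show "\<forall>\<^sub>F B in at_top. indicator {B<..} y * exp y = 0"
          using eventually_ge_at_top[of y] by eventually_elim auto
      qed
    qed (use eta(2) in \<open>auto simp: indicator_def\<close>)
    then show ?thesis by (simp add: tau_def[abs_def])
  qed
  show ?thesis
  proof (rule asymp_le_long_tailed_left[OF lt])
    show "0 \<le> ?f x" for x by simp
    fix e :: real assume e: "0 < e"
    define d where "d = min (1 / 4) (e / 8)"
    have d: "0 < d" "d \<le> 1 / 4" "d \<le> e / 8" using e by (auto simp: d_def)
    have gT: "0 < ?g T" using pos T by simp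
    have "((\<lambda>B. 2 * C * tau B) \<longlongrightarrow> 0) at_top" by (rule tendsto_mult_right_zero[OF tau])
    then have "\<forall>\<^sub>F B in at_top. 2 * C * tau B < d" using d by (intro order_tendstoD(2)) auto
    with eventually_ge_at_top[of 0] have "\<forall>\<^sub>F B in at_top. 0 \<le> B \<and> 2 * C * tau B < d"
      by eventually_elim simp
    then obtain B where B: "0 \<le> B" "2 * C * tau B < d" by (auto simp: eventually_at_top_linorder)
    have "((\<lambda>x. C / ?g T * tau (x - T)) \<longlongrightarrow> 0) at_top"
      by (rule tendsto_mult_right_zero, rule filterlim_compose[OF tau]) real_asymp
    then have "\<forall>\<^sub>F x in at_top. C / ?g T * tau (x - T) < d" using d by (intro order_tendstoD(2)) auto
    moreover have "\<forall>\<^sub>F x in at_top. \<forall>t\<ge>x - B. ?f t \<le> (1 + d) * ?f (x - B)"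
      by (rule eventually_compose_filterlim[OF asymp_nonincreasing_upper[OF A d(1)]]) real_asymp
    ultimately have ev: "\<forall>\<^sub>F x in at_top. ?g x \<le> (1 + e) * ?f (x - B)"
      using eventually_ge_at_top[of T] eventually_ge_at_top[of "T + B"]
    proof eventually_elim
      case (elim x)
      let ?s = "sum_mass c \<eta> F"
      have "?s (\<lambda>y _. y \<in> {..B}) x \<le> (1 + d) * ?f (x - B) * measure \<eta> {..B}"
        by (rule sum_mass_le_const[OF fin c]) (use elim in auto)
      also have "\<dots> \<le> (1 + d) * ?f (x - B)" using d by (intro mult_left_le E.prob_le_1) auto
      finally have s1: "?s (\<lambda>y _. y \<in> {..B}) x \<le> (1 + d) * ?f (x - B)" .
      have "?s (\<lambda>y _. y \<in> {B<..x - T}) x = (\<integral>y. indicator {B<..x - T} y * ?f (x - y) \<partial>\<eta>)"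
        by (rule sum_mass_eq_integral[OF fin c]) simp
      also have "\<dots> \<le> (\<integral>y. 2 * C * ?g x * (indicator {B<..} y * exp y) \<partial>\<eta>)"
      proof (rule integral_mono)
        show "integrable \<eta> (\<lambda>y. indicator {B<..x - T} y * ?f (x - y))"
          by (rule integrable_local_mass[OF fin c]) simp
        show "integrable \<eta> (\<lambda>y. 2 * C * ?g x * (indicator {B<..} y * exp y))"
          using int_tau[of B] by simp
        fix y
        show "indicator {B<..x - T} y * ?f (x - y) \<le> 2 * C * ?g x * (indicator {B<..} y * exp y)"
        proof (cases "y \<in> {B<..x - T}")
          case True
          then have "?f (x - y) \<le> 2 * ?g (x - y)" using x1 T by auto
          also have "?g (x - y) \<le> C * exp y * ?g x" using dn[of "x - y" y] True T B by auto
          finally show ?thesis using True by (simp add: mult_ac)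
        qed (use C in auto)
      qed
      also have "\<dots> = 2 * C * tau B * ?g x" by (simp add: tau_def)
      finally have s2: "?s (\<lambda>y _. y \<in> {B<..x - T}) x \<le> 2 * C * tau B * ?g x" .
      have s3: "?s (\<lambda>y _. y \<in> {x - T<..}) x \<le> C / ?g T * tau (x - T) * ?g x"
      proof -
        have "?s (\<lambda>y _. y \<in> {x - T<..}) x \<le> 1 * measure \<eta> {x - T<..}"
          using F.local_mass_le_mass[of c] F.prob_space by (intro sum_mass_le_const[OF fin c]) auto
        also have "\<dots> = (\<integral>y. indicator {x - T<..} y \<partial>\<eta>)" by simp
        also have "\<dots> \<le> (\<integral>y. exp (- (x - T)) * (indicator {x - T<..} y * exp y) \<partial>\<eta>)"
        proof (rule integral_mono)
          show "integrable \<eta> (indicat_real {x - T<..})"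
            by (intro integrable_real_indicator) (auto simp: E.emeasure_eq_measure)
          show "integrable \<eta> (\<lambda>y. exp (- (x - T)) * (indicator {x - T<..} y * exp y))"
            by (intro integrable_mult_right int_tau)
          show "indicator {x - T<..} y \<le> exp (- (x - T)) * (indicator {x - T<..} y * exp y)" for y
            by (auto simp: indicator_def simp flip: exp_add)
        qed
        also have "\<dots> = exp (- (x - T)) * tau (x - T)" unfolding tau_def by (rule integral_mult_right_zero)
        also have "\<dots> \<le> C / ?g T * ?g x * tau (x - T)"
        proof (rule mult_right_mono)
          have "?g T \<le> C * exp (x - T) * ?g x" using dn[of T "x - T"] elim T by simp
          then have "exp (- (x - T)) * ?g T \<le> exp (- (x - T)) * (C * exp (x - T) * ?g x)"
            by (intro mult_left_mono) auto
          also have "\<dots> = (exp (- (x - T)) * exp (x - T)) * (C * ?g x)" by (simp only: mult_ac)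
          also have "\<dots> = C * ?g x" by (simp flip: exp_add)
          finally show "exp (- (x - T)) \<le> C / ?g T * ?g x" using gT by (simp add: pos_le_divide_eq)
          show "0 \<le> tau (x - T)" unfolding tau_def by (rule Bochner_Integration.integral_nonneg) auto
        qed
        finally show ?thesis by (simp add: mult_ac)
      qed
      have "?g x \<le> ?s (\<lambda>y _. y \<in> {..B}) x + ?s (\<lambda>y _. y \<in> {B<..}) x"
        unfolding local_mass_convolution[OF fin] by (rule sum_mass_subadd[OF fin]) auto
      moreover have "?s (\<lambda>y _. y \<in> {B<..}) x \<le> ?s (\<lambda>y _. y \<in> {B<..x - T}) x + ?s (\<lambda>y _. y \<in> {x - T<..}) x"
        by (rule sum_mass_subadd[OF fin]) auto
      moreover have "2 * C * tau B * ?g x \<le> d * ?g x" using B by (intro mult_right_mono) auto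
      moreover have "C / ?g T * tau (x - T) * ?g x \<le> d * ?g x" using elim by (intro mult_right_mono) auto
      ultimately have "?g x \<le> (1 + d) * ?f (x - B) + d * ?g x + d * ?g x"
        using s1 s2 s3 by linarith
      then have "(1 - 2 * d) * ?g x \<le> (1 + d) * ?f (x - B)" by (simp add: algebra_simps)
      also have "\<dots> \<le> ((1 - 2 * d) * (1 + e)) * ?f (x - B)"
      proof (rule mult_right_mono)
        have "d * e \<le> 1 / 4 * e" using d e by (intro mult_right_mono) auto
        moreover have "(1 - 2 * d) * (1 + e) = 1 + e - 2 * d - 2 * (d * e)" by (simp add: algebra_simps)
        ultimately show "1 + d \<le> (1 - 2 * d) * (1 + e)" using d e by linarith
      qed simp
      finally have "(1 - 2 * d) * ?g x \<le> (1 - 2 * d) * ((1 + e) * ?f (x - B))" by (simp only: mult.assoc)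
      then show ?case using d by simp
    qed
    then have "\<forall>\<^sub>F x in at_top. ?g (x + B) \<le> (1 + e) * ?f (x + B - B)"
      by (rule eventually_compose_filterlim) real_asymp
    then show "\<exists>A. \<forall>\<^sub>F x in at_top. ?g (x + A) \<le> (1 + e) * ?f x" by auto
  qed
qed

section \<open>The equivalence\<close>

text \<open>The convolution square of \<open>\<eta> * m\<close> is a light-tailed perturbation of \<open>m * m\<close>, which inherits the long tail and
  almost decrease from its asymptotic equivalent \<open>2 m\<close>.\<close>

lemma (in positive_levy) light_perturbation_S_Delta:
  assumes eta: "real_distribution \<eta>" "integrable \<eta> exp"
    and lt: "long_tailed r" and neg: "negligible_pairs c R R r" and ad: "almost_decreasing lm"
  shows "(\<eta> \<star> m) \<in> S_Delta c \<inter> D_Delta c" "local_mass c (\<eta> \<star> m) \<sim>[at_top] r"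
proof -
  interpret E: real_distribution \<eta> by fact
  interpret M: real_distribution "\<eta> \<star> m"
    by (rule real_distribution_convolution[OF eta(1) m.real_distribution_axioms])
  let ?g = "local_mass c (\<eta> \<star> m)"
  have rpos: "\<forall>\<^sub>F x in at_top. 0 < r x" by (rule long_tailed_pos[OF lt])
  have lm_r: "lm \<sim>[at_top] r" by (rule lm_asymp_r[OF lt neg])
  have lm_lt: "long_tailed lm"
    by (rule long_tailed_cong_asymp[OF lt m.borel_measurable_local_mass[OF c_pos] _ lm_r]) simp
  have lmpos: "\<forall>\<^sub>F x in at_top. 0 < lm x" by (rule long_tailed_pos[OF lm_lt])
  have g_lm: "?g \<sim>[at_top] lm" by (rule convolution_light_asymp[OF c_pos eta m_fin lm_lt ad])
  show g_r: "?g \<sim>[at_top] r" by (rule asymp_equiv_trans[OF g_lm lm_r])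
  have g_lt: "long_tailed ?g"
    by (rule long_tailed_cong_asymp[OF lm_lt M.borel_measurable_local_mass[OF c_pos] _ g_lm]) simp
  have g_ad: "almost_decreasing ?g"
    by (rule almost_decreasing_transfer[OF ad _ _ _ asymp_equiv_le_double[OF g_lm lmpos]]) auto

  have "m \<in> S_Delta c"
  proof (rule negligible_pairs_imp_S_Delta[OF c_pos _ m_nonneg])
    show "m \<in> L_Delta c" using lm_lt m.real_distribution_axioms by (simp add: L_Delta_def)
    obtain T where T: "\<And>x. T \<le> x \<Longrightarrow> lm x \<le> 2 * r x"
      using asymp_equiv_le_double(1)[OF lm_r rpos] by (auto simp: eventually_at_top_linorder)
    have "negligible_pairs c m m r"
      by (rule negligible_pairs_transfer[OF c_pos R_fin m_fin m_fin neg _ T T]) auto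
    then show "negligible_pairs c m m lm"
      by (rule negligible_pairs_mono[OF _ _ asymp_equiv_le_double(2)[OF lm_r rpos]]) simp
  qed
  then have mm: "local_mass c (m \<star> m) \<sim>[at_top] (\<lambda>x. 2 * lm x)" by (simp add: S_Delta_def)
  interpret MM: real_distribution "m \<star> m"
    by (rule real_distribution_convolution[OF m.real_distribution_axioms m.real_distribution_axioms])
  let ?mm = "local_mass c (m \<star> m)"
  have mm_lt: "long_tailed ?mm"
  proof (rule long_tailed_cong_asymp[OF _ MM.borel_measurable_local_mass[OF c_pos] _ mm])
    show "long_tailed (\<lambda>x. 2 * lm x)"
      by (rule long_tailed_scale[OF lm_lt, where p = 2])
        (use m.borel_measurable_local_mass[OF c_pos] in auto)
  qed simp
  have mm_ad: "almost_decreasing ?mm"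
  proof (rule almost_decreasing_transfer[OF ad, where a = 4 and b = 1])
    have p2: "\<forall>\<^sub>F x in at_top. 0 < 2 * lm x" using lmpos by eventually_elim simp
    show "\<forall>\<^sub>F x in at_top. ?mm x \<le> 4 * lm x"
      using asymp_equiv_le_double(1)[OF mm p2] by eventually_elim simp
    show "\<forall>\<^sub>F x in at_top. lm x \<le> 1 * ?mm x"
      using asymp_equiv_le_double(2)[OF mm p2] by eventually_elim simp
  qed auto
  have ee: "real_distribution (\<eta> \<star> \<eta>)" by (rule real_distribution_convolution[OF eta(1) eta(1)])
  have ee_exp: "integrable (\<eta> \<star> \<eta>) exp"
  proof (rule integrableI_bounded)
    have "(\<integral>\<^sup>+x. ennreal (exp (1 * x)) \<partial>(\<eta> \<star> \<eta>)) < \<infinity>"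
      unfolding nn_integral_exp_convolution[OF eta(1) eta(1)]
      using eta(2) by (simp add: integrable_iff_bounded ennreal_mult_less_top)
    then show "(\<integral>\<^sup>+x. ennreal (norm (exp x)) \<partial>(\<eta> \<star> \<eta>)) < \<infinity>" by simp
  qed simp
  have "((\<eta> \<star> m) \<star> (\<eta> \<star> m)) = ((\<eta> \<star> \<eta>) \<star> (m \<star> m))"
  proof (rule Levy_uniqueness)
    show "char ((\<eta> \<star> m) \<star> (\<eta> \<star> m)) = char ((\<eta> \<star> \<eta>) \<star> (m \<star> m))"
      by (rule ext)
        (simp add: char_convolution eta(1) ee m.real_distribution_axioms M.real_distribution_axioms
          MM.real_distribution_axioms)
  qed (intro real_distribution_convolution eta(1) m.real_distribution_axioms)+
  then have "local_mass c ((\<eta> \<star> m) \<star> (\<eta> \<star> m)) \<sim>[at_top] ?mm"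
    using convolution_light_asymp[OF c_pos ee ee_exp MM.finite_borel_measure_M mm_lt mm_ad] by simp
  also note mm
  also have "(\<lambda>x. 2 * lm x) \<sim>[at_top] (\<lambda>x. 2 * ?g x)"
    by (intro asymp_equiv_mult asymp_equiv_refl asymp_equiv_symI[OF g_lm])
  finally show "(\<eta> \<star> m) \<in> S_Delta c \<inter> D_Delta c"
    using g_lt g_ad M.real_distribution_axioms by (simp add: S_Delta_def L_Delta_def D_Delta_def)
qed

theorem theorem4p8:
  fixes c :: real and \<mu> \<nu> :: "real measure"
  assumes "c > 0"
    and "infinitely_divisible_with \<mu> \<nu>"
    and "\<exists>c\<^sub>1>1. \<exists>\<mu>\<^sub>c. compound_poisson (levy_above \<nu> c\<^sub>1) \<mu>\<^sub>c \<and> \<mu>\<^sub>c \<in> A_Delta c"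
  shows "(\<mu> \<in> S_Delta c \<inter> D_Delta c \<longleftrightarrow>
           emeasure \<nu> {1<..} > 0 \<and> normalized_levy \<nu> \<in> S_Delta c) \<and>
         (emeasure \<nu> {1<..} > 0 \<and> normalized_levy \<nu> \<in> S_Delta c \<longleftrightarrow>
           (emeasure \<nu> {1<..} > 0 \<and> normalized_levy \<nu> \<in> L_Delta c \<inter> D_Delta c) \<and>
           local_mass c \<mu> \<sim>[at_top] local_mass c \<nu>)"
proof -
  obtain c1 \<mu>\<^sub>c where c1: "1 < c1" and cp: "compound_poisson (levy_above \<nu> c1) \<mu>\<^sub>c" and A: "\<mu>\<^sub>c \<in> A_Delta c"
    using assms(3) by blast
  note c = assms(1)
  have nu: "levy_measure \<nu>" using assms(2) by (simp add: infinitely_divisible_with_def)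
  have s [measurable_cong]: "sets \<nu> = sets borel" using nu by (simp add: levy_measure_def)
  define R where "R = levy_above \<nu> c1"
  have R_fin: "finite_borel_measure R"
    unfolding R_def levy_above_def by (rule levy_measure_density_finite[OF nu, where d = 1]) (use c1 in auto)
  interpret R: finite_borel_measure R by (rule R_fin)
  have mc: "\<mu>\<^sub>c = cpois R" using R.compound_poisson_eq_cpois cp by (simp add: R_def)
  have an: "asymp_nonincreasing (local_mass c (cpois R))" using A by (simp add: A_Delta_def mc)
  have mass: "0 < measure R UNIV"
  proof (rule ccontr)
    assume "\<not> 0 < measure R UNIV"
    then have "cpois R = return borel 0" by (simp add: cpois_def zero_less_measure_iff)
    then have zero: "local_mass c (cpois R) x = 0" if "0 \<le> x" for x
      using that by (simp add: local_mass_def measure_return indicator_def)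
    have "\<forall>\<^sub>F x in at_top. 0 < local_mass c (cpois R) x \<and> 0 \<le> x"
      using asymp_nonincreasing_pos[OF an] eventually_ge_at_top[of 0] by eventually_elim simp
    then obtain x where "0 < local_mass c (cpois R) x" "0 \<le> x"
      unfolding eventually_at_top_linorder by blast
    with zero show False by simp
  qed
  have nonneg: "AE y in R. 0 \<le> y"
    unfolding R_def levy_above_def by (subst AE_density) (use c1 in \<open>auto simp: indicator_def\<close>)
  interpret P: positive_levy R c
    using R_fin mass nonneg c by (simp add: positive_levy_def positive_levy_axioms_def)
  obtain \<eta> where eta: "real_distribution \<eta>" "integrable \<eta> exp" and mu: "\<mu> = (\<eta> \<star> cpois R)"
    using infinitely_divisible_decompose[OF assms(2), of c1] c1 unfolding R_def by auto
  interpret mu: real_distribution \<mu> using assms(2) by (simp add: infinitely_divisible_with_def)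
  let ?g = "local_mass c \<mu>" and ?r = "local_mass c R" and ?m = "local_mass c (cpois R)"
    and ?n = "local_mass c (normalized_levy \<nu>)"

  have em1: "emeasure \<nu> {1<..} \<noteq> \<infinity>"
  proof -
    interpret D: finite_borel_measure "density \<nu> (indicator {1<..})"
      by (rule levy_measure_density_finite[OF nu, where d = 1]) auto
    have "emeasure (density \<nu> (indicator {1<..})) UNIV = emeasure \<nu> {1<..}"
      using s by (simp add: emeasure_density sets_eq_imp_space_eq)
    then show ?thesis using D.emeasure_finite[of UNIV] by simp
  qed
  have R_eq: "emeasure R B = emeasure \<nu> B" if "B \<in> sets borel" "B \<subseteq> {c1<..}" for B
  proof -
    have "emeasure R B = (\<integral>\<^sup>+y. indicator {c1<..} y * indicator B y \<partial>\<nu>)"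
      unfolding R_def levy_above_def using that s by (intro emeasure_density) auto
    also have "\<dots> = (\<integral>\<^sup>+y. indicator B y \<partial>\<nu>)"
      using that by (intro nn_integral_cong) (auto simp: indicator_def)
    finally show ?thesis using that s by simp
  qed
  have em0: "0 < emeasure \<nu> {1<..}"
  proof -
    have "AE y in R. y \<in> {c1<..}"
      unfolding R_def levy_above_def by (subst AE_density) (auto simp: indicator_def)
    then have "emeasure R {c1<..} = emeasure R (space R)"
      by (intro emeasure_eq_AE) (auto simp: R.M_is_borel R.borel_UNIV)
    moreover have "0 < emeasure R (space R)"
      using mass by (simp add: R.emeasure_eq_measure R.borel_UNIV)
    moreover have "emeasure R {c1<..} = emeasure \<nu> {c1<..}" by (rule R_eq) auto
    ultimately have "0 < emeasure \<nu> {c1<..}" by (simp only:)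
    also have "\<dots> \<le> emeasure \<nu> {1<..}" using c1 s by (intro emeasure_mono) auto
    finally show ?thesis .
  qed
  define p where "p = measure \<nu> {1<..}"
  have p: "0 < p" using em0 em1 by (simp add: p_def measure_def enn2real_positive_iff top.not_eq_extremum)
  have n_dist: "real_distribution (normalized_levy \<nu>)"
    using prob_space_uniform_measure[of \<nu> "{1<..}"] em0 em1 s
    by (simp add: normalized_levy_def real_distribution_def real_distribution_axioms_def)
  interpret n: real_distribution "normalized_levy \<nu>" by (rule n_dist)
  have nu_r: "local_mass c \<nu> x = ?r x" if "c1 \<le> x" for x
  proof -
    have "emeasure R {x<..x + c} = emeasure \<nu> {x<..x + c}" by (rule R_eq) (use that in auto)
    then show ?thesis by (simp add: local_mass_def measure_def)
  qed
  have r_n: "?r x = p * ?n x" if "c1 \<le> x" for x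
  proof -
    have "{1<..} \<inter> {x<..x + c} = {x<..x + c}" using that c1 by auto
    then have "?n x = measure \<nu> {x<..x + c} / p"
      unfolding local_mass_def normalized_levy_def p_def
      using em0 em1 s by (subst measure_uniform_measure) auto
    then show ?thesis using nu_r[OF that] p by (simp add: local_mass_def)
  qed
  have ev_r_n: "\<forall>\<^sub>F x in at_top. ?r x = p * ?n x"
    using eventually_ge_at_top[of c1] by eventually_elim (rule r_n)
  have ev_nu_r: "\<forall>\<^sub>F x in at_top. local_mass c \<nu> x = ?r x"
    using eventually_ge_at_top[of c1] by eventually_elim (rule nu_r)
  have ev_n_r: "\<forall>\<^sub>F x in at_top. ?n x = 1 / p * ?r x"
    using ev_r_n by eventually_elim (use p in simp)

  \<comment> \<open>the condition to which all three assertions are reduced\<close>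
  define good where "good \<longleftrightarrow> long_tailed ?r \<and> negligible_pairs c R R ?r"

  have lt_iff: "long_tailed ?n \<longleftrightarrow> long_tailed ?r"
    using long_tailed_scale[of ?n p ?r] long_tailed_scale[of ?r "1 / p" ?n] p ev_r_n ev_n_r
      R.borel_measurable_local_mass[OF c] n.borel_measurable_local_mass[OF c] by auto
  have S_iff: "normalized_levy \<nu> \<in> S_Delta c \<longleftrightarrow> good"
  proof
    assume S: "normalized_levy \<nu> \<in> S_Delta c"
    then have "long_tailed ?n" by (simp add: S_Delta_def L_Delta_def)
    moreover have "negligible_pairs c R R ?n"
      by (rule negligible_pairs_transfer[OF c n.finite_borel_measure_M R_fin R_fin
            S_Delta_imp_negligible_pairs[OF c S] p, where T = c1]) (use r_n in auto)
    then have "negligible_pairs c R R ?r"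
    proof (rule negligible_pairs_mono)
      show "0 < 1 / p" using p by simp
      show "\<forall>\<^sub>F x in at_top. ?n x \<le> 1 / p * ?r x" using ev_n_r by eventually_elim simp
    qed
    ultimately show good using lt_iff by (simp add: good_def)
  next
    assume good: good
    show "normalized_levy \<nu> \<in> S_Delta c"
    proof (rule negligible_pairs_imp_S_Delta[OF c])
      show "normalized_levy \<nu> \<in> L_Delta c" using good lt_iff n_dist by (simp add: L_Delta_def good_def)
      have "{1<..} \<inter> {..<0} = ({} :: real set)" by auto
      then show "measure (normalized_levy \<nu>) {..<0} = 0"
        unfolding normalized_levy_def using em0 em1 s by (subst measure_uniform_measure) auto
      have "negligible_pairs c (normalized_levy \<nu>) (normalized_levy \<nu>) ?r"
      proof (rule negligible_pairs_transfer[OF c R_fin n.finite_borel_measure_M n.finite_borel_measure_M, where T = c1 and K = "1 / p"])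
        show "negligible_pairs c R R ?r" using good by (simp add: good_def)
        show "0 < 1 / p" using p by simp
      qed (use r_n p in auto)
      then show "negligible_pairs c (normalized_levy \<nu>) (normalized_levy \<nu>) ?n"
      proof (rule negligible_pairs_mono[OF _ p])
        show "\<forall>\<^sub>F x in at_top. ?r x \<le> p * ?n x" using ev_r_n by eventually_elim simp
      qed
    qed
  qed

  note lower = convolution_lower_shift[OF c eta(1) P.m_fin an, folded mu]

  have i_good: good if i: "\<mu> \<in> S_Delta c"
  proof -
    have g_lt: "long_tailed ?g" using i by (simp add: S_Delta_def L_Delta_def)
    note gpos = long_tailed_pos[OF g_lt]
    have le: "asymp_le ?m ?g"
    proof (rule asymp_le_long_tailed_right[OF g_lt _ lower])
      show "asymp_le ?g ?g" using asymp_equiv_iff_asymp_le[OF gpos] asymp_equiv_refl by blast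
    qed
    have "asymp_le ?g ?m"
      unfolding mu
    proof (rule convolution_upper_shift[OF c eta P.m.real_distribution_axioms an])
      show "long_tailed (local_mass c (\<eta> \<star> cpois R))" using g_lt by (simp add: mu)
      show "\<forall>\<^sub>F x in at_top. ?m x \<le> 2 * local_mass c (\<eta> \<star> cpois R) x"
        using asymp_leD[OF le, of 1] by (simp add: mu)
    qed
    with le have m_g: "?m \<sim>[at_top] ?g" using asymp_equiv_iff_asymp_le[OF gpos] by blast
    have m_lt: "long_tailed ?m"
      by (rule long_tailed_cong_asymp[OF g_lt P.m.borel_measurable_local_mass[OF c] _ m_g]) simp
    obtain T where T: "\<And>x. T \<le> x \<Longrightarrow> ?m x \<le> 2 * ?g x"
      using asymp_equiv_le_double(1)[OF m_g gpos] by (auto simp: eventually_at_top_linorder)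
    have "negligible_pairs c (cpois R) (cpois R) ?g"
      by (rule negligible_pairs_transfer[OF c mu.finite_borel_measure_M P.m_fin P.m_fin
            S_Delta_imp_negligible_pairs[OF c i] _ T T]) auto
    then have m_neg: "negligible_pairs c (cpois R) (cpois R) ?m"
      by (rule negligible_pairs_mono[OF _ _ asymp_equiv_le_double(2)[OF m_g gpos]]) simp
    have r_m: "?r \<sim>[at_top] ?m" by (rule P.r_asymp_lm[OF m_lt m_neg])
    note mpos = long_tailed_pos[OF m_lt]
    have r_lt: "long_tailed ?r"
      by (rule long_tailed_cong_asymp[OF m_lt R.borel_measurable_local_mass[OF c] _ r_m]) simp
    obtain T' where T': "\<And>x. T' \<le> x \<Longrightarrow> ?r x \<le> 2 * ?m x"
      using asymp_equiv_le_double(1)[OF r_m mpos] by (auto simp: eventually_at_top_linorder)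
    have "negligible_pairs c R R ?m"
      by (rule negligible_pairs_transfer[OF c P.m_fin R_fin R_fin m_neg _ T' T']) auto
    then have "negligible_pairs c R R ?r"
      by (rule negligible_pairs_mono[OF _ _ asymp_equiv_le_double(2)[OF r_m mpos]]) simp
    with r_lt show good by (simp add: good_def)
  qed

  have ad: "almost_decreasing ?m" by (rule asymp_nonincreasing_imp_almost_decreasing[OF an])
  have good_i: "\<mu> \<in> S_Delta c \<inter> D_Delta c" and good_asymp: "?g \<sim>[at_top] ?r" if good
    using P.light_perturbation_S_Delta[OF eta _ _ ad] that unfolding good_def mu by auto

  have good_iii: "normalized_levy \<nu> \<in> L_Delta c \<inter> D_Delta c \<and> ?g \<sim>[at_top] local_mass c \<nu>" if good: good
  proof -
    have r_lt: "long_tailed ?r" and neg: "negligible_pairs c R R ?r" using good by (simp_all add: good_def)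
    note rpos = long_tailed_pos[OF r_lt]
    have m_r: "?m \<sim>[at_top] ?r" by (rule P.lm_asymp_r[OF r_lt neg])
    have "almost_decreasing ?n"
    proof (rule almost_decreasing_transfer[OF ad, where a = "2 / p" and b = "2 * p"])
      show "\<forall>\<^sub>F x in at_top. ?n x \<le> 2 / p * ?m x"
        using asymp_equiv_le_double(2)[OF m_r rpos] ev_r_n
        by eventually_elim (use p in \<open>simp add: field_simps\<close>)
      show "\<forall>\<^sub>F x in at_top. ?m x \<le> 2 * p * ?n x"
        using asymp_equiv_le_double(1)[OF m_r rpos] ev_r_n by eventually_elim simp
    qed (use p in auto)
    moreover have "?g \<sim>[at_top] local_mass c \<nu>"
      by (rule asymp_equiv_trans[OF good_asymp[OF good] asymp_equiv_symI[OF asymp_equiv_refl_ev[OF ev_nu_r]]])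
    ultimately show ?thesis
      using r_lt lt_iff n_dist by (simp add: L_Delta_def D_Delta_def)
  qed

  have iii_good: good if L: "normalized_levy \<nu> \<in> L_Delta c" and asymp: "?g \<sim>[at_top] local_mass c \<nu>"
  proof -
    have r_lt: "long_tailed ?r" using L lt_iff by (simp add: L_Delta_def)
    note rpos = long_tailed_pos[OF r_lt]
    have "local_mass c \<nu> \<sim>[at_top] ?r" by (rule asymp_equiv_refl_ev[OF ev_nu_r])
    with asymp have "?g \<sim>[at_top] ?r" by (rule asymp_equiv_trans)
    then have "asymp_le ?g ?r" using asymp_equiv_iff_asymp_le[OF rpos] by blast
    then have "asymp_le ?m ?r" by (rule asymp_le_long_tailed_right[OF r_lt _ lower])
    from P.negligible_pairs_if_asymp_le[OF r_lt this] r_lt show good by (simp add: good_def)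
  qed

  show ?thesis using S_iff i_good good_i good_iii iii_good em0 by blast
qed

end
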